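(* For $m=2$ and $N=1$, $\mathrm{HH}^*(\Lambda_1)$ is a finitely generated $\mathbb{K}$-algebra with generators: - $1,\ a_0\bar a_0,\ a_1\bar a_1$ in degree $0$; - $\varphi_{1,0},\ \varphi_{1,-1},\ \psi_{1,0},\ \psi_{1,-1}$ in degree $1$; - $\chi_{2,0},\ \chi_{2,1},\ \chi_{2,-1}$ in degree $2$.
   Context: Let $\mathbb{K}$ be a field. Here $m=2$: let $\mathcal{Q}$ be the quiver with vertices $0,1$ and, for each $i\in\{0,1\}$ (indices modulo $2$), arrows $a_i:i\to i+1$ and $\bar a_i:i+1\to i$. Paths are written from left to right; $e_i$ is the trivial path at $i$. $\Lambda_1=\mathbb{K}\mathcal{Q}/I_1$ where $I_1$ is generated by $a_ia_{i+1}$, $\bar a_{i-1}\bar a_{i-2}$, $a_i\bar a_i-\bar a_{i-1}a_{i-1}$ for all $i$. $\mathrm{HH}^*(\Lambda_1)=\mathrm{Ext}^*_{\Lambda_1^e}(\Lambda_1,\Lambda_1)$ with the Yoneda product; $\mathrm{HH}^0(\Lambda_1)$ is identified with the centre $Z(\Lambda_1)$. Write $\otimes=\otimes_{\mathbb{K}}$. A minimal projective bimodule resolution of $\Lambda_1$ is $(P^*,\partial^* )$ with $P^n=\bigoplus_{i=0}^{1}\bigoplus_{r=0}^n\Lambda_1e_i\otimes e_{i+n-2r}\Lambda_1$. Write $e_i\otimes_r e_{i+n-2r}$ for the generator of the $(i,r)$-summand of $P^n$ (first index modulo $2$; generators in $P^{n-1}$ with tensor subscript $-1$ or $n$ are $0$).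 Unsubscripted $a,\bar a$ denote the arrows of that type making the expression composable. $\partial^0$ is multiplication, and for $n\geq1$, $\partial^n(e_i\otimes_r e_{i+n-2r})=e_i\otimes_r e_{i+n-1-2r}a+(-1)^ne_i\otimes_{r-1}e_{i+n+1-2r}\bar a+(-1)^{n+r}\big(ae_{i+1}\otimes_re_{i+n-2r}+\bar ae_{i-1}\otimes_{r-1}e_{i+n-2r}\big)$. Classes in $\mathrm{HH}^n(\Lambda_1)$ are represented by cocycles in $\mathrm{Hom}_{\Lambda_1^e}(P^n,\Lambda_1)$; for a cocycle only the non-zero images of generators are listed. For $i\in\{0,1\}$ and $k\in\mathbb{Z}$, $e_i\otimes e_{i+k}\in P^n$ means $e_i\otimes_r e_{i+n-2r}$ with $r=(n-k)/2$ ($k$ is not reduced modulo $2$). For $i=0,1$: $\varphi_{1,0}$: $e_i\otimes e_{i+1}\mapsto a_i$; $\varphi_{1,-1}$: $e_i\otimes e_{i-1}\mapsto(-1)^ia_i$; $\psi_{1,0}$: $e_i\otimes e_{i+1}\mapsto(-1)^i\bar a_{i+1}$; $\psi_{1,-1}$: $e_i\otimes e_{i-1}\mapsto\bar a_{i+1}$; $\chi_{2,0}$: $e_i\otimes e_i\mapsto(-1)^ie_i$; $\chi_{2,1}$: $e_i\otimes e_{i+2}\mapsto e_i$; $\chi_{2,-1}$: $e_i\otimes e_{i-2}\mapsto e_i$. The first subscript of each symbol is its cohomological degree.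
   Formalization: The field K is assumed to have characteristic different from 2; in characteristic 2 the claim fails, since φ_{1,0}+ψ_{1,-1} is then a coboundary, so the listed elements generate at most 3 dimensions of the 4-dimensional HH^1. *)

theory Defs
  imports
    "HOL-Library.Numeral_Type"
    "HOL-Library.Function_Algebras"
    "HOL-Library.Poly_Mapping"
    "HOL-Algebra.Algebraic_Closure_Type"
begin

section \<open>The path algebra of the quiver\<close>

text \<open>
  The vertices are the elements of the type \<open>2\<close>, the integers modulo 2, so that arithmetic on
  vertices is automatically taken modulo 2.  \<open>Arr i\<close> is the arrow \<open>a\<^sub>i : i \<rightarrow> i + 1\<close> and
  \<open>Bar i\<close> is the arrow from \<open>i + 1\<close> to \<open>i\<close> written with a bar.
\<close>

datatype arrow = Arr "2" | Bar "2"

fun src :: "arrow \<Rightarrow> 2" where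
  "src (Arr i) = i"
| "src (Bar i) = i + 1"

fun tgt :: "arrow \<Rightarrow> 2" where
  "tgt (Arr i) = i + 1"
| "tgt (Bar i) = i"

fun is_path :: "2 \<Rightarrow> arrow list \<Rightarrow> bool" where
  "is_path v [] \<longleftrightarrow> True"
| "is_path v (x # xs) \<longleftrightarrow> src x = v \<and> is_path (tgt x) xs"

fun path_end :: "2 \<Rightarrow> arrow list \<Rightarrow> 2" where
  "path_end v [] = v"
| "path_end v (x # xs) = path_end (tgt x) xs"

lemma path_end_append: "path_end v (xs @ ys) = path_end (path_end v xs) ys"
  by (induction xs arbitrary: v) auto

lemma is_path_append: "is_path v (xs @ ys) \<longleftrightarrow> is_path v xs \<and> is_path (path_end v xs) ys"
  by (induction xs arbitrary: v) auto

text \<open>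
  A path is a pair of its initial vertex and its list of arrows, read from left to right; the
  trivial paths are the pairs \<open>(v, [])\<close>.  An element of the path algebra is given by its
  coefficients with respect to the basis of paths.
\<close>

typedef (overloaded) 'k path_alg =
  "{f :: 2 \<times> arrow list \<Rightarrow> 'k::field.
      finite {p. f p \<noteq> 0} \<and> (\<forall>v xs. f (v, xs) \<noteq> 0 \<longrightarrow> is_path v xs)}"
  morphisms coeff Path_alg
  by (rule exI[of _ "\<lambda>_. 0"]) simp

setup_lifting type_definition_path_alg

lift_definition path_scale :: "'k::field \<Rightarrow> 'k path_alg \<Rightarrow> 'k path_alg"
  is "\<lambda>c f p. c * f p"
  by (auto intro: rev_finite_subset)

lift_definition path_elt :: "2 \<Rightarrow> arrow list \<Rightarrow> 'k::field path_alg"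
  is "\<lambda>v xs p. if p = (v, xs) \<and> is_path v xs then 1 else 0"
  by (auto intro: rev_finite_subset[of "{(v, xs)}" for v xs])

definition path_conv ::
  "(2 \<times> arrow list \<Rightarrow> 'k::field) \<Rightarrow> (2 \<times> arrow list \<Rightarrow> 'k) \<Rightarrow> 2 \<times> arrow list \<Rightarrow> 'k" where
  "path_conv f g = (\<lambda>(v, xs).
     \<Sum>k\<le>length xs. f (v, take k xs) * g (path_end v (take k xs), drop k xs))"

lemma path_conv_nonzeroD:
  assumes "path_conv f g (v, xs) \<noteq> 0"
  shows "\<exists>ys zs. xs = ys @ zs \<and> f (v, ys) \<noteq> 0 \<and> g (path_end v ys, zs) \<noteq> 0"
proof -
  have "(\<Sum>k\<le>length xs. f (v, take k xs) * g (path_end v (take k xs), drop k xs)) \<noteq> 0"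
    using assms by (simp add: path_conv_def)
  then obtain k where "f (v, take k xs) * g (path_end v (take k xs), drop k xs) \<noteq> 0"
    by (meson sum.not_neutral_contains_not_neutral)
  then show ?thesis
    by (intro exI[of _ "take k xs"] exI[of _ "drop k xs"]) auto
qed

lemma path_conv_assoc: "path_conv (path_conv f g) h = path_conv f (path_conv g h)"
proof (intro ext, clarify)
  fix v :: 2 and xs :: "arrow list"
  let ?n = "length xs"
  let ?t = "\<lambda>j i. f (v, take j xs) * (g (path_end v (take j xs), take i (drop j xs))
                  * h (path_end v (take (j + i) xs), drop (j + i) xs))"
  have left: "path_conv f g (v, take k xs) * h (path_end v (take k xs), drop k xs)
      = (\<Sum>j\<le>k. ?t j (k - j))" if "k \<le> ?n" for k
  proof -
    have "path_conv f g (v, take k xs) * h (path_end v (take k xs), drop k xs)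
        = (\<Sum>j\<le>k. f (v, take j (take k xs))
              * g (path_end v (take j (take k xs)), drop j (take k xs))
              * h (path_end v (take k xs), drop k xs))"
      using that by (simp add: path_conv_def sum_distrib_right min_def)
    also have "\<dots> = (\<Sum>j\<le>k. ?t j (k - j))"
      by (rule sum.cong) (simp_all add: min_def drop_take mult.assoc)
    finally show ?thesis .
  qed
  have right: "f (v, take j xs) * path_conv g h (path_end v (take j xs), drop j xs)
      = (\<Sum>i\<le>?n - j. ?t j i)" for j
  proof -
    have "f (v, take j xs) * path_conv g h (path_end v (take j xs), drop j xs)
        = (\<Sum>i\<le>?n - j. f (v, take j xs)
              * (g (path_end v (take j xs), take i (drop j xs))
              * h (path_end (path_end v (take j xs)) (take i (drop j xs)), drop i (drop j xs))))"
      by (simp add: path_conv_def sum_distrib_left)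
    also have "\<dots> = (\<Sum>i\<le>?n - j. ?t j i)"
    proof (rule sum.cong)
      fix i
      have "drop i (drop j xs) = drop (j + i) xs"
        by (simp add: add.commute)
      moreover have "path_end (path_end v (take j xs)) (take i (drop j xs))
          = path_end v (take (j + i) xs)"
        by (simp only: path_end_append[symmetric] take_add[symmetric])
      ultimately show "f (v, take j xs)
              * (g (path_end v (take j xs), take i (drop j xs))
              * h (path_end (path_end v (take j xs)) (take i (drop j xs)), drop i (drop j xs)))
          = ?t j i"
        by (simp only:)
    qed (rule refl)
    finally show ?thesis .
  qed
  have "path_conv (path_conv f g) h (v, xs) = (\<Sum>k\<le>?n. \<Sum>j\<le>k. ?t j (k - j))"
    unfolding path_conv_def[of "path_conv f g"] prod.case
    by (rule sum.cong) (use left in simp_all)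
  also have "\<dots> = (\<Sum>(j, i) \<in> {(j, i). j + i \<le> ?n}. ?t j i)"
    by (rule sum.triangle_reindex_eq[symmetric])
  also have "{(j, i). j + i \<le> ?n} = Sigma {..?n} (\<lambda>j. {..?n - j})"
    by auto
  also have "(\<Sum>(j, i) \<in> Sigma {..?n} (\<lambda>j. {..?n - j}). ?t j i) = (\<Sum>j\<le>?n. \<Sum>i\<le>?n - j. ?t j i)"
    by (rule sum.Sigma[symmetric]) simp_all
  also have "\<dots> = path_conv f (path_conv g h) (v, xs)"
    unfolding path_conv_def[of f] prod.case right ..
  finally show "path_conv (path_conv f g) h (v, xs) = path_conv f (path_conv g h) (v, xs)" .
qed

lemma path_conv_const_left:
  "path_conv (\<lambda>(v, xs). if xs = [] then c else 0) f (v, xs) = c * f (v, xs)"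
proof -
  have "path_conv (\<lambda>(v, xs). if xs = [] then c else 0) f (v, xs)
      = (\<Sum>k\<le>length xs. if k = 0 then c * f (v, xs) else 0)"
    unfolding path_conv_def prod.case by (rule sum.cong) auto
  then show ?thesis by simp
qed

lemma path_conv_const_right:
  "path_conv f (\<lambda>(v, xs). if xs = [] then c else 0) (v, xs) = f (v, xs) * c"
proof -
  have "path_conv f (\<lambda>(v, xs). if xs = [] then c else 0) (v, xs)
      = (\<Sum>k\<le>length xs. if k = length xs then f (v, xs) * c else 0)"
    unfolding path_conv_def prod.case by (rule sum.cong) auto
  then show ?thesis by simp
qed

instantiation path_alg :: (field) ring_1
begin

lift_definition zero_path_alg :: "'a path_alg" is "\<lambda>_. 0" by simp

lift_definition one_path_alg :: "'a path_alg" is "\<lambda>(v, xs). if xs = [] then 1 else 0"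
proof (intro conjI)
  have "{p. (case p of (v :: 2, xs :: arrow list) \<Rightarrow> if xs = [] then 1 else 0) \<noteq> (0 :: 'a)}
      \<subseteq> UNIV \<times> {[]}"
    by (auto split: if_splits)
  then show "finite {p. (case p of (v :: 2, xs :: arrow list) \<Rightarrow>
      if xs = [] then 1 else 0) \<noteq> (0 :: 'a)}"
    by (rule finite_subset) simp
qed auto

lift_definition plus_path_alg :: "'a path_alg \<Rightarrow> 'a path_alg \<Rightarrow> 'a path_alg"
  is "\<lambda>f g p. f p + g p"
proof (intro conjI allI impI)
  fix f g :: "2 \<times> arrow list \<Rightarrow> 'a"
  assume *: "finite {p. f p \<noteq> 0} \<and> (\<forall>v xs. f (v, xs) \<noteq> 0 \<longrightarrow> is_path v xs)"
    "finite {p. g p \<noteq> 0} \<and> (\<forall>v xs. g (v, xs) \<noteq> 0 \<longrightarrow> is_path v xs)"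
  show "finite {p. f p + g p \<noteq> 0}"
    by (rule finite_subset[of _ "{p. f p \<noteq> 0} \<union> {p. g p \<noteq> 0}"]) (use * in auto)
  show "is_path v xs" if "f (v, xs) + g (v, xs) \<noteq> 0" for v xs
    using that * by (cases "f (v, xs) = 0") auto
qed

lift_definition uminus_path_alg :: "'a path_alg \<Rightarrow> 'a path_alg" is "\<lambda>f p. - f p" by simp

lift_definition times_path_alg :: "'a path_alg \<Rightarrow> 'a path_alg \<Rightarrow> 'a path_alg" is path_conv
proof (intro conjI allI impI)
  fix f g :: "2 \<times> arrow list \<Rightarrow> 'a"
  assume *: "finite {p. f p \<noteq> 0} \<and> (\<forall>v xs. f (v, xs) \<noteq> 0 \<longrightarrow> is_path v xs)"
    "finite {p. g p \<noteq> 0} \<and> (\<forall>v xs. g (v, xs) \<noteq> 0 \<longrightarrow> is_path v xs)"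
  have "{p. path_conv f g p \<noteq> 0}
      \<subseteq> (\<lambda>((v, ys), (w, zs)). (v, ys @ zs)) ` ({p. f p \<noteq> 0} \<times> {p. g p \<noteq> 0})"
    by (force dest: path_conv_nonzeroD simp: image_iff)
  then show "finite {p. path_conv f g p \<noteq> 0}"
    by (rule finite_subset) (use * in auto)
  show "is_path v xs" if "path_conv f g (v, xs) \<noteq> 0" for v xs
    using path_conv_nonzeroD[OF that] * by (auto simp: is_path_append)
qed

definition minus_path_alg :: "'a path_alg \<Rightarrow> 'a path_alg \<Rightarrow> 'a path_alg" where
  "x - y = x + - (y :: 'a path_alg)"

instance
proof
  fix x y z :: "'a path_alg"
  show "x + y + z = x + (y + z)" by transfer (simp add: add.assoc)
  show "x + y = y + x" by transfer (simp add: add.commute)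
  show "0 + x = x" by transfer simp
  show "- x + x = 0" by transfer simp
  show "x - y = x + - y" by (simp add: minus_path_alg_def)
  show "x * y * z = x * (y * z)" by transfer (rule path_conv_assoc)
  show "(x + y) * z = x * z + y * z"
    by transfer (auto simp: path_conv_def fun_eq_iff distrib_right sum.distrib)
  show "x * (y + z) = x * y + x * z"
    by transfer (auto simp: path_conv_def fun_eq_iff distrib_left sum.distrib)
  show "1 * x = x"
    by transfer (simp add: fun_eq_iff path_conv_const_left)
  show "x * 1 = x"
    by transfer (simp add: fun_eq_iff path_conv_const_right)
  show "(0 :: 'a path_alg) \<noteq> 1"
    by transfer (auto simp: fun_eq_iff)
qed

end

inductive_set ideal_gen :: "'a::ring set \<Rightarrow> 'a set" for S where
  gen: "x \<in> S \<Longrightarrow> x \<in> ideal_gen S"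
| zero: "0 \<in> ideal_gen S"
| add: "x \<in> ideal_gen S \<Longrightarrow> y \<in> ideal_gen S \<Longrightarrow> x + y \<in> ideal_gen S"
| uminus: "x \<in> ideal_gen S \<Longrightarrow> - x \<in> ideal_gen S"
| mult_left: "x \<in> ideal_gen S \<Longrightarrow> u * x \<in> ideal_gen S"
| mult_right: "x \<in> ideal_gen S \<Longrightarrow> x * u \<in> ideal_gen S"

lemma ideal_gen_diff: "x \<in> ideal_gen S \<Longrightarrow> y \<in> ideal_gen S \<Longrightarrow> x - y \<in> ideal_gen S"
  using ideal_gen.add[of x S "- y"] ideal_gen.uminus[of y S] by simp

lemma ideal_gen_equivp: "equivp (\<lambda>x y. x - y \<in> ideal_gen S)"
proof (rule equivpI)
  show "reflp (\<lambda>x y. x - y \<in> ideal_gen S)"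
    by (auto intro!: reflpI ideal_gen.zero)
  show "symp (\<lambda>x y. x - y \<in> ideal_gen S)"
    by (rule sympI) (metis ideal_gen.uminus minus_diff_eq)
  show "transp (\<lambda>x y. x - y \<in> ideal_gen S)"
  proof (rule transpI)
    fix x y z assume "x - y \<in> ideal_gen S" "y - z \<in> ideal_gen S"
    then have "(x - y) + (y - z) \<in> ideal_gen S" by (rule ideal_gen.add)
    then show "x - z \<in> ideal_gen S" by simp
  qed
qed

lemma ideal_gen_cong_add:
  assumes "x - x' \<in> ideal_gen S" "y - y' \<in> ideal_gen S"
  shows "(x + y) - (x' + y') \<in> ideal_gen S"
  using ideal_gen.add[OF assms] by (simp add: algebra_simps)

lemma ideal_gen_cong_uminus:
  assumes "x - x' \<in> ideal_gen S"
  shows "(- x) - (- x') \<in> ideal_gen S"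
  using ideal_gen.uminus[OF assms] by simp

lemma ideal_gen_cong_times:
  assumes "x - x' \<in> ideal_gen S" "y - y' \<in> ideal_gen S"
  shows "(x * y) - (x' * y') \<in> ideal_gen S"
  using ideal_gen.add[OF ideal_gen.mult_right[OF assms(1), of y]
      ideal_gen.mult_left[OF assms(2), of x']]
  by (simp add: algebra_simps)


section \<open>The algebra $\Lambda_1$\<close>

definition relations :: "'k::field path_alg set" where
  "relations =
     (\<Union>i. {path_elt i [Arr i] * path_elt (i + 1) [Arr (i + 1)],
           path_elt i [Bar (i - 1)] * path_elt (i - 1) [Bar (i - 2)],
           path_elt i [Arr i] * path_elt (i + 1) [Bar i]
             - path_elt i [Bar (i - 1)] * path_elt (i - 1) [Arr (i - 1)]})"

definition lam_rel :: "'k::field path_alg \<Rightarrow> 'k path_alg \<Rightarrow> bool" where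
  "lam_rel x y \<longleftrightarrow> x - y \<in> ideal_gen relations"

quotient_type (overloaded) 'k lam = "'k::field path_alg" / lam_rel
  unfolding lam_rel_def by (rule ideal_gen_equivp)

lemma coeff_mult_trivial: "coeff (x * y) (v, []) = coeff x (v, []) * coeff y (v, [])"
  by (simp add: times_path_alg.rep_eq path_conv_def)

lemma coeff_diff: "coeff (x - y) p = coeff x p - coeff y p"
  unfolding minus_path_alg_def plus_path_alg.rep_eq uminus_path_alg.rep_eq
  by (rule add_uminus_conv_diff)

lemma coeff_path_elt_Cons: "coeff (path_elt w (x # xs)) (v, []) = 0"
  by (simp add: path_elt.rep_eq)

lemma ideal_gen_relations_trivial: "x \<in> ideal_gen relations \<Longrightarrow> coeff x (v, []) = 0"
proof (induction rule: ideal_gen.induct)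
  case (gen x)
  then show ?case
    unfolding relations_def
    by (elim UN_E insertE emptyE) (simp_all only: coeff_mult_trivial coeff_diff coeff_path_elt_Cons
        mult_zero_left mult_zero_right diff_zero)
qed (simp_all add: coeff_mult_trivial zero_path_alg.rep_eq plus_path_alg.rep_eq
      uminus_path_alg.rep_eq)

instantiation lam :: (field) ring_1
begin

lift_definition zero_lam :: "'a lam" is 0 .
lift_definition one_lam :: "'a lam" is 1 .
lift_definition plus_lam :: "'a lam \<Rightarrow> 'a lam \<Rightarrow> 'a lam" is "(+)"
  unfolding lam_rel_def by (rule ideal_gen_cong_add)
lift_definition uminus_lam :: "'a lam \<Rightarrow> 'a lam" is uminus
  unfolding lam_rel_def by (rule ideal_gen_cong_uminus)
lift_definition times_lam :: "'a lam \<Rightarrow> 'a lam \<Rightarrow> 'a lam" is "(*)"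
  unfolding lam_rel_def by (rule ideal_gen_cong_times)
definition minus_lam :: "'a lam \<Rightarrow> 'a lam \<Rightarrow> 'a lam" where "x - y = x + - (y :: 'a lam)"

instance
proof
  fix x y z :: "'a lam"
  show "x + y + z = x + (y + z)" by transfer (simp add: lam_rel_def ideal_gen.zero add.assoc)
  show "x + y = y + x" by transfer (simp add: lam_rel_def ideal_gen.zero add.commute)
  show "0 + x = x" by transfer (simp add: lam_rel_def ideal_gen.zero)
  show "- x + x = 0" by transfer (simp add: lam_rel_def ideal_gen.zero)
  show "x - y = x + - y" by (simp add: minus_lam_def)
  show "x * y * z = x * (y * z)" by transfer (simp add: lam_rel_def ideal_gen.zero mult.assoc)
  show "(x + y) * z = x * z + y * z"
    by transfer (simp add: lam_rel_def ideal_gen.zero distrib_right)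
  show "x * (y + z) = x * y + x * z"
    by transfer (simp add: lam_rel_def ideal_gen.zero distrib_left)
  show "1 * x = x" by transfer (simp add: lam_rel_def ideal_gen.zero)
  show "x * 1 = x" by transfer (simp add: lam_rel_def ideal_gen.zero)
  show "(0 :: 'a lam) \<noteq> 1"
  proof transfer
    show "\<not> lam_rel (0 :: 'a path_alg) 1"
      using ideal_gen_relations_trivial[of "0 - 1 :: 'a path_alg" 0]
      by (auto simp: lam_rel_def one_path_alg.rep_eq uminus_path_alg.rep_eq)
  qed
qed

end

lemma path_scale_one:
  "(\<lambda>p. c * (case p of (v, xs) \<Rightarrow> if xs = [] then 1 else 0))
     = (\<lambda>(v :: 2, xs :: arrow list). if xs = [] then c else (0 :: 'k::field))"
  by (auto simp: fun_eq_iff)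

lemma path_scale_conv: "path_scale c x = path_scale c 1 * x"
  by transfer (simp add: fun_eq_iff path_scale_one path_conv_const_left)

lemma path_scale_comm: "path_scale c 1 * x = x * path_scale c 1"
  by transfer
    (simp add: fun_eq_iff path_scale_one path_conv_const_left path_conv_const_right mult.commute)

lift_definition scale :: "'k::field \<Rightarrow> 'k lam \<Rightarrow> 'k lam" is path_scale
proof -
  fix c :: 'k and x y :: "'k path_alg"
  assume "lam_rel x y"
  then have "path_scale c 1 * (x - y) \<in> ideal_gen relations"
    unfolding lam_rel_def by (rule ideal_gen.mult_left)
  then show "lam_rel (path_scale c x) (path_scale c y)"
    by (simp add: lam_rel_def path_scale_conv[of c x] path_scale_conv[of c y] right_diff_distrib)
qed

lift_definition idem :: "2 \<Rightarrow> 'k::field lam" is "\<lambda>i. path_elt i []" .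
lift_definition arr :: "2 \<Rightarrow> 'k::field lam" is "\<lambda>i. path_elt i [Arr i]" .
lift_definition bar :: "2 \<Rightarrow> 'k::field lam" is "\<lambda>i. path_elt (i + 1) [Bar i]" .

lemma scale_one_mult: "scale c x = scale c 1 * x"
  by transfer (simp add: lam_rel_def path_scale_conv[symmetric] ideal_gen.zero)

lemma scale_comm: "scale c 1 * x = x * scale c 1"
  by transfer (simp add: lam_rel_def path_scale_comm ideal_gen.zero)

lemma scale_scale: "scale c (scale d x) = scale (c * d) x"
  by (transfer, simp add: lam_rel_def)
    (metis (no_types, lifting) cancel_comm_monoid_add_class.diff_cancel ideal_gen.zero
      mult.assoc path_scale.rep_eq coeff_inject ext)

lemma scale_mult_left: "scale c x * y = scale c (x * y)"
  by (metis mult.assoc scale_one_mult)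

lemma scale_mult_right: "x * scale c y = scale c (x * y)"
  by (metis mult.assoc scale_one_mult scale_comm)

lemma scale_add_left: "scale (c + d) x = scale c x + scale d x"
proof transfer
  fix c d :: 'a and x :: "'a path_alg"
  have "path_scale (c + d) x = path_scale c x + path_scale d x"
    by transfer (simp add: fun_eq_iff distrib_right)
  then show "lam_rel (path_scale (c + d) x) (path_scale c x + path_scale d x)"
    by (simp add: lam_rel_def ideal_gen.zero)
qed

lemma scale_add_right: "scale c (x + y) = scale c x + scale c y"
  by (metis scale_one_mult distrib_left)

lemma scale_zero_left: "scale 0 x = 0"
  using scale_add_left[of 0 0 x] by simp

lemma scale_one_left: "scale 1 x = x"
proof transfer
  fix x :: "'a path_alg"
  have "path_scale 1 x = x" by transfer simp
  then show "lam_rel (path_scale 1 x) x" by (simp add: lam_rel_def ideal_gen.zero)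
qed

lemma scale_zero_right: "scale c 0 = 0"
  using scale_add_right[of c 0 0] by simp


section \<open>The enveloping algebra\<close>

text \<open>
  The enveloping algebra \<open>\<Lambda>\<^sup>e\<close>, that is the tensor product over \<open>K\<close> of \<open>\<Lambda>\<close> with its opposite
  algebra, is constructed as the free vector space on the set of pairs \<open>(x, y)\<close> of elements of \<open>\<Lambda>\<close>, with
  \<open>(x, y) (u, v) = (x u, v y)\<close>, modulo the bilinearity relations.  The span of these relations is
  closed under left and right multiplication, so that it coincides with the ideal they generate.
  The free vector space is the monoid algebra \<open>'k lam env_pair \<Rightarrow>\<^sub>0 'k\<close>; the library writes the monoid of
  exponents additively, whence the additive notation for the multiplication of pairs.
\<close>

lifting_forget lam.lifting

datatype 'b env_pair = Env_Pair 'b 'b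

instantiation env_pair :: (monoid_mult) monoid_add
begin

definition zero_env_pair :: "'a env_pair" where "0 = Env_Pair 1 1"

fun plus_env_pair :: "'a env_pair \<Rightarrow> 'a env_pair \<Rightarrow> 'a env_pair" where
  "Env_Pair x y + Env_Pair u v = Env_Pair (x * u) (v * y)"

instance
proof
  fix p q r :: "'a env_pair"
  show "p + q + r = p + (q + r)" by (cases p; cases q; cases r) (simp add: mult.assoc)
  show "0 + p = p" "p + 0 = p" by (cases p; simp add: zero_env_pair_def)+
qed

end

definition bilinear_relations :: "('k::field lam env_pair \<Rightarrow>\<^sub>0 'k) set" where
  "bilinear_relations =
     {Poly_Mapping.single (Env_Pair (x + x') y) 1
        - Poly_Mapping.single (Env_Pair x y) 1 - Poly_Mapping.single (Env_Pair x' y) 1 | x x' y. True} \<union>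
     {Poly_Mapping.single (Env_Pair x (y + y')) 1
        - Poly_Mapping.single (Env_Pair x y) 1 - Poly_Mapping.single (Env_Pair x y') 1 | x y y'. True} \<union>
     {Poly_Mapping.single (Env_Pair (scale c x) y) 1 - Poly_Mapping.single (Env_Pair x y) c | c x y. True} \<union>
     {Poly_Mapping.single (Env_Pair x (scale c y)) 1 - Poly_Mapping.single (Env_Pair x y) c | c x y. True}"

definition env_rel :: "('k::field lam env_pair \<Rightarrow>\<^sub>0 'k) \<Rightarrow> ('k lam env_pair \<Rightarrow>\<^sub>0 'k) \<Rightarrow> bool" where
  "env_rel p q \<longleftrightarrow> p - q \<in> ideal_gen bilinear_relations"

quotient_type (overloaded) 'k env = "'k::field lam env_pair \<Rightarrow>\<^sub>0 'k" / env_rel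
  unfolding env_rel_def by (rule ideal_gen_equivp)

lift_definition tens :: "'k::field lam \<Rightarrow> 'k lam \<Rightarrow> 'k env"
  is "\<lambda>x y. Poly_Mapping.single (Env_Pair x y) 1" .

instantiation env :: (field) "{ring, monoid_mult}"
begin

lift_definition zero_env :: "'a env" is 0 .
lift_definition one_env :: "'a env" is 1 .
lift_definition plus_env :: "'a env \<Rightarrow> 'a env \<Rightarrow> 'a env" is "(+)"
  unfolding env_rel_def by (rule ideal_gen_cong_add)
lift_definition uminus_env :: "'a env \<Rightarrow> 'a env" is uminus
  unfolding env_rel_def by (rule ideal_gen_cong_uminus)
lift_definition times_env :: "'a env \<Rightarrow> 'a env \<Rightarrow> 'a env" is "(*)"
  unfolding env_rel_def by (rule ideal_gen_cong_times)
definition minus_env :: "'a env \<Rightarrow> 'a env \<Rightarrow> 'a env" where "x - y = x + - (y :: 'a env)"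

instance
proof
  fix x y z :: "'a env"
  show "x + y + z = x + (y + z)" by transfer (simp add: env_rel_def ideal_gen.zero add.assoc)
  show "x + y = y + x" by transfer (simp add: env_rel_def ideal_gen.zero add.commute)
  show "0 + x = x" by transfer (simp add: env_rel_def ideal_gen.zero)
  show "- x + x = 0" by transfer (simp add: env_rel_def ideal_gen.zero)
  show "x - y = x + - y" by (simp add: minus_env_def)
  show "x * y * z = x * (y * z)" by transfer (simp add: env_rel_def ideal_gen.zero mult.assoc)
  show "(x + y) * z = x * z + y * z"
    by transfer (simp add: env_rel_def ideal_gen.zero distrib_right)
  show "x * (y + z) = x * y + x * z"
    by transfer (simp add: env_rel_def ideal_gen.zero distrib_left)
  show "1 * x = x" by transfer (simp add: env_rel_def ideal_gen.zero)
  show "x * 1 = x" by transfer (simp add: env_rel_def ideal_gen.zero)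
qed

end

lemma tens_mult: "tens x y * tens u v = tens (x * u) (v * y)"
  by transfer (simp add: env_rel_def mult_single ideal_gen.zero)

fun pair_act :: "'k::field lam env_pair \<Rightarrow> 'k lam \<Rightarrow> 'k lam" where
  "pair_act (Env_Pair x y) z = x * z * y"

definition free_act :: "('k::field lam env_pair \<Rightarrow>\<^sub>0 'k) \<Rightarrow> 'k lam \<Rightarrow> 'k lam" where
  "free_act p z = (\<Sum>q\<in>Poly_Mapping.keys p. scale (Poly_Mapping.lookup p q) (pair_act q z))"

lemma pair_act_add: "pair_act (p + q) z = pair_act p (pair_act q z)"
  by (cases p; cases q) (simp add: mult.assoc)

lemma pair_act_scale: "pair_act p (scale c z) = scale c (pair_act p z)"
  by (cases p) (simp add: scale_mult_left scale_mult_right)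

lemma pair_act_plus: "pair_act p (z + w) = pair_act p z + pair_act p w"
  by (cases p) (simp add: distrib_left distrib_right)

lemma pair_act_zero: "pair_act p 0 = 0"
  by (cases p) simp

lemma free_act_superset:
  assumes "finite A" "Poly_Mapping.keys p \<subseteq> A"
  shows "free_act p z = (\<Sum>q\<in>A. scale (Poly_Mapping.lookup p q) (pair_act q z))"
  unfolding free_act_def
  by (rule sum.mono_neutral_left) (use assms in \<open>auto simp: in_keys_iff scale_zero_left\<close>)

lemma free_act_add_left: "free_act (p + q) z = free_act p z + free_act q z"
  using Poly_Mapping.keys_add[of p q]
  by (simp add: free_act_superset[of "Poly_Mapping.keys p \<union> Poly_Mapping.keys q"]
      lookup_add scale_add_left sum.distrib)

lemma free_act_zero_left: "free_act 0 z = 0"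
  by (simp add: free_act_def)

lemma free_act_uminus_left: "free_act (- p) z = - free_act p z"
  using free_act_add_left[of p "- p" z] by (simp add: free_act_zero_left eq_neg_iff_add_eq_0 add.commute)

lemma free_act_diff_left: "free_act (p - q) z = free_act p z - free_act q z"
  using free_act_add_left[of p "- q" z] by (simp add: free_act_uminus_left)

lemma free_act_single: "free_act (Poly_Mapping.single q c) z = scale c (pair_act q z)"
  by (simp add: free_act_def scale_zero_left)

lemma free_act_sum_left: "free_act (sum f A) z = (\<Sum>i\<in>A. free_act (f i) z)"
  by (induction A rule: infinite_finite_induct)
    (simp_all add: free_act_zero_left free_act_add_left)

lemma free_act_add_right: "free_act p (z + w) = free_act p z + free_act p w"
  by (simp add: free_act_def pair_act_plus scale_add_right sum.distrib)

lemma free_act_zero_right: "free_act p 0 = 0"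
  by (simp add: free_act_def pair_act_zero scale_zero_right)

lemma free_act_sum_right: "free_act p (sum f A) = (\<Sum>i\<in>A. free_act p (f i))"
  by (induction A rule: infinite_finite_induct)
    (simp_all add: free_act_zero_right free_act_add_right)

lemma poly_mapping_eq_sum_single:
  "p = (\<Sum>q\<in>Poly_Mapping.keys p. Poly_Mapping.single q (Poly_Mapping.lookup p q))"
  by (rule poly_mapping_eqI)
    (auto simp: lookup_sum lookup_single when_def in_keys_iff)

lemma free_act_mult: "free_act (p * q) z = free_act p (free_act q z)"
proof -
  let ?s = "\<lambda>p. (\<Sum>i\<in>Poly_Mapping.keys p. Poly_Mapping.single i (Poly_Mapping.lookup p i))"
  have "free_act (p * q) z = free_act (?s p * ?s q) z"
    using poly_mapping_eq_sum_single[of p] poly_mapping_eq_sum_single[of q] by simp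
  also have "\<dots> = free_act (?s p) (free_act (?s q) z)"
    by (simp add: sum_product mult_single free_act_sum_left free_act_sum_right free_act_single
        pair_act_add pair_act_scale scale_scale)
      (rule sum.swap)
  also have "\<dots> = free_act p (free_act q z)"
    using poly_mapping_eq_sum_single[of p] poly_mapping_eq_sum_single[of q] by simp
  finally show ?thesis .
qed

lemma free_act_ideal: "p \<in> ideal_gen bilinear_relations \<Longrightarrow> free_act p z = 0"
proof (induction arbitrary: z rule: ideal_gen.induct)
  case (gen x)
  then show ?case
    by (auto simp: bilinear_relations_def free_act_diff_left free_act_single scale_one_left
        scale_mult_left scale_mult_right distrib_left distrib_right)
qed (simp_all add: free_act_zero_left free_act_add_left free_act_uminus_left free_act_mult
      free_act_zero_right)

text \<open>The left \<open>\<Lambda>\<^sup>e\<close>-module structure of the bimodule \<open>\<Lambda>\<close>; see \<open>act_tens\<close> below.\<close>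

lift_definition act :: "'k::field env \<Rightarrow> 'k lam \<Rightarrow> 'k lam" is free_act
proof -
  fix p q :: "'k lam env_pair \<Rightarrow>\<^sub>0 'k"
  assume "env_rel p q"
  then have "free_act (p - q) z = 0" for z
    unfolding env_rel_def by (rule free_act_ideal)
  then show "free_act p = free_act q"
    by (simp add: fun_eq_iff free_act_diff_left)
qed

lemma act_tens: "act (tens x y) z = x * z * y"
  by transfer (simp add: free_act_single scale_one_left)


section \<open>The minimal projective bimodule resolution\<close>

text \<open>
  Bimodules over \<open>\<Lambda>\<close> are treated as left \<open>\<Lambda>\<^sup>e\<close>-modules.  An element of \<open>P\<^sup>n\<close> is the family of its
  components, that with index \<open>(i, r)\<close>, where \<open>r \<le> n\<close>, lying in
  \<open>\<Lambda> e\<^sub>i \<otimes> e\<^sub>j \<Lambda> = \<Lambda>\<^sup>e (e\<^sub>i \<otimes> e\<^sub>j)\<close> with \<open>j = i + n - 2 r\<close>.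
\<close>

type_synonym 'k chain = "2 \<Rightarrow> nat \<Rightarrow> 'k env"

definition res :: "nat \<Rightarrow> 'k::field chain set" where
  "res n = {x. \<forall>i r. if r \<le> n
     then x i r \<in> range (\<lambda>t. t * tens (idem i) (idem (i + of_int (int n - 2 * int r))))
     else x i r = 0}"

definition lmul :: "'k::field env \<Rightarrow> 'k chain \<Rightarrow> 'k chain" where
  "lmul t x = (\<lambda>i r. t * x i r)"

text \<open>
  \<open>res_gen n i r\<close> is the generator of the summand \<open>(i, r)\<close> of \<open>P\<^sup>n\<close>; it is \<open>0\<close> if \<open>r < 0\<close> or
  \<open>r > n\<close>.
\<close>

definition res_gen :: "nat \<Rightarrow> 2 \<Rightarrow> int \<Rightarrow> 'k::field chain" where
  "res_gen n i r = (\<lambda>i' r'. if i' = i \<and> int r' = r \<and> r' \<le> n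
     then tens (idem i) (idem (i + of_int (int n - 2 * r))) else 0)"

text \<open>
  The value of the differential of degree \<open>n \<ge> 1\<close> on the generator \<open>(i, r)\<close>.  Multiplication by
  \<open>x \<otimes> 1\<close> is left multiplication by \<open>x\<close>, and multiplication by \<open>1 \<otimes> x\<close> is right multiplication
  by \<open>x\<close>.
\<close>

definition diff_gen :: "nat \<Rightarrow> 2 \<Rightarrow> int \<Rightarrow> 'k::field chain" where
  "diff_gen n i r =
     lmul (tens 1 (arr (i + of_int (int n - 1 - 2 * r)))) (res_gen (n - 1) i r)
     + lmul ((- 1) ^ n)
         (lmul (tens 1 (bar (i + of_int (int n - 2 * r)))) (res_gen (n - 1) i (r - 1)))
     + lmul ((- 1) ^ (n + nat r))
         (lmul (tens (arr i) 1) (res_gen (n - 1) (i + 1) r)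
          + lmul (tens (bar (i - 1)) 1) (res_gen (n - 1) (i - 1) (r - 1)))"

definition diff :: "nat \<Rightarrow> 'k::field chain \<Rightarrow> 'k chain" where
  "diff n x = (\<Sum>i\<in>UNIV. \<Sum>r\<le>n. lmul (x i r) (diff_gen n i (int r)))"

text \<open>The multiplication map from \<open>P\<^sup>0\<close> to \<open>\<Lambda>\<close>.\<close>

definition aug :: "'k::field chain \<Rightarrow> 'k lam" where
  "aug x = (\<Sum>i\<in>UNIV. act (x i 0) 1)"


section \<open>Hochschild cohomology\<close>

text \<open>
  \<open>HH\<^sup>n\<close> is \<open>Ext\<close> of degree \<open>n\<close> of \<open>\<Lambda>\<close> with itself over \<open>\<Lambda>\<^sup>e\<close>, computed from the projective
  resolution above.  Homomorphisms defined on \<open>P\<^sup>n\<close> are extended by \<open>0\<close> to the whole type, so that they are determined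
  by their restriction to \<open>P\<^sup>n\<close>.
\<close>

definition extend0 :: "nat \<Rightarrow> ('k::field chain \<Rightarrow> 'm::zero) \<Rightarrow> 'k chain \<Rightarrow> 'm" where
  "extend0 n f = (\<lambda>x. if x \<in> res n then f x else 0)"

definition cochains :: "nat \<Rightarrow> ('k::field chain \<Rightarrow> 'k lam) set" where
  "cochains n = {f.
     (\<forall>x\<in>res n. \<forall>y\<in>res n. f (x + y) = f x + f y) \<and>
     (\<forall>t. \<forall>x\<in>res n. f (lmul t x) = act t (f x)) \<and>
     (\<forall>x. x \<notin> res n \<longrightarrow> f x = 0)}"

definition res_homs :: "nat \<Rightarrow> nat \<Rightarrow> ('k::field chain \<Rightarrow> 'k chain) set" where
  "res_homs m n = {f.
     (\<forall>x\<in>res m. f x \<in> res n) \<and>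
     (\<forall>x\<in>res m. \<forall>y\<in>res m. f (x + y) = f x + f y) \<and>
     (\<forall>t. \<forall>x\<in>res m. f (lmul t x) = lmul t (f x)) \<and>
     (\<forall>x. x \<notin> res m \<longrightarrow> f x = 0)}"

definition cocycles :: "nat \<Rightarrow> ('k::field chain \<Rightarrow> 'k lam) set" where
  "cocycles n = {f \<in> cochains n. \<forall>x\<in>res (Suc n). f (diff (Suc n) x) = 0}"

fun coboundaries :: "nat \<Rightarrow> ('k::field chain \<Rightarrow> 'k lam) set" where
  "coboundaries 0 = {0}"
| "coboundaries (Suc n) = (\<lambda>g. extend0 (Suc n) (g \<circ> diff (Suc n))) ` cochains n"

text \<open>Cohomology classes are cosets of the group of coboundaries.\<close>

definition coho_class ::
  "nat \<Rightarrow> ('k::field chain \<Rightarrow> 'k lam) \<Rightarrow> ('k chain \<Rightarrow> 'k lam) set" where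
  "coho_class n f = (\<lambda>b. f + b) ` coboundaries n"

definition HH :: "nat \<Rightarrow> ('k::field chain \<Rightarrow> 'k lam) set set" where
  "HH n = coho_class n ` cocycles n"

text \<open>
  \<open>is_lift q g G\<close>: the maps \<open>G p\<close> from \<open>P\<^sup>p\<^sup>+\<^sup>q\<close> to \<open>P\<^sup>p\<close> form a chain map lifting the cocycle \<open>g\<close>
  of degree \<open>q\<close> along the resolution.
\<close>

definition is_lift ::
  "nat \<Rightarrow> ('k::field chain \<Rightarrow> 'k lam) \<Rightarrow> (nat \<Rightarrow> 'k chain \<Rightarrow> 'k chain) \<Rightarrow> bool" where
  "is_lift q g G \<longleftrightarrow>
     (\<forall>p. G p \<in> res_homs (p + q) p) \<and>
     (\<forall>x\<in>res q. aug (G 0 x) = g x) \<and>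
     (\<forall>p. \<forall>x\<in>res (Suc p + q). diff (Suc p) (G (Suc p) x) = G p (diff (Suc p + q) x))"

text \<open>
  The Yoneda product of the classes of cocycles \<open>f\<close> and \<open>g\<close> of degrees \<open>p\<close> and \<open>q\<close> is the class of
  the composite of \<open>f\<close> with the component in degree \<open>p\<close> of a lift of \<open>g\<close>.  The union over all
  representatives and all lifts is this single class, because the class of the composite does not
  depend on these choices.
\<close>

definition yoneda ::
  "nat \<Rightarrow> nat \<Rightarrow> ('k::field chain \<Rightarrow> 'k lam) set \<Rightarrow> ('k chain \<Rightarrow> 'k lam) set
     \<Rightarrow> ('k chain \<Rightarrow> 'k lam) set" where
  "yoneda p q c d =
     {h. \<exists>f\<in>c. \<exists>g\<in>d. \<exists>G. is_lift q g G \<and>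
        h \<in> coho_class (p + q) (extend0 (p + q) (f \<circ> G p))}"

text \<open>
  The algebra \<open>HH\<^sup>*\<close>, the direct sum of all \<open>HH\<^sup>n\<close>: an element is the family of its homogeneous
  components, almost all of which are zero.  The zero of \<open>HH\<^sup>n\<close> is the coset \<open>coboundaries n\<close>.
\<close>

definition homog ::
  "nat \<Rightarrow> ('k::field chain \<Rightarrow> 'k lam) \<Rightarrow> nat \<Rightarrow> ('k chain \<Rightarrow> 'k lam) set" where
  "homog n f = (\<lambda>m. if m = n then coho_class n f else coboundaries m)"

definition HH_algebra :: "('k::field, nat \<Rightarrow> ('k chain \<Rightarrow> 'k lam) set) module" where
  "HH_algebra = \<lparr>
     carrier = {z. (\<forall>n. z n \<in> HH n) \<and> finite {n. z n \<noteq> coboundaries n}},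
     monoid.mult = (\<lambda>z w n. {\<Sum>p\<le>n. h p | h. \<forall>p\<le>n. h p \<in> yoneda p (n - p) (z p) (w (n - p))}),
     one = homog 0 (extend0 0 aug),
     ring.zero = coboundaries,
     add = (\<lambda>z w n. {f + g | f g. f \<in> z n \<and> g \<in> w n}),
     module.smult = (\<lambda>c z n. {(\<lambda>x. scale c (f x)) + b | f b. f \<in> z n \<and> b \<in> coboundaries n})\<rparr>"


section \<open>The generators\<close>

text \<open>
  \<open>coch n v\<close> is the homomorphism from \<open>P\<^sup>n\<close> to \<open>\<Lambda>\<close> that maps the generator \<open>(i, r)\<close> to
  \<open>v i r\<close>, provided that this value lies in \<open>e\<^sub>i \<Lambda> e\<^sub>j\<close> with \<open>j = i + n - 2 r\<close>.
\<close>

definition coch :: "nat \<Rightarrow> (2 \<Rightarrow> nat \<Rightarrow> 'k::field lam) \<Rightarrow> 'k chain \<Rightarrow> 'k lam" where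
  "coch n v = extend0 n (\<lambda>x. \<Sum>i\<in>UNIV. \<Sum>r\<le>n. act (x i r) (v i r))"

text \<open>
  The class in \<open>HH\<^sup>n\<close> of the cochain that maps \<open>e\<^sub>i \<otimes> e\<^sub>i\<^sub>+\<^sub>k\<close> to \<open>v i\<close> for each vertex \<open>i\<close> and the other
  generators of \<open>P\<^sup>n\<close> to \<open>0\<close>.  The condition \<open>r = (n - k) / 2\<close> is an equation between integers.
\<close>

definition gen_class ::
  "nat \<Rightarrow> int \<Rightarrow> (2 \<Rightarrow> 'k::field lam) \<Rightarrow> nat \<Rightarrow> ('k chain \<Rightarrow> 'k lam) set" where
  "gen_class n k v = homog n (coch n (\<lambda>i r. if 2 * int r = int n - k then v i else 0))"

text \<open>The element of \<open>HH\<^sup>0\<close> identified with the central element \<open>z\<close>.\<close>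

definition centre_class :: "'k::field lam \<Rightarrow> nat \<Rightarrow> ('k chain \<Rightarrow> 'k lam) set" where
  "centre_class z = gen_class 0 0 (\<lambda>i. idem i * z)"

definition vsign :: "2 \<Rightarrow> 'k::field" where
  "vsign i = (if i = 0 then 1 else - 1)"

text \<open>A final \<open>m1\<close> in the following names stands for the second subscript \<open>-1\<close>.\<close>

definition phi_1_0 :: "nat \<Rightarrow> ('k::field chain \<Rightarrow> 'k lam) set" where
  "phi_1_0 = gen_class 1 1 (\<lambda>i. arr i)"
definition phi_1_m1 :: "nat \<Rightarrow> ('k::field chain \<Rightarrow> 'k lam) set" where
  "phi_1_m1 = gen_class 1 (- 1) (\<lambda>i. scale (vsign i) (arr i))"
definition psi_1_0 :: "nat \<Rightarrow> ('k::field chain \<Rightarrow> 'k lam) set" where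
  "psi_1_0 = gen_class 1 1 (\<lambda>i. scale (vsign i) (bar (i + 1)))"
definition psi_1_m1 :: "nat \<Rightarrow> ('k::field chain \<Rightarrow> 'k lam) set" where
  "psi_1_m1 = gen_class 1 (- 1) (\<lambda>i. bar (i + 1))"
definition chi_2_0 :: "nat \<Rightarrow> ('k::field chain \<Rightarrow> 'k lam) set" where
  "chi_2_0 = gen_class 2 0 (\<lambda>i. scale (vsign i) (idem i))"
definition chi_2_1 :: "nat \<Rightarrow> ('k::field chain \<Rightarrow> 'k lam) set" where
  "chi_2_1 = gen_class 2 2 (\<lambda>i. idem i)"
definition chi_2_m1 :: "nat \<Rightarrow> ('k::field chain \<Rightarrow> 'k lam) set" where
  "chi_2_m1 = gen_class 2 (- 2) (\<lambda>i. idem i)"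


section \<open>Algebras over a field and their generators\<close>

text \<open>
  The library's \<open>algebra\<close> locale requires commutativity, which is not assumed here.
\<close>

definition K_algebra :: "('k::field, 'b) module \<Rightarrow> bool" where
  "K_algebra A \<longleftrightarrow> ring A \<and> module (ring_of_type_algebra :: 'k ring) A \<and>
     (\<forall>c. \<forall>x\<in>carrier A. \<forall>y\<in>carrier A.
        (c \<odot>\<^bsub>A\<^esub> x) \<otimes>\<^bsub>A\<^esub> y = c \<odot>\<^bsub>A\<^esub> (x \<otimes>\<^bsub>A\<^esub> y) \<and>
        x \<otimes>\<^bsub>A\<^esub> (c \<odot>\<^bsub>A\<^esub> y) = c \<odot>\<^bsub>A\<^esub> (x \<otimes>\<^bsub>A\<^esub> y))"

definition K_subalgebra :: "'b set \<Rightarrow> ('k::field, 'b) module \<Rightarrow> bool" where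
  "K_subalgebra S A \<longleftrightarrow> subring S A \<and> (\<forall>c. \<forall>x\<in>S. c \<odot>\<^bsub>A\<^esub> x \<in> S)"

definition K_generated :: "('k::field, 'b) module \<Rightarrow> 'b set \<Rightarrow> 'b set" where
  "K_generated A G = \<Inter>{S. K_subalgebra S A \<and> G \<subseteq> S}"

definition finitely_generated_by :: "('k::field, 'b) module \<Rightarrow> 'b set \<Rightarrow> bool" where
  "finitely_generated_by A G \<longleftrightarrow> finite G \<and> G \<subseteq> carrier A \<and> K_generated A G = carrier A"

end

theory Submission
  imports Defs
begin

text \<open>
  Put \<open>x = a\<^sub>0 + a\<^sub>1\<close> and let \<open>y\<close> be the sum of the two arrows with a bar, so that \<open>x\<^sup>2 = y\<^sup>2 = 0\<close> and \<open>x y = y x\<close>.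
  The complex \<open>P\<close> is a twisted tensor product of the periodic bimodule resolutions for \<open>x\<close> and for \<open>y\<close>,
  and the tensor product of their contracting homotopies, which are linear on the left only, shows
  that it is exact.  Hence cocycles lift to chain maps, uniquely up to homotopy, and the Yoneda product makes
  \<open>HH\<^sup>*\<close> an associative algebra.

  The three classes of degree 2 lift to chain maps that merely shift the index \<open>r\<close> of a
  generator by 0, 1 or 2, with a sign at the vertex 1 for the shift by 1.  Multiplying the
  generators of degree 0 and 1 by these classes gives, in each degree \<open>n\<close> and for each \<open>r \<le> n\<close>, cocycles
  supported on the generators with index \<open>r\<close>; since 2 is invertible, these span all cocycles modulo coboundaries.
\<close>

section \<open>The algebra in coordinates\<close>

text \<open>The shifts are chain maps because passing from degree \<open>n\<close> to
  \<open>n + 2\<close> and from index \<open>r\<close> to \<open>r + s\<close> leaves the sign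
  \<open>(-1)^n\<close> of the differential alone and changes only \<open>(-1)^(n + r)\<close>,
  which multiplies exactly the two terms that move from vertex \<open>i\<close> to
  \<open>i + 1\<close>. The factor \<open>(-1)^(s * i)\<close> absorbs this change, so that products
  with the degree-two classes are explicit on cochains. Exactness enters because
  \<open>yoneda\<close> is a union over all lifts, which is a single coset only by the comparison of
  lifts, and because the algebra laws concern arbitrary cocycles, whose lifts are not explicit. In
  even degree the cocycle condition alone forces the normal form. In odd degree it ties the
  coefficients of \<open>arr\<close> at one index only to those of \<open>bar\<close> at the next,
  so a coboundary must first symmetrise the former; the characteristic matters there and nowhere
  else.\<close>

lemma vertex_cases: "(i::2) = 0 \<or> i = 1"
proof (cases i)
  case (of_int z)
  then have "z = 0 \<or> z = 1" by auto
  then show ?thesis using of_int by auto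
qed

lemma UNIV_vertex: "(UNIV::2 set) = {0, 1}"
  using vertex_cases by auto

lemma vertex_add_self [simp]: "(i::2) + i = 0" "i + (i + j) = j"
  using vertex_cases[of i] by (auto simp: add.assoc[symmetric])

lemma vertex_diff [simp]: "(i::2) - j = i + j"
  using vertex_cases[of i] vertex_cases[of j] by auto

lemma vertex_of_int [simp]: "(of_int (2 * r)::2) = 0" "(2::2) = 0" "2 * (i::2) = 0"
  by (simp_all only: of_int_mult of_int_numeral of_int_add one_add_one[symmetric] distrib_right mult_1 vertex_add_self mult_zero_left)

lemma coeff_mult_arrow:
  "coeff (x * y) (v, [a]) = coeff x (v, []) * coeff y (v, [a]) + coeff x (v, [a]) * coeff y (tgt a, [])"
  by (simp add: times_path_alg.rep_eq path_conv_def)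

lemma coeff_mult_arrow2:
  "coeff (x * y) (v, [a, b]) = coeff x (v, []) * coeff y (v, [a, b])
     + coeff x (v, [a]) * coeff y (tgt a, [b]) + coeff x (v, [a, b]) * coeff y (tgt b, [])"
  by (simp add: times_path_alg.rep_eq path_conv_def eval_nat_numeral atMost_Suc add_ac)

text \<open>The two paths summed here are identified by the commutation relation. Only the sum of
  their coefficients is constant on classes; it becomes the socle coordinate of the algebra.\<close>

definition path_coord_s :: "2 \<Rightarrow> 'k::field path_alg \<Rightarrow> 'k" where
  "path_coord_s i x = coeff x (i, [Arr i, Bar i]) + coeff x (i, [Bar (i + 1), Arr (i + 1)])"

lemma path_coord_s_mult:
  "path_coord_s i (x * y) = coeff x (i, []) * path_coord_s i y + path_coord_s i x * coeff y (i, [])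
     + coeff x (i, [Arr i]) * coeff y (i + 1, [Bar i])
     + coeff x (i, [Bar (i + 1)]) * coeff y (i + 1, [Arr (i + 1)])"
  by (simp add: path_coord_s_def coeff_mult_arrow2 algebra_simps)

lemma ideal_gen_relations_coord:
  assumes "x \<in> ideal_gen relations"
  shows "coeff x (i, [a]) = 0" "path_coord_s i x = 0"
proof -
  \<comment> \<open>The claims are proved jointly because the product rule for
    \<open>path_coord_s\<close> involves the coefficients of arrows at both vertices.\<close>
  have "(\<forall>i a. coeff x (i, [a]) = 0) \<and> (\<forall>i. path_coord_s i x = 0)"
    using assms
  proof (induction rule: ideal_gen.induct)
    case (gen x)
    then show ?case
      unfolding relations_def
      by (elim UN_E insertE emptyE)
        (auto simp: path_coord_s_def coeff_mult_arrow coeff_mult_arrow2 coeff_diff path_elt.rep_eq add.assoc)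
  next
    case (mult_left x u)
    then show ?case
      using ideal_gen_relations_trivial[of x] by (auto simp: coeff_mult_arrow path_coord_s_mult)
  next
    case (mult_right x u)
    then show ?case
      using ideal_gen_relations_trivial[of x] by (auto simp: coeff_mult_arrow path_coord_s_mult)
  qed (simp_all add: path_coord_s_def zero_path_alg.rep_eq plus_path_alg.rep_eq uminus_path_alg.rep_eq
      eq_neg_iff_add_eq_0 neg_eq_iff_add_eq_0 algebra_simps)
  then show "coeff x (i, [a]) = 0" "path_coord_s i x = 0" by auto
qed

text \<open>The coordinates with respect to the basis of idempotents, arrows and socle elements,
  read off an arbitrary representative; \<open>coord_abs_lam\<close> gives the independence of that
  choice.\<close>

definition coord_e :: "2 \<Rightarrow> 'k::field lam \<Rightarrow> 'k" where
  "coord_e i x = coeff (rep_lam x) (i, [])"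
definition coord_a :: "2 \<Rightarrow> 'k::field lam \<Rightarrow> 'k" where
  "coord_a i x = coeff (rep_lam x) (i, [Arr i])"
definition coord_b :: "2 \<Rightarrow> 'k::field lam \<Rightarrow> 'k" where
  "coord_b i x = coeff (rep_lam x) (i + 1, [Bar i])"
definition coord_s :: "2 \<Rightarrow> 'k::field lam \<Rightarrow> 'k" where
  "coord_s i x = path_coord_s i (rep_lam x)"

lemma path_coord_s_diff: "path_coord_s i (x - y) = path_coord_s i x - path_coord_s i y"
  by (simp add: path_coord_s_def coeff_diff)

lemma coord_abs_lam:
  "coord_e i (abs_lam x) = coeff x (i, [])"
  "coord_a i (abs_lam x) = coeff x (i, [Arr i])"
  "coord_b i (abs_lam x) = coeff x (i + 1, [Bar i])"
  "coord_s i (abs_lam x) = path_coord_s i x"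
proof -
  have "rep_lam (abs_lam x) - x \<in> ideal_gen relations"
    using Quotient3_rep_abs[OF Quotient3_lam, of x]
    by (simp add: lam_rel_def ideal_gen.zero)
  from ideal_gen_relations_trivial[OF this] ideal_gen_relations_coord[OF this]
  show "coord_e i (abs_lam x) = coeff x (i, [])"
    "coord_a i (abs_lam x) = coeff x (i, [Arr i])"
    "coord_b i (abs_lam x) = coeff x (i + 1, [Bar i])"
    "coord_s i (abs_lam x) = path_coord_s i x"
    by (simp_all add: coord_e_def coord_a_def coord_b_def coord_s_def path_coord_s_diff coeff_diff)
qed

lemma abs_lam_surj: obtains p where "x = abs_lam p"
  using lam.abs_induct[of "\<lambda>x. \<exists>p. x = abs_lam p" x] by blast

lemma coord_add [simp]:
  "coord_e i (x + y) = coord_e i x + coord_e i y"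
  "coord_a i (x + y) = coord_a i x + coord_a i y"
  "coord_b i (x + y) = coord_b i x + coord_b i y"
  "coord_s i (x + y) = coord_s i x + coord_s i y"
  by (rule abs_lam_surj[of x], rule abs_lam_surj[of y], hypsubst,
      simp add: plus_lam.abs_eq coord_abs_lam path_coord_s_def plus_path_alg.rep_eq)+

lemma coord_zero [simp]: "coord_e i 0 = 0" "coord_a i 0 = 0" "coord_b i 0 = 0" "coord_s i 0 = 0"
  by (simp_all add: zero_lam.abs_eq coord_abs_lam path_coord_s_def zero_path_alg.rep_eq)

lemma coord_uminus [simp]:
  "coord_e i (- x) = - coord_e i x" "coord_a i (- x) = - coord_a i x"
  "coord_b i (- x) = - coord_b i x" "coord_s i (- x) = - coord_s i x"
  by (rule abs_lam_surj[of x], hypsubst, simp add: uminus_lam.abs_eq coord_abs_lam path_coord_s_def uminus_path_alg.rep_eq)+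

lemma coord_diff [simp]:
  "coord_e i (x - y :: 'a::field lam) = coord_e i x - coord_e i y"
  "coord_a i (x - y) = coord_a i x - coord_a i y"
  "coord_b i (x - y) = coord_b i x - coord_b i y"
  "coord_s i (x - y) = coord_s i x - coord_s i y"
  by (simp_all only: minus_lam_def coord_add coord_uminus add_uminus_conv_diff[where 'a = 'a])

lemma coord_scale [simp]:
  "coord_e i (scale c x) = c * coord_e i x" "coord_a i (scale c x) = c * coord_a i x"
  "coord_b i (scale c x) = c * coord_b i x" "coord_s i (scale c x) = c * coord_s i x"
  by (rule abs_lam_surj[of x], hypsubst, simp add: scale.abs_eq coord_abs_lam path_coord_s_def path_scale.rep_eq algebra_simps)+

lemma coord_mult [simp]:
  "coord_e i (x * y) = coord_e i x * coord_e i y"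
  "coord_a i (x * y) = coord_e i x * coord_a i y + coord_a i x * coord_e (i + 1) y"
  "coord_b i (x * y) = coord_e (i + 1) x * coord_b i y + coord_b i x * coord_e i y"
  "coord_s i (x * y) = coord_e i x * coord_s i y + coord_s i x * coord_e i y
     + coord_a i x * coord_b i y + coord_b (i + 1) x * coord_a (i + 1) y"
proof -
  obtain p where [simp]: "x = abs_lam p" by (rule abs_lam_surj)
  obtain q where [simp]: "y = abs_lam q" by (rule abs_lam_surj)
  show "coord_e i (x * y) = coord_e i x * coord_e i y"
    "coord_a i (x * y) = coord_e i x * coord_a i y + coord_a i x * coord_e (i + 1) y"
    "coord_b i (x * y) = coord_e (i + 1) x * coord_b i y + coord_b i x * coord_e i y"
    "coord_s i (x * y) = coord_e i x * coord_s i y + coord_s i x * coord_e i y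
     + coord_a i x * coord_b i y + coord_b (i + 1) x * coord_a (i + 1) y"
    by (simp_all add: times_lam.abs_eq coord_abs_lam path_coord_s_mult coeff_mult_arrow coeff_mult_trivial
        add.assoc[of i 1 1])
qed

lemma coord_one [simp]: "coord_e i 1 = 1" "coord_a i 1 = 0" "coord_b i 1 = 0" "coord_s i 1 = 0"
  by (simp_all add: one_lam.abs_eq coord_abs_lam path_coord_s_def one_path_alg.rep_eq)

lemma coord_generators [simp]:
  "coord_e i (idem j) = (if i = j then 1 else 0)" "coord_a i (idem j) = 0"
  "coord_b i (idem j) = 0" "coord_s i (idem j) = 0"
  "coord_e i (arr j) = 0" "coord_a i (arr j) = (if i = j then 1 else 0)"
  "coord_b i (arr j) = 0" "coord_s i (arr j) = 0"
  "coord_e i (bar j) = 0" "coord_a i (bar j) = 0"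
  "coord_b i (bar j) = (if i = j then 1 else 0)" "coord_s i (bar j) = 0"
  by (simp_all add: idem.abs_eq arr.abs_eq bar.abs_eq coord_abs_lam path_coord_s_def path_elt.rep_eq)

lemma abs_lam_eqI: "x - y \<in> ideal_gen relations \<Longrightarrow> abs_lam x = abs_lam y"
  by (simp add: lam.abs_eq_iff lam_rel_def)

lemma path_elt_mult:
  "(path_elt v (xs @ ys) :: 'k::field path_alg) = path_elt v xs * path_elt (path_end v xs) ys"
proof -
  have "coeff (path_elt v (xs @ ys) :: 'k path_alg) (w, zs)
      = coeff (path_elt v xs * path_elt (path_end v xs) ys) (w, zs)" for w zs
  proof -
    \<comment> \<open>The convolution has at most one non-zero summand, the splitting after
      \<open>length xs\<close> arrows.\<close>
    have "coeff (path_elt v xs * path_elt (path_end v xs) ys :: 'k path_alg) (w, zs)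
        = (\<Sum>k\<le>length zs. if k = length xs then
            (if w = v \<and> zs = xs @ ys \<and> is_path v (xs @ ys) then 1 else 0) else 0)"
      unfolding times_path_alg.rep_eq path_conv_def prod.case path_elt.rep_eq
    proof (rule sum.cong[OF refl], goal_cases)
      case (1 k)
      have "zs = xs @ ys \<longleftrightarrow> take k zs = xs \<and> drop k zs = ys" if "k = length xs"
        using that by (metis append_eq_conv_conj append_take_drop_id)
      moreover have "take k zs \<noteq> xs" if "k \<noteq> length xs"
        using that 1 by auto
      ultimately show ?case
        by (auto simp: is_path_append)
    qed
    also have "\<dots> = coeff (path_elt v (xs @ ys)) (w, zs)"
      by (auto simp: path_elt.rep_eq)
    finally show ?thesis ..
  qed
  then show ?thesis
    by (simp add: coeff_inject[symmetric] fun_eq_iff)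
qed

text \<open>Induction over a finite set containing the support: one path is subtracted at a time,
  and pairs that are not paths have coefficient zero anyway.\<close>

lemma path_alg_induct:
  assumes "P 0" "\<And>x y. P x \<Longrightarrow> P y \<Longrightarrow> P (x + y)"
    and "\<And>c v xs. is_path v xs \<Longrightarrow> P (path_scale c (path_elt v xs))"
  shows "P (x :: 'k::field path_alg)"
proof -
  have "P x" if "finite S" "{p. coeff x p \<noteq> 0} \<subseteq> S" for S and x :: "'k path_alg"
    using that
  proof (induction S arbitrary: x rule: finite_induct)
    case empty
    then have "x = 0"
      by (simp add: coeff_inject[symmetric] fun_eq_iff zero_path_alg.rep_eq)
    then show ?case using assms(1) by simp
  next
    case (insert p S)
    obtain v xs where p: "p = (v, xs)" by (cases p)
    show ?case
    proof (cases "is_path v xs")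
      case True
      let ?t = "path_scale (coeff x p) (path_elt v xs)"
      have "P (x - ?t)"
      proof (rule insert.IH, rule subsetI)
        fix q assume "q \<in> {q. coeff (x - ?t) q \<noteq> 0}"
        then have "coeff x q \<noteq> 0" "q \<noteq> p"
          using True by (cases "q = p"; simp add: coeff_diff path_scale.rep_eq path_elt.rep_eq p)+
        then show "q \<in> S" using insert.prems by blast
      qed
      then have "P (x - ?t + ?t)"
        using assms(2,3) True by blast
      then show ?thesis by simp
    next
      case False
      then have "coeff x p = 0"
        using coeff[of x] p by auto
      then show ?thesis
        using insert.IH[of x] insert.prems by auto
    qed
  qed
  moreover have "finite {p. coeff x p \<noteq> 0}"
    using coeff[of x] by simp
  ultimately show ?thesis by blast
qed

lemma path_elt_relations:
  "path_elt i [Arr i] * path_elt (i + 1) [Arr (i + 1)] \<in> relations"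
  "path_elt (i + 1) [Bar i] * path_elt i [Bar (i + 1)] \<in> relations"
  "path_elt i [Arr i] * path_elt (i + 1) [Bar i]
     - path_elt i [Bar (i + 1)] * path_elt (i + 1) [Arr (i + 1)] \<in> relations"
proof -
  show "path_elt i [Arr i] * path_elt (i + 1) [Arr (i + 1)] \<in> relations"
    unfolding relations_def by (rule UN_I[of i]) simp_all
  show "path_elt i [Arr i] * path_elt (i + 1) [Bar i]
     - path_elt i [Bar (i + 1)] * path_elt (i + 1) [Arr (i + 1)] \<in> relations"
    unfolding relations_def by (rule UN_I[of i]) simp_all
  show "path_elt (i + 1) [Bar i] * path_elt i [Bar (i + 1)] \<in> relations"
    unfolding relations_def by (rule UN_I[of "i + 1"]) (simp_all add: add.assoc)
qed

lemma arr_arr: "arr i * arr (i + 1) = 0"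
  and bar_bar: "bar i * bar (i + 1) = 0"
  and arr_bar: "arr i * bar i = bar (i + 1) * arr (i + 1)"
  using path_elt_relations[of i, THEN ideal_gen.gen]
  by (auto simp: arr.abs_eq bar.abs_eq times_lam.abs_eq zero_lam.abs_eq add.assoc intro!: abs_lam_eqI)

definition soc :: "2 \<Rightarrow> 'k::field lam" where
  "soc i = arr i * bar i"

lemma coord_soc [simp]:
  "coord_e i (soc j) = 0" "coord_a i (soc j) = 0" "coord_b i (soc j) = 0"
  "coord_s i (soc j) = (if i = j then 1 else 0)"
  by (auto simp: soc_def)

lemma path_elt_ortho: "v \<noteq> path_end u xs \<Longrightarrow> path_elt u xs * path_elt v ys = 0"
  by (simp add: coeff_inject[symmetric] fun_eq_iff times_path_alg.rep_eq path_conv_def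
      path_elt.rep_eq zero_path_alg.rep_eq) (auto intro!: sum.neutral)

text \<open>The expansion in the eight expected basis elements. That it is the identity, shown in
  \<open>from_coords_eq\<close>, means that these elements span.\<close>

definition from_coords :: "'k::field lam \<Rightarrow> 'k lam" where
  "from_coords x = (\<Sum>i\<in>UNIV. scale (coord_e i x) (idem i) + scale (coord_a i x) (arr i)
     + scale (coord_b i x) (bar i) + scale (coord_s i x) (soc i))"

lemma path_elt_trivial:
  "path_elt v [] * path_elt v xs = (path_elt v xs :: 'k::field path_alg)"
  "w = path_end v xs \<Longrightarrow> path_elt v xs * path_elt w [] = (path_elt v xs :: 'k path_alg)"
  using path_elt_mult[of v "[]" xs, where 'k = 'k] path_elt_mult[of v xs "[]", where 'k = 'k] by simp_all

lemma lam_gen_idem [simp]: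
  "arr j * idem i = (if i = j + 1 then arr j else 0)"
  "bar j * idem i = (if i = j then bar j else 0)"
  and idem_lam_gen [simp]:
  "idem i * arr j = (if i = j then arr j else 0)"
  "idem i * bar j = (if i = j + 1 then bar j else 0)"
  and idem_idem [simp]: "idem i * idem j = (if i = j then idem i else 0)"
  by (simp_all add: arr.abs_eq bar.abs_eq idem.abs_eq times_lam.abs_eq zero_lam.abs_eq path_elt_ortho
      path_elt_trivial add.assoc)

lemma arr_mult [simp]: "arr j * arr i = (0 :: 'a::field lam)"
  and bar_mult [simp]: "bar j * bar i = (0 :: 'a lam)"
proof -
  have "i = j \<or> i = j + 1" using vertex_cases[of i] vertex_cases[of j] by auto
  moreover have "arr j * arr j = (0 :: 'a lam)" "bar j * bar j = (0 :: 'a lam)"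
    by (simp_all add: arr.abs_eq bar.abs_eq times_lam.abs_eq zero_lam.abs_eq path_elt_ortho)
  ultimately show "arr j * arr i = (0 :: 'a lam)" "bar j * bar i = (0 :: 'a lam)"
    using arr_arr[of j] bar_bar[of j] by auto
qed

lemma arr_bar_mult [simp]: "arr j * bar i = (if i = j then soc j else 0)"
  and bar_arr_mult [simp]: "bar j * arr i = (if i = j then soc (j + 1) else 0)"
proof -
  show "arr j * bar i = (if i = j then soc j else 0)"
    by (simp add: soc_def) (simp add: arr.abs_eq bar.abs_eq times_lam.abs_eq zero_lam.abs_eq path_elt_ortho)
  show "bar j * arr i = (if i = j then soc (j + 1) else 0)"
    by (simp add: soc_def arr_bar[of "j + 1"] add.assoc)
      (simp add: arr.abs_eq bar.abs_eq times_lam.abs_eq zero_lam.abs_eq path_elt_ortho)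
qed

text \<open>By \<open>arr_bar\<close> a socle element may be spelled with either type of arrow
  first; the suitable spelling exposes a vanishing product.\<close>

lemma lam_gen_soc [simp]: "arr j * soc i = 0" "bar j * soc i = 0"
proof -
  show "arr j * soc i = 0"
    by (simp only: soc_def mult.assoc[symmetric] arr_mult mult_zero_left)
  show "bar j * soc i = 0"
    by (simp only: soc_def arr_bar mult.assoc[symmetric] bar_mult mult_zero_left)
qed

lemma from_coords_add: "from_coords (x + y) = from_coords x + from_coords y"
  by (simp add: from_coords_def scale_add_left sum.distrib UNIV_vertex)

lemma from_coords_scale: "from_coords (scale c x) = scale c (from_coords x)"
  by (simp add: from_coords_def scale_scale scale_add_right UNIV_vertex)

text \<open>The induction step for \<open>from_coords_path\<close>, where a path is built by
  prepending arrows.\<close>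

lemma from_coords_gen_mult:
  "from_coords (arr j * z) = arr j * from_coords z"
  "from_coords (bar j * z) = bar j * from_coords z"
  using vertex_cases[of j]
  by (elim disjE; simp add: from_coords_def scale_zero_left scale_zero_right scale_mult_right UNIV_vertex distrib_left)+

lemma from_coords_path:
  "from_coords (abs_lam (path_elt v xs)) = (abs_lam (path_elt v xs) :: 'k::field lam)" if "is_path v xs"
  using that
proof (induction xs arbitrary: v)
  case Nil
  then show ?case
    using vertex_cases[of v]
    by (elim disjE) (simp_all add: idem.abs_eq[symmetric] from_coords_def UNIV_vertex
      scale_zero_left scale_one_left)
next
  case (Cons b xs)
  let ?z = "abs_lam (path_elt (tgt b) xs) :: 'k lam"
  let ?g = "case b of Arr i \<Rightarrow> arr i | Bar i \<Rightarrow> bar i"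
  have *: "abs_lam (path_elt v (b # xs)) = ?g * ?z"
    using path_elt_mult[of v "[b]" xs, where 'k = 'k] Cons.prems
    by (cases b) (auto simp: arr.abs_eq bar.abs_eq times_lam.abs_eq)
  have "from_coords ?z = ?z" using Cons by auto
  then have "?g * ?z = ?g * from_coords ?z" by simp
  also have "\<dots> = from_coords (?g * ?z)"
    by (cases b) (simp_all add: from_coords_gen_mult)
  finally show ?case using * by simp
qed

lemma from_coords_eq: "from_coords x = x"
proof -
  obtain p where "x = abs_lam p" by (rule abs_lam_surj)
  moreover have "from_coords (abs_lam p) = abs_lam p"
  proof (induction p rule: path_alg_induct)
    case 1
    show ?case by (simp add: zero_lam.abs_eq[symmetric] from_coords_def scale_zero_left)
  next
    case (2 x y)
    then show ?case by (simp add: plus_lam.abs_eq[symmetric] from_coords_add)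
  next
    case (3 c v xs)
    then show ?case by (simp add: scale.abs_eq[symmetric] from_coords_scale from_coords_path)
  qed
  ultimately show ?thesis by simp
qed

text \<open>Together with the simplification rules for coordinates this decides most identities in
  the algebra.\<close>

lemma lam_eqI:
  assumes "\<And>i. coord_e i x = coord_e i y" "\<And>i. coord_a i x = coord_a i y"
    "\<And>i. coord_b i x = coord_b i y" "\<And>i. coord_s i x = coord_s i y"
  shows "x = y"
  using from_coords_eq[of x] from_coords_eq[of y] assms by (simp add: from_coords_def)


section \<open>The enveloping algebra and a universal property\<close>

definition xx :: "'k::field lam" where "xx = arr 0 + arr 1"
definition yy :: "'k::field lam" where "yy = bar 0 + bar 1"

lemma coord_xx_yy [simp]:
  "coord_e i xx = 0" "coord_a i xx = 1" "coord_b i xx = 0" "coord_s i xx = 0"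
  "coord_e i yy = 0" "coord_a i yy = 0" "coord_b i yy = 1" "coord_s i yy = 0"
  using vertex_cases[of i] by (auto simp: xx_def yy_def)

lemma xx_xx [simp]: "xx * xx = 0" "xx * (xx * w) = 0"
  and yy_yy [simp]: "yy * yy = 0" "yy * (yy * w) = 0"
  and xx_yy: "xx * yy = yy * xx" "xx * (yy * w) = yy * (xx * w)"
  by (auto intro!: lam_eqI simp: add.assoc)

lemma idem_xx: "idem i * xx = arr i" "xx * idem (i + 1) = arr i"
  and idem_yy: "idem i * yy = bar (i + 1)" "yy * idem (i + 1) = bar (i + 1)"
  by (auto intro!: lam_eqI simp: add.assoc split: if_splits)

lemma idem_xx_comm: "xx * idem i = idem (i + 1) * xx" "yy * idem i = idem (i + 1) * yy"
  by (auto intro!: lam_eqI)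

text \<open>
  The contracting homotopy acts on right factors through the following maps: \<open>dx\<close> divides by \<open>x\<close> on the left,
  while \<open>dy\<close> and \<open>dxy\<close> pick out the coefficients of \<open>y\<close> and of \<open>x y\<close>.
\<close>

definition dx :: "'k::field lam \<Rightarrow> 'k lam" where
  "dx w = (\<Sum>i\<in>UNIV. scale (coord_a (i + 1) w) (idem i) + scale (coord_s i w) (bar i))"
definition dy :: "'k::field lam \<Rightarrow> 'k lam" where
  "dy w = (\<Sum>i\<in>UNIV. scale (coord_b i w) (idem i))"
definition dxy :: "'k::field lam \<Rightarrow> 'k lam" where
  "dxy w = (\<Sum>i\<in>UNIV. scale (coord_s i w) (idem i))"

lemma coord_dx [simp]:
  "coord_e i (dx w) = coord_a (i + 1) w" "coord_a i (dx w) = 0"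
  "coord_b i (dx w) = coord_s i w" "coord_s i (dx w) = 0"
  "coord_e i (dy w) = coord_b i w" "coord_a i (dy w) = 0"
  "coord_b i (dy w) = 0" "coord_s i (dy w) = 0"
  "coord_e i (dxy w) = coord_s i w" "coord_a i (dxy w) = 0"
  "coord_b i (dxy w) = 0" "coord_s i (dxy w) = 0"
  using vertex_cases[of i] by (auto simp: dx_def dy_def dxy_def UNIV_vertex)

lemma dx_add: "dx (v + w) = dx v + dx w" "dy (v + w) = dy v + dy w" "dxy (v + w) = dxy v + dxy w"
  and dx_scale: "dx (scale c w) = scale c (dx w)" "dy (scale c w) = scale c (dy w)"
    "dxy (scale c w) = scale c (dxy w)"
  by (auto intro!: lam_eqI)

text \<open>The first identity says that \<open>dx\<close> contracts left multiplication by x. Here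
  \<open>dx (xx * w)\<close> is the part of \<open>w\<close> free of x, and \<open>dx w\<close> is
  the cofactor of x. The last two identities contract left multiplication by y on these two parts,
  through \<open>dy\<close> and \<open>dxy\<close>.\<close>

lemma dx_identities:
  "dx (xx * w) + xx * dx w = w"
  "dx (yy * w) = yy * dx w"
  "dy (xx * w) = 0"
  "dxy (xx * w) = dy w"
  "dx (xx * w) = yy * dy w + dy (yy * w)"
  "dx w = yy * dxy w + dxy (yy * w)"
  by (auto intro!: lam_eqI simp: add.assoc)

lemma dx_idem: "dx (idem i * w) = idem (i + 1) * dx w" "dy (idem i * w) = idem (i + 1) * dy w"
  "dxy (idem i * w) = idem i * dxy w"
  by (auto intro!: lam_eqI simp: add.assoc)

text \<open>The target is a mere abelian group, so that chains can serve as values without a scalar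
  multiplication of their own; linearity over the field becomes the rule that scalars pass from one
  argument to the other. For the same reason \<open>free_lift\<close> puts the coefficient into the
  left factor.\<close>

definition balanced :: "('k::field lam \<Rightarrow> 'k lam \<Rightarrow> 'm::ab_group_add) \<Rightarrow> bool" where
  "balanced \<beta> \<longleftrightarrow> (\<forall>x x' y. \<beta> (x + x') y = \<beta> x y + \<beta> x' y) \<and>
     (\<forall>x y y'. \<beta> x (y + y') = \<beta> x y + \<beta> x y') \<and>
     (\<forall>c x y. \<beta> (scale c x) y = \<beta> x (scale c y))"

lemma balancedD:
  assumes "balanced \<beta>"
  shows "\<beta> (x + x') y = \<beta> x y + \<beta> x' y" "\<beta> x (y + y') = \<beta> x y + \<beta> x y'"
    "\<beta> x (scale c y) = \<beta> (scale c x) y"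
  using assms by (auto simp: balanced_def)

definition free_lift :: "('k::field lam \<Rightarrow> 'k lam \<Rightarrow> 'm::ab_group_add) \<Rightarrow> ('k lam env_pair \<Rightarrow>\<^sub>0 'k) \<Rightarrow> 'm" where
  "free_lift \<beta> p = (\<Sum>q\<in>Poly_Mapping.keys p. case q of Env_Pair x y \<Rightarrow> \<beta> (scale (Poly_Mapping.lookup p q) x) y)"

definition env_lift :: "('k::field lam \<Rightarrow> 'k lam \<Rightarrow> 'm::ab_group_add) \<Rightarrow> 'k env \<Rightarrow> 'm" where
  "env_lift \<beta> t = free_lift \<beta> (rep_env t)"

context
  fixes \<beta> :: "'k::field lam \<Rightarrow> 'k lam \<Rightarrow> 'm::ab_group_add"
  assumes \<beta>: "balanced \<beta>"
begin

lemma balanced_zero: "\<beta> 0 y = 0"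
  using \<beta> unfolding balanced_def by (metis add.right_neutral add_left_cancel)

lemma free_lift_superset:
  assumes "finite A" "Poly_Mapping.keys p \<subseteq> A"
  shows "free_lift \<beta> p = (\<Sum>q\<in>A. case q of Env_Pair x y \<Rightarrow> \<beta> (scale (Poly_Mapping.lookup p q) x) y)"
  unfolding free_lift_def
  by (rule sum.mono_neutral_left)
    (use assms in \<open>auto simp: in_keys_iff scale_zero_left balanced_zero split: env_pair.splits\<close>)

lemma free_lift_add: "free_lift \<beta> (p + q) = free_lift \<beta> p + free_lift \<beta> q"
proof -
  let ?A = "Poly_Mapping.keys p \<union> Poly_Mapping.keys q"
  have "free_lift \<beta> (p + q) = (\<Sum>r\<in>?A. (case r of Env_Pair x y \<Rightarrow> \<beta> (scale (Poly_Mapping.lookup p r) x) y)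
      + (case r of Env_Pair x y \<Rightarrow> \<beta> (scale (Poly_Mapping.lookup q r) x) y))"
    using Poly_Mapping.keys_add[of p q] \<beta> unfolding balanced_def
    by (subst free_lift_superset[of ?A]) (auto intro!: sum.cong split: env_pair.splits simp: lookup_add scale_add_left)
  then show ?thesis
    by (simp add: free_lift_superset[of ?A] sum.distrib)
qed

lemma free_lift_zero: "free_lift \<beta> 0 = 0"
  by (simp add: free_lift_def)

lemma free_lift_uminus: "free_lift \<beta> (- p) = - free_lift \<beta> p"
  using free_lift_add[of p "- p"] by (simp add: free_lift_zero eq_neg_iff_add_eq_0 add.commute)

lemma free_lift_diff: "free_lift \<beta> (p - q) = free_lift \<beta> p - free_lift \<beta> q"
  using free_lift_add[of p "- q"] by (simp add: free_lift_uminus)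

lemma free_lift_single: "free_lift \<beta> (Poly_Mapping.single (Env_Pair x y) c) = \<beta> (scale c x) y"
  by (simp add: free_lift_def scale_zero_left balanced_zero)

end

lemma free_monoid_induct:
  assumes "P 0" "\<And>p q. P p \<Longrightarrow> P q \<Longrightarrow> P (p + q)" "\<And>k c. P (Poly_Mapping.single k c)"
  shows "P (p :: 'b \<Rightarrow>\<^sub>0 'c::ab_group_add)"
proof -
  have "P (\<Sum>q\<in>A. Poly_Mapping.single q (Poly_Mapping.lookup p q))" if "finite A" for A
    using that by (induction rule: finite_induct) (auto intro: assms)
  moreover have "p = (\<Sum>q\<in>Poly_Mapping.keys p. Poly_Mapping.single q (Poly_Mapping.lookup p q))"
    by (rule poly_mapping_eqI) (auto simp: lookup_sum lookup_single when_def in_keys_iff)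
  ultimately show ?thesis by (metis finite_keys)
qed

text \<open>The relations generate a two-sided ideal. Multiplying by a single pair turns
  \<open>free_lift \<beta>\<close> into \<open>free_lift\<close> of another balanced map, so the
  induction must let \<open>\<beta>\<close> vary.\<close>

lemma free_lift_ideal:
  fixes \<beta> :: "'k::field lam \<Rightarrow> 'k lam \<Rightarrow> 'm::ab_group_add"
  assumes "p \<in> ideal_gen bilinear_relations" "balanced \<beta>"
  shows "free_lift \<beta> p = 0"
  using assms
proof (induction arbitrary: \<beta> rule: ideal_gen.induct)
  case (gen x)
  then have "\<And>x x' y. \<beta> (x + x') y = \<beta> x y + \<beta> x' y" "\<And>x y y'. \<beta> x (y + y') = \<beta> x y + \<beta> x y'"
    "\<And>c x y. \<beta> (scale c x) y = \<beta> x (scale c y)" by (auto simp: balanced_def)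
  then show ?case using gen
    by (auto simp: bilinear_relations_def free_lift_diff free_lift_single scale_one_left scale_scale)
next
  case (mult_left p u)
  have "free_lift \<beta> (u * p) = 0"
  proof (induction u rule: free_monoid_induct)
    case (3 k c)
    obtain x y where k: "k = Env_Pair x y" by (cases k)
    let ?\<beta> = "\<lambda>a b. \<beta> (scale c (x * a)) (b * y)"
    have b: "balanced ?\<beta>"
      using balancedD[OF mult_left.prems]
      by (simp add: balanced_def distrib_left distrib_right scale_add_right scale_mult_right scale_mult_left
          scale_scale mult.commute)
    have "free_lift \<beta> (Poly_Mapping.single k c * p) = free_lift ?\<beta> p" for p
    proof (induction p rule: free_monoid_induct)
      case (3 l d)
      obtain a b where l: "l = Env_Pair a b" by (cases l)
      show ?case
        by (simp add: k l mult_single free_lift_single mult_left.prems b scale_mult_right scale_scale)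
    qed (simp_all add: free_lift_zero mult_left.prems b free_lift_add distrib_left)
    then show ?case using mult_left.IH[OF b] by simp
  qed (simp_all add: distrib_right free_lift_zero free_lift_add mult_left.prems)
  then show ?case .
next
  case (mult_right p u)
  have "free_lift \<beta> (p * u) = 0"
  proof (induction u rule: free_monoid_induct)
    case (3 k c)
    obtain x y where k: "k = Env_Pair x y" by (cases k)
    let ?\<beta> = "\<lambda>a b. \<beta> (scale c (a * x)) (y * b)"
    have b: "balanced ?\<beta>"
      using balancedD[OF mult_right.prems]
      by (simp add: balanced_def distrib_left distrib_right scale_add_right scale_mult_right scale_mult_left
          scale_scale mult.commute)
    have "free_lift \<beta> (p * Poly_Mapping.single k c) = free_lift ?\<beta> p" for p
    proof (induction p rule: free_monoid_induct)
      case (3 l d)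
      obtain a b where l: "l = Env_Pair a b" by (cases l)
      show ?case
        by (simp add: k l mult_single free_lift_single mult_right.prems b scale_mult_left scale_scale mult.commute)
    qed (simp_all add: free_lift_zero mult_right.prems b free_lift_add distrib_right)
    then show ?case using mult_right.IH[OF b] by simp
  qed (simp_all add: distrib_left free_lift_zero free_lift_add mult_right.prems)
  then show ?case .
qed (simp_all add: free_lift_zero free_lift_add free_lift_uminus)

lemma env_lift_abs: "balanced \<beta> \<Longrightarrow> env_lift \<beta> (abs_env p) = free_lift \<beta> p"
proof -
  assume \<beta>: "balanced \<beta>"
  have "rep_env (abs_env p) - p \<in> ideal_gen bilinear_relations"
    using Quotient3_rep_abs[OF Quotient3_env, of p] by (simp add: env_rel_def ideal_gen.zero)
  from free_lift_ideal[OF this \<beta>] show ?thesis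
    by (simp add: env_lift_def free_lift_diff[OF \<beta>])
qed

lemma abs_env_surj: obtains p where "x = abs_env p"
  using env.abs_induct[of "\<lambda>x. \<exists>p. x = abs_env p" x] by blast

lemma env_lift_tens: "balanced \<beta> \<Longrightarrow> env_lift \<beta> (tens x y) = \<beta> x y"
  by (simp add: tens.abs_eq env_lift_abs free_lift_single scale_one_left)

lemma env_lift_add: "balanced \<beta> \<Longrightarrow> env_lift \<beta> (s + t) = env_lift \<beta> s + env_lift \<beta> t"
proof -
  assume \<beta>: "balanced \<beta>"
  obtain p where s: "s = abs_env p" by (rule abs_env_surj)
  obtain q where t: "t = abs_env q" by (rule abs_env_surj)
  show ?thesis by (simp add: s t plus_env.abs_eq env_lift_abs \<beta> free_lift_add)
qed

lemma tens_rel: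
  "tens (x + x') y = tens x y + tens x' y"
  "tens x (y + y') = tens x y + tens x y'"
  "tens (scale c x) y = abs_env (Poly_Mapping.single (Env_Pair x y) c)"
  "tens x (scale c y) = abs_env (Poly_Mapping.single (Env_Pair x y) c)"
proof -
  have *: "abs_env p = abs_env q" if "p - q \<in> bilinear_relations" for p q :: "'a lam env_pair \<Rightarrow>\<^sub>0 'a"
    using ideal_gen.gen[OF that] by (simp add: env.abs_eq_iff env_rel_def)
  show "tens (x + x') y = tens x y + tens x' y" "tens x (y + y') = tens x y + tens x y'"
    "tens (scale c x) y = abs_env (Poly_Mapping.single (Env_Pair x y) c)"
    "tens x (scale c y) = abs_env (Poly_Mapping.single (Env_Pair x y) c)"
    unfolding tens.abs_eq plus_env.abs_eq
    by (rule *; unfold bilinear_relations_def diff_diff_eq[symmetric]; blast)+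
qed

lemmas tens_add = tens_rel(1,2)

lemma tens_scale: "tens (scale c x) y = tens x (scale c y)"
  by (simp add: tens_rel)

lemma tens_zero [simp]: "tens 0 y = 0" "tens x 0 = 0"
  using tens_add(1)[of 0 0 y] tens_add(2)[of x 0 0] by simp_all

lemma tens_uminus: "tens (- x) y = - tens x y" "tens x (- y) = - tens x y"
  using tens_add(1)[of x "- x" y] tens_add(2)[of x y "- y"]
  by (simp_all add: eq_neg_iff_add_eq_0 add.commute)

lemma tens_one: "tens 1 1 = 1"
  by (simp add: tens.abs_eq one_env.abs_eq zero_env_pair_def[symmetric])

text \<open>No case for scalars arises, since a coefficient can be absorbed into the left factor of
  an elementary tensor.\<close>

lemma env_induct [case_names tens add]:
  assumes "\<And>x y. P (tens x y)" "\<And>s t. P s \<Longrightarrow> P t \<Longrightarrow> P (s + t)"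
  shows "P t"
proof -
  obtain p where t: "t = abs_env p" by (rule abs_env_surj)
  have "P (abs_env p)"
  proof (induction p rule: free_monoid_induct)
    case 1
    show ?case using assms(1)[of 0 0] by (simp add: zero_env.abs_eq)
  next
    case (2 p q)
    then show ?case using assms(2) by (simp add: plus_env.abs_eq[symmetric])
  next
    case (3 k c)
    show ?case by (cases k) (metis assms(1) tens_rel(3))
  qed
  then show ?thesis by (simp add: t)
qed

lemma act_add_left: "act (s + t) z = act s z + act t z"
  by transfer (simp add: free_act_add_left)
lemma act_zero_left [simp]: "act 0 z = 0"
  by transfer (simp add: free_act_zero_left)
lemma act_uminus_left: "act (- t) z = - act t z"
  by transfer (simp add: free_act_uminus_left)
lemma act_mult: "act (s * t) z = act s (act t z)"
  by transfer (simp add: free_act_mult)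
lemma act_one [simp]: "act 1 z = z"
  using act_tens[of 1 1 z] by (simp add: tens_one)
lemma act_add_right: "act t (z + w) = act t z + act t w"
  by transfer (simp add: free_act_add_right)
lemma act_zero_right [simp]: "act t 0 = 0"
  by transfer (simp add: free_act_zero_right)
lemma act_sum_right: "act t (sum f A) = (\<Sum>i\<in>A. act t (f i))"
  by transfer (simp add: free_act_sum_right)
lemma act_scale: "act t (scale c z) = scale c (act t z)"
  by (induction t rule: env_induct) (simp_all add: act_tens act_add_left scale_add_right scale_mult_left scale_mult_right)


section \<open>The differential on elementary chains\<close>

lemma lmul_simps:
  "lmul t (x + y) = lmul t x + lmul t y" "lmul (s + t) x = lmul s x + lmul t x"
  "lmul s (lmul t x) = lmul (s * t) x" "lmul 1 x = x"
  "lmul (- t) x = - lmul t x" "lmul t (- x) = - lmul t x"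
  "lmul t (x - y) = lmul t x - lmul t y"
  by (simp_all add: lmul_def fun_eq_iff distrib_left distrib_right mult.assoc right_diff_distrib)

lemma lmul_zero [simp]: "lmul t 0 = 0" "lmul 0 x = 0"
  by (simp_all add: lmul_def fun_eq_iff)

lemma lmul_sum: "lmul t (sum f A) = (\<Sum>i\<in>A. lmul t (f i))"
  using sum_comp_morphism[of "lmul t" f A] by (simp add: lmul_simps comp_def)

lemma sum_fun_apply: "sum f A i = (\<Sum>a\<in>A. f a i)"
  by (induction A rule: infinite_finite_induct) simp_all

abbreviation gen_idem :: "nat \<Rightarrow> 2 \<Rightarrow> 'k::field env" where
  "gen_idem n i \<equiv> tens (idem i) (idem (i + of_nat n))"

lemma gen_idem_idem: "gen_idem n i * gen_idem n i = gen_idem n i"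
  by (simp add: tens_mult)

lemma vertex_index [simp]: "(i::2) + of_int (int n - 2 * r) = i + of_nat n"
proof -
  have "(of_int (int n - 2 * r) :: 2) = of_nat n + of_int (2 * r)"
    by (simp only: of_int_diff vertex_diff of_int_of_nat_eq)
  then show ?thesis by simp
qed

lemma res_iff: "x \<in> res n \<longleftrightarrow> (\<forall>i r. if r \<le> n then x i r * gen_idem n i = x i r else x i r = 0)"
proof -
  have "t \<in> range (\<lambda>s. s * gen_idem n i) \<longleftrightarrow> t * gen_idem n i = t" for t :: "'a env" and i
    by (metis (no_types, lifting) gen_idem_idem mult.assoc rangeE rangeI)
  then show ?thesis by (simp add: res_def)
qed

lemma res_closed [simp]:
  "0 \<in> res n" "x \<in> res n \<Longrightarrow> y \<in> res n \<Longrightarrow> x + y \<in> res n"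
  "x \<in> res n \<Longrightarrow> - x \<in> res n" "x \<in> res n \<Longrightarrow> y \<in> res n \<Longrightarrow> x - y \<in> res n"
  "x \<in> res n \<Longrightarrow> lmul t x \<in> res n"
  by (auto simp: res_iff lmul_def distrib_right left_diff_distrib mult.assoc)

lemma res_sum [simp]: "(\<And>i. i \<in> A \<Longrightarrow> f i \<in> res n) \<Longrightarrow> sum f A \<in> res n"
  by (induction A rule: infinite_finite_induct) simp_all

text \<open>
  \<open>cell n i r u w\<close> is the multiple \<open>u e\<^sub>i \<otimes>\<^sub>r e\<^sub>i\<^sub>+\<^sub>n w\<close> of a generator; modulo 2, \<open>i + n - 2 r\<close> is \<open>i + n\<close>.
  It is \<open>0\<close> unless \<open>0 \<le> r \<le> n\<close>, which makes most formulas below valid for all integers \<open>r\<close>.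
\<close>

definition cell :: "nat \<Rightarrow> 2 \<Rightarrow> int \<Rightarrow> 'k::field lam \<Rightarrow> 'k lam \<Rightarrow> 'k chain" where
  "cell n i r u w = (\<lambda>i' r'. if i' = i \<and> int r' = r \<and> r' \<le> n
     then tens (u * idem i) (idem (i + of_nat n) * w) else 0)"

lemma cell_in_res [simp]: "cell n i r u w \<in> res n"
  by (auto simp: res_iff cell_def tens_mult mult.assoc)
    (simp add: mult.assoc[symmetric])

lemma cell_out [simp]: "r < 0 \<or> r > int n \<Longrightarrow> cell n i r u w = 0"
  by (auto simp: cell_def fun_eq_iff)

lemma cell_add:
  "cell n i r (u + v) w = cell n i r u w + cell n i r v w"
  "cell n i r u (v + w) = cell n i r u v + cell n i r u w"
  by (auto simp: cell_def fun_eq_iff distrib_left distrib_right tens_add)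

lemma cell_scale: "cell n i r (scale c u) w = cell n i r u (scale c w)"
  by (auto simp: cell_def fun_eq_iff scale_mult_left scale_mult_right tens_scale)

lemma cell_zero [simp]: "cell n i r 0 w = 0" "cell n i r u 0 = 0"
  by (auto simp: cell_def fun_eq_iff)

lemma cell_uminus: "cell n i r (- u) w = - cell n i r u w" "cell n i r u (- w) = - cell n i r u w"
  by (auto simp: cell_def fun_eq_iff tens_uminus)

lemma cell_idem [simp]:
  "cell n i r (u * idem j) w = (if j = i then cell n i r u w else 0)"
  "cell n i r u (idem j * w) = (if j = i + of_nat n then cell n i r u w else 0)"
  by (auto simp: cell_def fun_eq_iff mult.assoc) (auto simp: mult.assoc[symmetric])

lemma lmul_cell: "lmul (tens p q) (cell n i r u w) = cell n i r (p * u) (w * q)"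
  by (auto simp: cell_def fun_eq_iff lmul_def tens_mult mult.assoc)

lemma res_gen_cell: "res_gen n i r = cell n i r 1 1"
  by (auto simp: res_gen_def cell_def fun_eq_iff)

text \<open>A chain is the sum of its components, each component is fixed by right multiplication
  with its idempotent, and \<open>env_induct\<close> splits it into elementary tensors.\<close>

lemma res_induct [consumes 1, case_names add cell]:
  assumes x: "x \<in> res n"
    and add: "\<And>x y. x \<in> res n \<Longrightarrow> y \<in> res n \<Longrightarrow> P x \<Longrightarrow> P y \<Longrightarrow> P (x + y)"
    and cell: "\<And>i r u w. r \<le> n \<Longrightarrow> P (cell n i (int r) u w)"
  shows "P (x :: 'k::field chain)"
proof -
  have P0: "P 0" using cell[of 0 0 0 0] by simp
  have comp: "P (\<lambda>i' r'. if i' = i \<and> r' = r then t * gen_idem n i else 0)" (is "P (?c i r t)")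
    if "r \<le> n" for i r t
  proof (induction t rule: env_induct)
    case (tens u w)
    have "?c i r (tens u w) = cell n i (int r) u w"
      using that by (auto simp: cell_def fun_eq_iff tens_mult)
    then show ?case using cell[OF that] by simp
  next
    case (add s t)
    have "?c i r s \<in> res n" "?c i r t \<in> res n"
      using that by (auto simp: res_iff mult.assoc gen_idem_idem)
    moreover have "?c i r (s + t) = ?c i r s + ?c i r t"
      by (auto simp: fun_eq_iff distrib_right)
    ultimately show ?case using assms(2) add by auto
  qed
  \<comment> \<open>Membership in \<open>res n\<close> is carried along because the hypothesis
    \<open>add\<close> asks for it.\<close>
  have sum: "sum f A \<in> res n \<and> P (sum f A)" if "finite A" "\<And>a. a \<in> A \<Longrightarrow> f a \<in> res n \<and> P (f a)"
    for A :: "'z set" and f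
    using that by (induction rule: finite_induct) (auto simp: P0 intro: add)
  let ?f = "\<lambda>i r. ?c i r (x i r)"
  have "?f i r \<in> res n \<and> P (?f i r)" if "r \<le> n" for i r
    using that comp by (auto simp: res_iff mult.assoc gen_idem_idem)
  then have "P (\<Sum>i\<in>UNIV. \<Sum>r\<le>n. ?f i r)"
    by (intro conjunct2[OF sum]) (auto intro!: sum)
  also have "(\<Sum>i\<in>UNIV. \<Sum>r\<le>n. ?f i r) = x"
  proof (intro ext)
    fix i r
    have "(\<Sum>i\<in>UNIV. \<Sum>r\<le>n. ?f i r) i r = (\<Sum>i'\<in>UNIV. \<Sum>r'\<le>n. ?f i' r' i r)"
      by (simp only: sum_fun_apply)
    also have "\<dots> = (\<Sum>i'\<in>UNIV. if i' = i then (\<Sum>r'\<le>n. if r' = r then x i r * gen_idem n i else 0) else 0)"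
      by (rule sum.cong[OF refl]) (auto intro!: sum.cong sum.neutral)
    also have "\<dots> = x i r"
      using x by (auto simp: res_iff)
    finally show "(\<Sum>i\<in>UNIV. \<Sum>r\<le>n. ?f i r) i r = x i r" .
  qed
  finally show ?thesis .
qed

definition sg :: "nat \<Rightarrow> 'b::ab_group_add \<Rightarrow> 'b" where
  "sg n x = (if even n then x else - x)"

lemma sg_simps [simp]: "sg (Suc n) x = - sg n x" "sg n (- x) = - sg n x" "sg n 0 = 0" "sg 0 x = x"
  "sg n (sg n x) = x" "sg m (sg n x) = sg (m + n) x"
  by (auto simp: sg_def)

lemma sg_add: "sg n (x + y) = sg n x + sg n y"
  by (simp add: sg_def)

lemma sign_lmul: "lmul ((- 1) ^ n) x = sg n x"
proof (induction n)
  case (Suc n)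
  have "lmul ((- 1) ^ Suc n) x = lmul (- 1) (lmul ((- 1) ^ n) x)"
    by (simp only: power_Suc lmul_simps(3))
  then show ?case by (simp add: Suc lmul_simps)
qed (simp add: lmul_simps)

text \<open>The idempotents built into a cell select the one composable arrow, so the arrows at
  individual vertices may be replaced by \<open>xx\<close> and \<open>yy\<close>.\<close>

lemma diff_gen_cell:
  assumes "n \<ge> 1"
  shows "(diff_gen n i (int r) :: 'k::field chain) =
     cell (n - 1) i (int r) 1 xx + sg n (cell (n - 1) i (int r - 1) 1 yy)
     + sg (n + r) (cell (n - 1) (i + 1) (int r) xx 1 + cell (n - 1) (i + 1) (int r - 1) yy 1)"
proof -
  obtain m where n: "n = Suc m" using assms by (cases n) auto
  have 1: "(i::2) + of_int (int n - 1 - 2 * int r) = i + of_nat m"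
    using vertex_index[of i m "int r"] by (simp add: n)
  have 2: "cell m i r' 1 (arr (i + of_nat m)) = (cell m i r' 1 xx :: 'k chain)"
    "cell m i r' 1 (bar (i + of_nat n)) = (cell m i r' 1 yy :: 'k chain)" for i r'
    by (auto simp: cell_def idem_xx idem_yy n fun_eq_iff add_ac)
  have 3: "cell m (i + 1) r' (arr i) 1 = (cell m (i + 1) r' xx 1 :: 'k chain)"
    "cell m (i + 1) r' (bar (i + 1)) 1 = (cell m (i + 1) r' yy 1 :: 'k chain)" for i r'
    by (auto simp: cell_def idem_xx idem_yy n fun_eq_iff)
  show ?thesis
    unfolding diff_gen_def res_gen_cell lmul_cell sign_lmul 1 vertex_index
    by (simp only: n diff_Suc_1 2[unfolded n] 3 mult_1_left mult_1_right nat_int vertex_diff)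
qed

lemma diff_add: "diff n (x + y) = diff n x + diff n y"
  by (simp add: diff_def lmul_simps sum.distrib)

lemma diff_lmul: "diff n (lmul t x) = lmul t (diff n x)"
  by (simp add: diff_def lmul_sum lmul_simps(3)) (simp add: lmul_def)

lemma diff_zero [simp]: "diff n 0 = 0"
  using diff_add[of n 0 0] by simp

lemma diff_uminus: "diff n (- x) = - diff n x"
  using diff_add[of n x "- x"] by (simp add: eq_neg_iff_add_eq_0 add.commute)

lemma diff_minus: "diff n (x - y) = diff n x - diff n y"
  using diff_add[of n x "- y"] by (simp add: diff_uminus)

lemma diff_in_res [simp]: "n \<ge> 1 \<Longrightarrow> diff n x \<in> res (n - 1)"
  by (auto simp: diff_def diff_gen_cell sg_def intro!: res_sum)

lemma diff_Suc_in_res [simp]: "diff (Suc n) x \<in> res n"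
  using diff_in_res[of "Suc n"] by simp

lemma diff_cell:
  assumes "r \<le> n" "n = Suc m"
  shows "diff n (cell n i (int r) u w) = cell m i (int r) u (xx * w) + sg n (cell m i (int r - 1) u (yy * w))
     + sg (n + r) (cell m (i + 1) (int r) (u * xx) w + cell m (i + 1) (int r - 1) (u * yy) w)"
proof -
  let ?t = "tens (u * idem i) (idem (i + of_nat n) * w)"
  have "diff n (cell n i (int r) u w) = (\<Sum>i'\<in>UNIV. \<Sum>r'\<le>n. if r' = r then if i' = i then lmul ?t (diff_gen n i (int r)) else 0 else 0)"
    unfolding diff_def
    by (intro sum.cong refl) (auto simp: cell_def)
  also have "\<dots> = lmul ?t (diff_gen n i (int r))"
    using assms(1) by simp
  also have "\<dots> = cell m i (int r) u (xx * w) + sg n (cell m i (int r - 1) u (yy * w))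
     + sg (n + r) (cell m (i + 1) (int r) (u * xx) w + cell m (i + 1) (int r - 1) (u * yy) w)"
  proof -
    have sg: "lmul t (sg k x) = sg k (lmul t x)" for t k and x :: "'a chain"
      by (simp add: sg_def lmul_simps)
    have 1: "xx * (idem (i + of_nat n) * w) = idem (i + of_nat m) * (xx * w)"
       "yy * (idem (i + of_nat n) * w) = idem (i + of_nat m) * (yy * w)"
      by (simp_all add: mult.assoc[symmetric] idem_xx_comm assms add_ac)
    have 3: "i + of_nat n = i + 1 + of_nat m" using assms by (simp add: add_ac)
    have m: "n - 1 = m" "n \<ge> 1" using assms by auto
    have 2: "u * idem i * xx = u * xx * idem (i + 1)" "u * idem i * yy = u * yy * idem (i + 1)"
      by (simp_all add: mult.assoc idem_xx_comm add.assoc)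
    show ?thesis
      by (simp only: diff_gen_cell[OF m(2)] m(1) lmul_simps sg lmul_cell 1 2 3 mult_1_left mult_1_right
          cell_idem if_True simp_thms)
        (simp only: 3[symmetric] 1 cell_idem if_True simp_thms)
  qed
  finally show ?thesis .
qed


section \<open>Exactness of the resolution\<close>

text \<open>
  With these rules the simplifier eta-expands equations between chains.
\<close>

declare plus_fun_apply [simp del] zero_fun_apply [simp del]
  minus_apply [simp del] uminus_apply [simp del]

definition sgz :: "int \<Rightarrow> 'b::ab_group_add \<Rightarrow> 'b" where
  "sgz k x = (if even k then x else - x)"

text \<open>Free of bounds on \<open>r\<close>: when the left cell is out of range, so are all cells
  on the right, and at \<open>r = 0\<close> and \<open>r = Suc m\<close> the missing generators are
  zero automatically. The minus signs come from \<open>(-1)^(Suc m)\<close>.\<close>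

lemma diff_cell_Suc:
  "diff (Suc m) (cell (Suc m) i r u w) =
     cell m i r u (xx * w) - sgz (int m) (cell m i (r - 1) u (yy * w))
     - sgz (int m + r) (cell m (i + 1) r (u * xx) w + cell m (i + 1) (r - 1) (u * yy) w)"
proof (cases "0 \<le> r \<and> r \<le> int (Suc m)")
  case True
  then have r: "r = int (nat r)" "nat r \<le> Suc m" by auto
  have "sgz (int m + r) x = sg (m + nat r) x" for x :: "'a chain"
    using r(1) by (simp add: sg_def sgz_def even_nat_iff True)
  then show ?thesis using diff_cell[OF r(2) refl, of i u w] True by (simp add: sgz_def sg_def)
qed (auto simp: sgz_def)

text \<open>Terms with two factors x, or two factors y, on the same side vanish; the others cancel
  in pairs by commutation and by the parities of \<open>m\<close> and \<open>r\<close>.\<close>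

lemma diff_diff: "x \<in> res (Suc (Suc m)) \<Longrightarrow> diff (Suc m) (diff (Suc (Suc m)) x) = 0"
proof (induction rule: res_induct)
  case (cell i r u w)
  have 1: "cell m j s (u * xx * xx) w = 0" "cell m j s (u * yy * yy) w = 0" "cell m j s u (xx * (xx * w)) = 0"
    "cell m j s (u * xx * yy) w = cell m j s (u * yy * xx) w" for j s
    by (simp_all add: mult.assoc xx_yy)
  show ?case
    by (cases "even m"; cases "even r")
      (simp_all add: sgz_def diff_cell_Suc diff_add diff_minus diff_uminus 1 xx_yy add.assoc)
qed (simp_all add: diff_add)

text \<open>
  The homotopy \<open>h\<^sub>x \<otimes> 1 + p\<^sub>x \<otimes> h\<^sub>y\<close> of a tensor product, where the projection \<open>p\<^sub>x\<close> onto the degree 0 part in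
  the direction of \<open>x\<close> is non-zero only for \<open>r = n\<close>.
\<close>

definition homotopy_term :: "nat \<Rightarrow> 2 \<Rightarrow> nat \<Rightarrow> 'k::field lam \<Rightarrow> 'k lam \<Rightarrow> 'k chain" where
  "homotopy_term n i r u w = cell (Suc n) i (int r) u (dx w)
     - (if r = n then sg n (cell (Suc n) i (int r + 1) u (dy w)
         + cell (Suc n) (i + 1) (int r + 1) (u * xx) (dxy w)) else 0)"

definition homotopy :: "nat \<Rightarrow> 'k::field chain \<Rightarrow> 'k chain" where
  "homotopy n x = (\<Sum>i\<in>UNIV. \<Sum>r\<le>n. env_lift (homotopy_term n i r) (x i r))"

lemma balanced_homotopy_term: "balanced (homotopy_term n i r)"
  unfolding balanced_def homotopy_term_def
  by (auto simp: cell_add dx_add distrib_right cell_scale dx_scale scale_mult_left sg_add add_ac)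

text \<open>A cell stores its two factors only after multiplication with the idempotents; this makes
  the value on the cell independent of that.\<close>

lemma homotopy_term_idem:
  "homotopy_term n i r (u * idem i) (idem (i + of_nat n) * w) = homotopy_term n i r u w"
proof -
  have "u * idem i * xx = u * xx * idem (i + 1)"
    by (simp add: mult.assoc idem_xx_comm add.assoc)
  moreover have "i + of_nat n + 1 = i + of_nat (Suc n)" "i + of_nat n = i + 1 + of_nat (Suc n)"
    by (simp_all add: add_ac)
  ultimately show ?thesis
    unfolding homotopy_term_def dx_idem by (simp only: cell_idem if_True simp_thms)
qed

lemma homotopy_add: "homotopy n (x + y) = homotopy n x + homotopy n y"
  by (simp add: homotopy_def plus_fun_apply env_lift_add[OF balanced_homotopy_term] sum.distrib)

lemma homotopy_cell_nat:
  assumes "r \<le> n"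
  shows "homotopy n (cell n i (int r) u w) = homotopy_term n i r u w"
proof -
  have z: "env_lift (homotopy_term n i' r') 0 = 0" for i' r'
    using env_lift_add[OF balanced_homotopy_term, of n i' r' 0 0] by simp
  have "homotopy n (cell n i (int r) u w)
      = (\<Sum>i'\<in>UNIV. \<Sum>r'\<le>n. if r' = r then if i' = i then homotopy_term n i r u w else 0 else 0)"
    unfolding homotopy_def
    by (intro sum.cong refl)
      (auto simp: cell_def z env_lift_tens[OF balanced_homotopy_term] homotopy_term_idem)
  also have "\<dots> = homotopy_term n i r u w" using assms by simp
  finally show ?thesis .
qed

lemma homotopy_zero [simp]: "homotopy n 0 = 0"
  using homotopy_add[of n 0 0] by simp

lemma homotopy_cell:
  "homotopy n (cell n i r u w) = (if 0 \<le> r \<and> r \<le> int n then cell (Suc n) i r u (dx w)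
     - (if r = int n then sg n (cell (Suc n) i (r + 1) u (dy w)
         + cell (Suc n) (i + 1) (r + 1) (u * xx) (dxy w)) else 0) else 0)"
proof (cases "0 \<le> r \<and> r \<le> int n")
  case True
  then have "r = int (nat r)" "nat r \<le> n" by auto
  then show ?thesis
    using homotopy_cell_nat[of "nat r" n i u w] True by (auto simp: homotopy_term_def)
qed auto

lemma homotopy_uminus: "homotopy n (- x) = - homotopy n x"
  using homotopy_add[of n x "- x"] by (simp add: eq_neg_iff_add_eq_0 add.commute)

lemma homotopy_minus: "homotopy n (x - y) = homotopy n x - homotopy n y"
  using homotopy_add[of n x "- y"] by (simp add: homotopy_uminus)

lemma cell_minus: "cell n i r u (v - w) = cell n i r u v - cell n i r u w"
  using cell_add(2)[of n i r u v "- w"] by (simp add: cell_uminus)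

text \<open>The contraction identities oriented as rewrite rules, so that right factors reach a
  normal form and the homotopy identity is left to linear arithmetic in chains.\<close>

lemma cell_dx_identities:
  "cell n i r u (dx (xx * w)) = cell n i r u w - cell n i r u (xx * dx w)"
  "cell n i r u (dx (yy * w)) = cell n i r u (yy * dx w)"
  "cell n i r u (dy (xx * w)) = 0"
  "cell n i r u (dxy (xx * w)) = cell n i r u (dy w)"
  "cell n i r u (yy * dy w) = cell n i r u w - cell n i r u (xx * dx w) - cell n i r u (dy (yy * w))"
  "cell n i r u (yy * dxy w) = cell n i r u (dx w) - cell n i r u (dxy (yy * w))"
proof -
  have 1: "dx (xx * w) = w - xx * dx w" by (metis add_diff_cancel_right' dx_identities(1))
  have 2: "yy * dy w = w - xx * dx w - dy (yy * w)" by (metis 1 add_diff_cancel_right' dx_identities(5))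
  have 3: "yy * dxy w = dx w - dxy (yy * w)" by (metis add_diff_cancel_right' dx_identities(6))
  show "cell n i r u (dx (xx * w)) = cell n i r u w - cell n i r u (xx * dx w)"
    "cell n i r u (dx (yy * w)) = cell n i r u (yy * dx w)"
    "cell n i r u (dy (xx * w)) = 0"
    "cell n i r u (dxy (xx * w)) = cell n i r u (dy w)"
    "cell n i r u (yy * dy w) = cell n i r u w - cell n i r u (xx * dx w) - cell n i r u (dy (yy * w))"
    "cell n i r u (yy * dxy w) = cell n i r u (dx w) - cell n i r u (dxy (yy * w))"
    by (simp_all only: 1 2 3 dx_identities(2-4) cell_minus cell_zero)
qed

lemma homotopy_identity:
  assumes "x \<in> res (Suc m)"
  shows "diff (Suc (Suc m)) (homotopy (Suc m) x) + homotopy m (diff (Suc m) x) = x"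
  using assms
proof (induction rule: res_induct)
  case (cell i r u w)
  have 1: "cell k j s (u * xx * xx) v = 0" "cell k j s (u * yy * yy) v = 0"
    "cell k j s (u * (xx * xx)) v = 0" "cell k j s (u * (yy * yy)) v = 0"
    "cell k j s (u * (xx * yy)) v = cell k j s (u * (yy * xx)) v"
    "cell k j s (u * xx * yy) v = cell k j s (u * yy * xx) v" for k j s v
    by (simp_all add: mult.assoc xx_yy)
  have [simp]: "1 + (i + 1) = i" using vertex_add_self(2)[of 1 i] by (simp add: add.commute)
  note s = diff_add diff_minus diff_uminus homotopy_add homotopy_minus homotopy_uminus 1 diff_cell_Suc homotopy_cell
    cell_dx_identities sgz_def sg_def
  \<comment> \<open>The summand with \<open>dy\<close> and \<open>dxy\<close> occurs only at top
    index: for \<open>r = Suc m\<close> in both homotopies, for \<open>r = m\<close> only in the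
    homotopy of the boundary, and for \<open>r < m\<close> in neither.\<close>
  consider "r = Suc m" | "r = m" | "r < m" using cell by linarith
  then show ?case
  proof cases
    case 1
    then show ?thesis
      by (cases "even m") (simp_all add: s algebra_simps del: mult.assoc)
  next
    case 2
    then show ?thesis
      by (cases "even m") (simp_all add: s algebra_simps del: mult.assoc)
  next
    case 3
    then show ?thesis
      by (cases "even m"; cases "even r") (simp_all add: s algebra_simps del: mult.assoc)
  qed
next
  case (add x y)
  then show ?case by (simp add: diff_add homotopy_add algebra_simps)
qed

lemma aug_add: "aug (x + y) = aug x + aug y"
  by (simp add: aug_def plus_fun_apply act_add_left sum.distrib)

lemma aug_zero [simp]: "aug 0 = 0"
  using aug_add[of 0 0] by simp

lemma aug_uminus: "aug (- x) = - aug x"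
  using aug_add[of x "- x"] by (simp add: eq_neg_iff_add_eq_0 add.commute)

lemma aug_minus: "aug (x - y) = aug x - aug y"
  using aug_add[of x "- y"] by (simp add: aug_uminus)

lemma aug_lmul: "aug (lmul t x) = act t (aug x)"
  by (simp add: aug_def lmul_def act_mult act_sum_right)

lemma aug_cell: "aug (cell 0 i 0 u w) = u * idem i * w"
proof -
  have "aug (cell 0 i 0 u w) = (\<Sum>i'\<in>UNIV. if i' = i then act (tens (u * idem i) (idem i * w)) 1 else 0)"
    unfolding aug_def by (rule sum.cong) (auto simp: cell_def)
  then show ?thesis by (simp add: act_tens mult.assoc[symmetric]) (simp add: mult.assoc)
qed

lemma aug_diff: "x \<in> res (Suc 0) \<Longrightarrow> aug (diff (Suc 0) x) = 0"
proof (induction rule: res_induct)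
  case (cell i r u w)
  have "u * idem i * xx = u * xx * idem (i + 1)" "u * idem i * yy = u * yy * idem (i + 1)"
    by (simp_all add: mult.assoc idem_xx_comm add.assoc)
  moreover have "r = 0 \<or> r = 1" using cell by auto
  ultimately show ?case
    by (auto simp: diff_cell_Suc aug_add aug_minus aug_uminus aug_cell sgz_def mult.assoc[symmetric])
qed (simp add: diff_add aug_add)

text \<open>The section of the augmentation that puts everything into the left factor; like the
  homotopy it is linear on the left only.\<close>

definition aug_section :: "'k::field lam \<Rightarrow> 'k chain" where
  "aug_section v = (\<Sum>i\<in>UNIV. cell 0 i 0 v 1)"

lemma aug_section_in_res [simp]: "aug_section v \<in> res 0"
  by (simp add: aug_section_def)

lemma sum_idem: "(\<Sum>i\<in>UNIV. idem i) = 1"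
  by (rule lam_eqI) (use vertex_cases in \<open>auto simp: UNIV_vertex\<close>)

lemma aug_aug_section: "aug (aug_section v) = v"
proof -
  have "aug (aug_section v) = (\<Sum>i\<in>UNIV. v * idem i)"
    unfolding aug_section_def
    by (subst sum_comp_morphism[of aug, symmetric]) (simp_all add: aug_add aug_cell)
  then show ?thesis by (simp add: sum_distrib_left[symmetric] sum_idem)
qed

lemma aug_section_add: "aug_section (v + w) = aug_section v + aug_section w"
  by (simp add: aug_section_def cell_add sum.distrib)

lemma homotopy_identity_0:
  assumes "x \<in> res 0"
  shows "diff (Suc 0) (homotopy 0 x) + aug_section (aug x) = x"
  using assms
proof (induction rule: res_induct)
  case (cell i r u w)
  \<comment> \<open>\<open>dy\<close> and \<open>dxy\<close> produce multiples of idempotents, whose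
    scalars can pass to the left factor.\<close>
  have 1: "cell 0 j 0 v (dy z) = cell 0 j 0 (scale (coord_b j z) v) 1"
    "cell 0 j 0 v (dxy z) = cell 0 j 0 (scale (coord_s j z) v) 1" for j v z
  proof -
    have "idem j * dy z = idem j * scale (coord_b j z) 1" "idem j * dxy z = idem j * scale (coord_s j z) 1"
      by (auto intro!: lam_eqI)
    then show "cell 0 j 0 v (dy z) = cell 0 j 0 (scale (coord_b j z) v) 1"
      "cell 0 j 0 v (dxy z) = cell 0 j 0 (scale (coord_s j z) v) 1"
      by (auto simp: cell_def fun_eq_iff scale_mult_left tens_scale scale_mult_right)
  qed
  \<comment> \<open>Each basis element is written as a word ending in an idempotent: the word joins
    the left factor and the idempotent is absorbed by the cell.\<close>
  have 2: "idem i * w * idem i = scale (coord_e i w) (idem i) + scale (coord_s i w) (yy * xx * idem i)"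
    "idem i * w * idem (i + 1) = scale (coord_a i w) (xx * idem (i + 1)) + scale (coord_b (i + 1) w) (yy * idem (i + 1))"
    by (auto intro!: lam_eqI simp: add.assoc)
  have "aug_section (u * idem i * w) = (\<Sum>j\<in>{i, i + 1}. cell 0 j 0 (u * (idem i * w * idem j)) 1)"
    unfolding aug_section_def
    by (rule sum.cong) (use vertex_cases[of i] in \<open>auto simp: UNIV_vertex mult.assoc[symmetric]\<close>)
  also have "\<dots> = cell 0 i 0 (u * (idem i * w * idem i)) 1 + cell 0 (i + 1) 0 (u * (idem i * w * idem (i + 1))) 1"
    by simp
  also have "\<dots> = cell 0 i 0 (scale (coord_e i w) u + scale (coord_s i w) (u * yy * xx)) 1
      + cell 0 (i + 1) 0 (scale (coord_a i w) (u * xx) + scale (coord_b (i + 1) w) (u * yy)) 1"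
    by (simp only: 2 distrib_left scale_mult_right mult.assoc[symmetric] cell_add cell_scale cell_idem if_True simp_thms)
  finally show ?case
    using cell
    by (simp add: homotopy_cell diff_add diff_minus diff_uminus diff_cell_Suc sgz_def aug_cell 1 cell_add cell_dx_identities mult.assoc xx_yy)
next
  case (add x y)
  then show ?case by (simp add: diff_add homotopy_add aug_add aug_section_add algebra_simps)
qed

lemma exact_0: "x \<in> res 0 \<Longrightarrow> aug x = 0 \<Longrightarrow> diff (Suc 0) (homotopy 0 x) = x"
  using homotopy_identity_0[of x] by (simp add: aug_section_def)

lemma exact_Suc: "x \<in> res (Suc m) \<Longrightarrow> diff (Suc m) x = 0 \<Longrightarrow> diff (Suc (Suc m)) (homotopy (Suc m) x) = x"
  using homotopy_identity[of x m] by simp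

lemma homotopy_in_res [simp]: "homotopy n (x :: 'k::field chain) \<in> res (Suc n)"
proof -
  have "env_lift (homotopy_term n i r) t \<in> res (Suc n)" for i r and t :: "'k env"
    by (induction t rule: env_induct)
      (simp_all add: env_lift_tens env_lift_add balanced_homotopy_term, auto simp: homotopy_term_def sg_def)
  then show ?thesis by (simp add: homotopy_def)
qed


section \<open>Lifting cocycles\<close>

text \<open>The augmentation acts as the differential out of degree 0, so that lifting needs no
  separate treatment of the lowest degree.\<close>

definition boundary_free :: "nat \<Rightarrow> 'k::field chain \<Rightarrow> bool" where
  "boundary_free n x \<longleftrightarrow> (case n of 0 \<Rightarrow> aug x = 0 | Suc m \<Rightarrow> diff (Suc m) x = 0)"

lemma exact_res: "x \<in> res n \<Longrightarrow> boundary_free n x \<Longrightarrow> diff (Suc n) (homotopy n x) = x"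
  by (cases n) (simp_all add: boundary_free_def exact_0 exact_Suc)

lemma lmul_apply: "lmul t x i r = t * x i r"
  by (simp add: lmul_def)

lemma act_uminus_right: "act t (- z) = - act t z"
  using act_add_right[of t z "- z"] by (simp add: eq_neg_iff_add_eq_0 add.commute)

lemma act_minus_right: "act t (z - w) = act t z - act t w"
  using act_add_right[of t z "- w"] by (simp add: act_uminus_right)

lemma res_homsD:
  assumes "F \<in> res_homs m n"
  shows "x \<in> res m \<Longrightarrow> F x \<in> res n" "x \<in> res m \<Longrightarrow> y \<in> res m \<Longrightarrow> F (x + y) = F x + F y"
    "x \<in> res m \<Longrightarrow> F (lmul t x) = lmul t (F x)" "x \<notin> res m \<Longrightarrow> F x = 0"
  using assms by (auto simp: res_homs_def)

lemma cochainsD: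
  assumes "f \<in> cochains n"
  shows "x \<in> res n \<Longrightarrow> y \<in> res n \<Longrightarrow> f (x + y) = f x + f y"
    "x \<in> res n \<Longrightarrow> f (lmul t x) = act t (f x)" "x \<notin> res n \<Longrightarrow> f x = 0"
  using assms by (auto simp: cochains_def)

lemma res_homs_zero [simp]: "F \<in> res_homs m n \<Longrightarrow> F 0 = 0"
  using res_homsD(3)[of F m n 0 0] by simp

lemma cochains_zero [simp]: "f \<in> cochains n \<Longrightarrow> f 0 = 0"
  using cochainsD(2)[of f n 0 0] by simp

lemma res_homs_uminus: "F \<in> res_homs m n \<Longrightarrow> x \<in> res m \<Longrightarrow> F (- x) = - F x"
  using res_homsD(3)[of F m n x "- 1"] by (simp add: lmul_simps)

lemma cochains_uminus: "f \<in> cochains n \<Longrightarrow> x \<in> res n \<Longrightarrow> f (- x) = - f x"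
  using cochainsD(2)[of f n x "- 1"] by (simp add: lmul_simps act_uminus_left)

lemma cochains_minus:
  "f \<in> cochains n \<Longrightarrow> x \<in> res n \<Longrightarrow> y \<in> res n \<Longrightarrow> f (x - y) = f x - f y"
  using cochainsD(1)[of f n x "- y"] by (simp add: cochains_uminus)

lemma sum_hom:
  assumes "h 0 = 0" "\<And>x y. x \<in> res n \<Longrightarrow> y \<in> res n \<Longrightarrow> h (x + y) = h x + h y"
    and "\<And>a. a \<in> A \<Longrightarrow> g a \<in> res n"
  shows "h (sum g A) = (\<Sum>a\<in>A. h (g a) :: 'b::ab_group_add)"
  using assms(3)
  by (induction A rule: infinite_finite_induct) (use assms(1,2) in simp_all)

text \<open>The summands are projective, not free: the generator \<open>(i, r)\<close> is sent to
  the product of its idempotent with \<open>w i r\<close>, so that arbitrary values \<open>w\<close>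
  are admissible.\<close>

definition hom_of :: "nat \<Rightarrow> (2 \<Rightarrow> nat \<Rightarrow> 'k::field chain) \<Rightarrow> 'k chain \<Rightarrow> 'k chain" where
  "hom_of m w = extend0 m (\<lambda>x. \<Sum>i\<in>UNIV. \<Sum>r\<le>m. lmul (x i r) (w i r))"

lemma hom_of_in_res_homs:
  assumes "\<And>i r. r \<le> m \<Longrightarrow> w i r \<in> res n"
  shows "hom_of m w \<in> res_homs m n"
  using assms
  by (auto simp: hom_of_def res_homs_def extend0_def plus_fun_apply lmul_simps sum.distrib lmul_sum
      intro!: res_sum) (simp add: lmul_def)

lemma coch_in_cochains [simp]: "coch n v \<in> cochains n"
  by (auto simp: coch_def cochains_def extend0_def plus_fun_apply act_add_left sum.distrib act_sum_right
      lmul_apply act_mult)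

lemma res_expand:
  assumes "x \<in> res m"
  shows "x = (\<Sum>i\<in>UNIV. \<Sum>r\<le>m. lmul (x i r) (res_gen m i (int r)))"
proof (intro ext)
  fix i r
  have "(\<Sum>i\<in>UNIV. \<Sum>r\<le>m. lmul (x i r) (res_gen m i (int r))) i r
      = (\<Sum>i'\<in>UNIV. \<Sum>r'\<le>m. if r' = r then if i' = i then x i r else 0 else 0)"
    unfolding sum_fun_apply
    using assms by (intro sum.cong refl) (auto simp: lmul_def res_gen_def res_iff)
  then show "x i r = (\<Sum>i\<in>UNIV. \<Sum>r\<le>m. lmul (x i r) (res_gen m i (int r))) i r"
    using assms by (cases "r \<le> m") (simp_all add: res_iff)
qed

lemma res_gen_in_res [simp]: "res_gen m i r \<in> res m"
  by (simp add: res_gen_cell)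

lemma res_homs_expand:
  assumes F: "F \<in> res_homs m n" and x: "x \<in> res m"
  shows "F x = (\<Sum>i\<in>UNIV. \<Sum>r\<le>m. lmul (x i r) (F (res_gen m i (int r))))"
proof -
  note s = sum_hom[of F m, OF res_homs_zero[OF F] res_homsD(2)[OF F]]
  have "F x = F (\<Sum>i\<in>UNIV. \<Sum>r\<le>m. lmul (x i r) (res_gen m i (int r)))"
    using res_expand[OF x] by simp
  then show ?thesis by (simp add: s res_homsD(3)[OF F])
qed

lemma cochains_expand:
  assumes f: "f \<in> cochains n" and x: "x \<in> res n"
  shows "f x = (\<Sum>i\<in>UNIV. \<Sum>r\<le>n. act (x i r) (f (res_gen n i (int r))))"
proof -
  note s = sum_hom[of f n, OF cochains_zero[OF f] cochainsD(1)[OF f]]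
  have "f x = f (\<Sum>i\<in>UNIV. \<Sum>r\<le>n. lmul (x i r) (res_gen n i (int r)))"
    using res_expand[OF x] by simp
  then show ?thesis by (simp add: s cochainsD(2)[OF f])
qed

text \<open>The homotopy is not linear on the right, so \<open>homotopy n \<circ> F\<close> would
  not be a bimodule map. It is applied to the images of the generators only, and the result is
  extended linearly.\<close>

lemma projective_lift:
  assumes F: "F \<in> res_homs m n" and b: "\<And>x. x \<in> res m \<Longrightarrow> boundary_free n (F x)"
  shows "\<exists>L\<in>res_homs m (Suc n). \<forall>x\<in>res m. diff (Suc n) (L x) = F x"
proof (intro bexI ballI)
  let ?L = "hom_of m (\<lambda>i r. homotopy n (F (res_gen m i (int r))))"
  show "?L \<in> res_homs m (Suc n)" by (rule hom_of_in_res_homs) simp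
  fix x :: "'a chain" assume x: "x \<in> res m"
  have [simp]: "diff (Suc n) (homotopy n (F (res_gen m i r))) = F (res_gen m i r)" for i r
    by (intro exact_res b res_homsD(1)[OF F]) simp_all
  have "diff (Suc n) (?L x) = (\<Sum>i\<in>UNIV. \<Sum>r\<le>m. lmul (x i r) (F (res_gen m i (int r))))"
    using x by (simp add: hom_of_def extend0_def sum_comp_morphism[of "diff (Suc n)", unfolded comp_def, symmetric] diff_add diff_lmul)
  then show "diff (Suc n) (?L x) = F x"
    using res_homs_expand[OF F x] by simp
qed

section \<open>Closure properties of homomorphisms, cochains, coboundaries and cocycles\<close>

lemma res_homs_comp: "F \<in> res_homs m n \<Longrightarrow> G \<in> res_homs k m \<Longrightarrow> F \<circ> G \<in> res_homs k n"
  unfolding res_homs_def[of k n] by (auto simp: res_homsD)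

lemma cochains_comp: "f \<in> cochains n \<Longrightarrow> G \<in> res_homs m n \<Longrightarrow> f \<circ> G \<in> cochains m"
  unfolding cochains_def[of m] by (auto simp: res_homsD cochainsD)

lemma res_homs_comp_diff: "F \<in> res_homs m n \<Longrightarrow> extend0 (Suc m) (F \<circ> diff (Suc m)) \<in> res_homs (Suc m) n"
  unfolding res_homs_def[of "Suc m" n]
  by (auto simp: res_homsD extend0_def diff_add diff_lmul)

lemma cochains_comp_diff: "f \<in> cochains m \<Longrightarrow> extend0 (Suc m) (f \<circ> diff (Suc m)) \<in> cochains (Suc m)"
  unfolding cochains_def[of "Suc m"]
  by (auto simp: cochainsD extend0_def diff_add diff_lmul)

lemma extend0_cochain: "f \<in> cochains n \<Longrightarrow> extend0 n f = f"
  by (auto simp: extend0_def cochainsD fun_eq_iff)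

lemma res_homs_closed:
  "F \<in> res_homs m n \<Longrightarrow> G \<in> res_homs m n \<Longrightarrow> F + G \<in> res_homs m n"
  "F \<in> res_homs m n \<Longrightarrow> G \<in> res_homs m n \<Longrightarrow> F - G \<in> res_homs m n"
  "0 \<in> res_homs m n"
  unfolding res_homs_def[of m n]
  by (auto simp: res_homsD plus_fun_apply minus_apply zero_fun_apply lmul_simps)

lemma cochains_closed [simp]:
  "f \<in> cochains n \<Longrightarrow> g \<in> cochains n \<Longrightarrow> f + g \<in> cochains n"
  "f \<in> cochains n \<Longrightarrow> g \<in> cochains n \<Longrightarrow> f - g \<in> cochains n"
  "f \<in> cochains n \<Longrightarrow> - f \<in> cochains n"
  "0 \<in> cochains n"
  "f \<in> cochains n \<Longrightarrow> (\<lambda>x. scale c (f x)) \<in> cochains n"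
  unfolding cochains_def
  by (auto simp: plus_fun_apply minus_apply uminus_apply zero_fun_apply act_add_right scale_add_right act_scale
      scale_zero_right act_minus_right act_uminus_right)


lemma coboundaries_in_cochains: "b \<in> coboundaries n \<Longrightarrow> b \<in> cochains n"
  by (cases n) (auto simp: cochains_comp_diff)

lemma coboundariesE:
  assumes "b \<in> coboundaries (Suc n)"
  obtains k where "k \<in> cochains n" "b = extend0 (Suc n) (k \<circ> diff (Suc n))"
  using assms by auto

lemma coboundaries_closed [simp]:
  fixes a b :: "'k::field chain \<Rightarrow> 'k lam"
  shows
  "(0 :: 'k chain \<Rightarrow> 'k lam) \<in> coboundaries n"
  "a \<in> coboundaries n \<Longrightarrow> b \<in> coboundaries n \<Longrightarrow> a + b \<in> coboundaries n"
  "a \<in> coboundaries n \<Longrightarrow> b \<in> coboundaries n \<Longrightarrow> a - b \<in> coboundaries n"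
  "a \<in> coboundaries n \<Longrightarrow> - a \<in> coboundaries n"
  "a \<in> coboundaries n \<Longrightarrow> (\<lambda>x. scale c (a x)) \<in> coboundaries n"
proof -
  have "(0 :: 'k chain \<Rightarrow> 'k lam) \<in> coboundaries n \<and>
    (a \<in> coboundaries n \<longrightarrow> b \<in> coboundaries n \<longrightarrow> a + b \<in> coboundaries n) \<and>
    (a \<in> coboundaries n \<longrightarrow> b \<in> coboundaries n \<longrightarrow> a - b \<in> coboundaries n) \<and>
    (a \<in> coboundaries n \<longrightarrow> - a \<in> coboundaries n) \<and>
    (a \<in> coboundaries n \<longrightarrow> (\<lambda>x. scale c (a x)) \<in> coboundaries n)"
  proof (cases n)
    case 0
    then show ?thesis
      by (simp add: fun_eq_iff zero_fun_apply scale_zero_right plus_fun_apply minus_apply uminus_apply)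
  next
    case (Suc m)
    let ?d = "\<lambda>g. extend0 (Suc m) (g \<circ> diff (Suc m))"
    have "?d 0 = 0" "?d g + ?d h = ?d (g + h)" "?d g - ?d h = ?d (g - h)" "- ?d g = ?d (- g)"
      "(\<lambda>x. scale c (?d g x)) = ?d (\<lambda>x. scale c (g x))" for g h :: "'k chain \<Rightarrow> 'k lam"
      by (auto simp: extend0_def fun_eq_iff plus_fun_apply minus_apply uminus_apply zero_fun_apply scale_zero_right)
    note e = this
    have "(0 :: 'k chain \<Rightarrow> 'k lam) \<in> ?d ` cochains m"
      by (rule image_eqI[of _ _ 0]) (simp_all only: e cochains_closed)
    then show ?thesis unfolding Suc coboundaries.simps
      by (intro conjI impI; elim imageE; hypsubst?; (simp only: e)?; (intro imageI)?; simp?)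
  qed
  then show "(0 :: 'k chain \<Rightarrow> 'k lam) \<in> coboundaries n"
    "a \<in> coboundaries n \<Longrightarrow> b \<in> coboundaries n \<Longrightarrow> a + b \<in> coboundaries n"
    "a \<in> coboundaries n \<Longrightarrow> b \<in> coboundaries n \<Longrightarrow> a - b \<in> coboundaries n"
    "a \<in> coboundaries n \<Longrightarrow> - a \<in> coboundaries n"
    "a \<in> coboundaries n \<Longrightarrow> (\<lambda>x. scale c (a x)) \<in> coboundaries n"
    by blast+
qed

lemma cocycles_cochains: "f \<in> cocycles n \<Longrightarrow> f \<in> cochains n"
  by (simp add: cocycles_def)

lemma cocyclesD: "f \<in> cocycles n \<Longrightarrow> x \<in> res (Suc n) \<Longrightarrow> f (diff (Suc n) x) = 0"
  by (simp add: cocycles_def)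

lemma cocycles_closed [simp]:
  "f \<in> cocycles n \<Longrightarrow> g \<in> cocycles n \<Longrightarrow> f + g \<in> cocycles n"
  "f \<in> cocycles n \<Longrightarrow> g \<in> cocycles n \<Longrightarrow> f - g \<in> cocycles n"
  "f \<in> cocycles n \<Longrightarrow> - f \<in> cocycles n"
  "0 \<in> cocycles n"
  "f \<in> cocycles n \<Longrightarrow> (\<lambda>x. scale c (f x)) \<in> cocycles n"
  by (simp_all add: cocycles_def plus_fun_apply minus_apply uminus_apply zero_fun_apply scale_zero_right)

lemma coboundaries_cocycles [simp]: "b \<in> coboundaries n \<Longrightarrow> b \<in> cocycles n"
proof (cases n)
  case (Suc m)
  assume b: "b \<in> coboundaries n"
  then obtain k where k: "k \<in> cochains m" "b = extend0 n (k \<circ> diff n)"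
    unfolding Suc by (rule coboundariesE)
  then show ?thesis
    using coboundaries_in_cochains[OF b] by (auto simp: cocycles_def extend0_def Suc diff_diff)
qed auto

lemma cocycles_zero [simp]: "f \<in> cocycles n \<Longrightarrow> f 0 = 0"
  by (rule cochains_zero[OF cocycles_cochains])

declare cocycles_cochains [simp] cocyclesD [simp]

section \<open>Existence and comparison of lifts\<close>

lemma is_liftD:
  assumes "is_lift q g G"
  shows "G p \<in> res_homs (p + q) p" "x \<in> res q \<Longrightarrow> aug (G 0 x) = g x"
    "x \<in> res (Suc (p + q)) \<Longrightarrow> diff (Suc p) (G (Suc p) x) = G p (diff (Suc (p + q)) x)"
  using assms by (auto simp: is_lift_def)

lemma lift_chain_exists:
  fixes g :: "'k::field chain \<Rightarrow> 'k lam"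
  assumes g: "g \<in> cochains q"
  shows "\<exists>S\<in>res_homs q 0. \<forall>x\<in>res q. aug (S x) = g x"
proof (intro bexI ballI)
  let ?S = "hom_of q (\<lambda>i r. aug_section (g (res_gen q i (int r))))"
  show "?S \<in> res_homs q 0" by (rule hom_of_in_res_homs) simp
  fix x :: "'k chain" assume x: "x \<in> res q"
  show "aug (?S x) = g x"
    using x by (simp add: hom_of_def extend0_def sum_comp_morphism[of aug, unfolded comp_def, symmetric] aug_add
        aug_lmul aug_aug_section cochains_expand[OF g x])
qed

lemma lift_exists:
  fixes g :: "'k::field chain \<Rightarrow> 'k lam"
  assumes g: "g \<in> cocycles q"
  shows "\<exists>G. is_lift q g G"
proof -
  \<comment> \<open>The last conjunct is the hypothesis under which \<open>projective_lift\<close>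
    supplies the next component.\<close>
  let ?P = "\<lambda>p G. G \<in> res_homs (p + q) p \<and> (p = 0 \<longrightarrow> (\<forall>x\<in>res q. aug (G x) = g x)) \<and>
      (\<forall>x\<in>res (Suc (p + q)). boundary_free p (G (diff (Suc (p + q)) x)))"
  let ?Q = "\<lambda>p G G'. \<forall>x\<in>res (Suc (p + q)). diff (Suc p) (G' x) = G (diff (Suc (p + q)) x)"
  have "\<exists>G. \<forall>p. ?P p (G p) \<and> ?Q p (G p) (G (Suc p))"
  proof (rule dependent_nat_choice)
    obtain S where "S \<in> res_homs q 0" "\<forall>x\<in>res q. aug (S x) = g x"
      using lift_chain_exists[of g q] g by auto
    then show "\<exists>G. ?P 0 G"
      using g by (intro exI[of _ S]) (auto simp: boundary_free_def)
  next
    fix G p assume P: "?P p G"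
    let ?F = "extend0 (Suc (p + q)) (G \<circ> diff (Suc (p + q)))"
    have "?F \<in> res_homs (Suc (p + q)) p" using P res_homs_comp_diff by blast
    moreover have "boundary_free p (?F x)" if "x \<in> res (Suc (p + q))" for x
      using P that by (auto simp: extend0_def)
    ultimately obtain L where L: "L \<in> res_homs (Suc (p + q)) (Suc p)"
      "\<forall>x\<in>res (Suc (p + q)). diff (Suc p) (L x) = ?F x"
      using projective_lift by blast
    have "boundary_free (Suc p) (L (diff (Suc (Suc (p + q))) x))" if "x \<in> res (Suc (Suc (p + q)))" for x
      using L(2) that P by (auto simp: boundary_free_def extend0_def diff_diff)
    then show "\<exists>G'. ?P (Suc p) G' \<and> ?Q p G G'"
      using L by (intro exI[of _ L]) (auto simp: extend0_def)
  qed
  then show ?thesis by (auto simp: is_lift_def)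
qed

text \<open>
  A lift of \<open>0\<close> is null-homotopic, and composing a cocycle with the homotopy gives the cochain sought.
\<close>

lemma comp_null_lift:
  assumes f: "f \<in> cocycles p" and G: "is_lift q g G" and g: "\<And>x. x \<in> res q \<Longrightarrow> g x = 0"
  shows "f \<circ> G p \<in> coboundaries (p + q)"
proof -
  note GD = is_liftD[OF G]
  \<comment> \<open>\<open>S p\<close> is the component of the null homotopy; the last conjunct says
    that the error still to be lifted is a cycle.\<close>
  let ?P = "\<lambda>p S. S \<in> res_homs (p + q) (Suc p) \<and> (p = 0 \<longrightarrow> (\<forall>x\<in>res q. diff (Suc 0) (S x) = G 0 x)) \<and>
     (\<forall>x\<in>res (Suc (p + q)). diff (Suc p) (G (Suc p) x - S (diff (Suc (p + q)) x)) = 0)"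
  let ?Q = "\<lambda>p S S'. \<forall>x\<in>res (Suc (p + q)). diff (Suc (Suc p)) (S' x) = G (Suc p) x - S (diff (Suc (p + q)) x)"
  have "\<exists>S. \<forall>p. ?P p (S p) \<and> ?Q p (S p) (S (Suc p))"
  proof (rule dependent_nat_choice)
    have "\<exists>L\<in>res_homs q (Suc 0). \<forall>x\<in>res q. diff (Suc 0) (L x) = G 0 x"
      using GD(1)[of 0] GD(2) g by (intro projective_lift) (auto simp: boundary_free_def)
    then obtain L where L: "L \<in> res_homs q (Suc 0)" "\<forall>x\<in>res q. diff (Suc 0) (L x) = G 0 x" by blast
    then show "\<exists>S. ?P 0 S"
      using GD(3)[of _ 0] by (intro exI[of _ L]) (auto simp: diff_minus)
  next
    fix S p assume P: "?P p S"
    let ?F = "G (Suc p) - extend0 (Suc (p + q)) (S \<circ> diff (Suc (p + q)))"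
    have "?F \<in> res_homs (Suc (p + q)) (Suc p)"
      using P GD(1)[of "Suc p"] by (intro res_homs_closed(2) res_homs_comp_diff) auto
    moreover have "boundary_free (Suc p) (?F x)" if "x \<in> res (Suc (p + q))" for x
      using P that by (auto simp: extend0_def boundary_free_def minus_apply)
    ultimately obtain L where L: "L \<in> res_homs (Suc (p + q)) (Suc (Suc p))"
      "\<forall>x\<in>res (Suc (p + q)). diff (Suc (Suc p)) (L x) = ?F x"
      using projective_lift by blast
    have S0: "S 0 = 0" using P res_homs_zero by blast
    have "diff (Suc (Suc p)) (G (Suc (Suc p)) x - L (diff (Suc (Suc (p + q))) x)) = 0"
      if "x \<in> res (Suc (Suc (p + q)))" for x
      using L(2) GD(3)[of x "Suc p"] that P by (simp add: diff_minus minus_apply extend0_def diff_diff S0)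
    then show "\<exists>S'. ?P (Suc p) S' \<and> ?Q p S S'"
      using L by (intro exI[of _ L]) (auto simp: extend0_def minus_apply)
  qed
  then obtain S where "\<forall>p. ?P p (S p) \<and> ?Q p (S p) (S (Suc p))" by (rule exE)
  note S = this[THEN spec, THEN conjunct1] this[THEN spec, THEN conjunct2]
  show ?thesis
  proof (cases p)
    case 0
    have "f (G 0 x) = 0" for x
    proof (cases "x \<in> res q")
      case True
      then have "f (G 0 x) = f (diff (Suc 0) (S 0 x))" using S(1)[of 0] by simp
      also have "\<dots> = 0" using f 0 True S(1)[of 0] cocyclesD[of f 0 "S 0 x"] res_homsD(1)[of "S 0" q "Suc 0" x] by simp
      finally show ?thesis .
    qed (use GD(1)[of 0] f in \<open>auto simp: res_homsD(4)\<close>)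
    then have "f \<circ> G p = 0" by (auto simp: fun_eq_iff zero_fun_apply 0)
    then show ?thesis by simp
  next
    case (Suc k)
    have k: "f \<circ> S k \<in> cochains (k + q)"
      using cochains_comp[OF cocycles_cochains[OF f[unfolded Suc]], of "S k" "k + q"] S(1)[of k] by blast
    have "f (G p x) = f (S k (diff (p + q) x))" if "x \<in> res (p + q)" for x
    proof -
      have 1: "S p x \<in> res (Suc p)"
        using res_homsD(1)[OF conjunct1[OF S(1)[of p]] that] .
      have 2: "S k (diff (p + q) x) \<in> res p"
        using res_homsD(1)[OF conjunct1[OF S(1)[of k]], of "diff (p + q) x"] by (simp add: Suc)
      have "G p x = diff (Suc p) (S p x) + S k (diff (p + q) x)"
        using S(2)[of k] that by (simp add: Suc)
      then show ?thesis
        using f 1 2 cochainsD(1)[of f p "diff (Suc p) (S p x)" "S k (diff (p + q) x)"] by simp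
    qed
    then have "f \<circ> G p = extend0 (Suc (k + q)) ((f \<circ> S k) \<circ> diff (Suc (k + q)))"
      using GD(1)[of p] f by (auto simp: fun_eq_iff extend0_def Suc res_homsD(4))
    then show ?thesis using k by (simp add: Suc)
  qed
qed

lemma is_lift_add:
  assumes "is_lift q g G" "is_lift q h H"
  shows "is_lift q (g + h) (\<lambda>p. G p + H p)"
  using is_liftD[OF assms(1)] is_liftD[OF assms(2)]
  by (simp add: is_lift_def res_homs_closed plus_fun_apply aug_add diff_add)

lemma is_lift_minus:
  assumes "is_lift q g G" "is_lift q h H"
  shows "is_lift q (g - h) (\<lambda>p. G p - H p)"
  using is_liftD[OF assms(1)] is_liftD[OF assms(2)]
  by (simp add: is_lift_def res_homs_closed minus_apply aug_minus diff_minus)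

text \<open>Centrality makes a scalar multiple of a lift again a module homomorphism.\<close>

lemma scalar_central: "tens (scale c 1) 1 * t = t * tens (scale c 1) 1"
  by (induction t rule: env_induct) (simp_all add: tens_mult scale_comm distrib_left distrib_right)

lemma act_scalar: "act (tens (scale c 1) 1) z = scale c z"
  by (simp add: act_tens scale_one_mult[symmetric])

lemma is_lift_scale:
  assumes "is_lift q g G"
  shows "is_lift q (\<lambda>x. scale c (g x)) (\<lambda>p x. lmul (tens (scale c 1) 1) (G p x))"
proof -
  note GD = is_liftD[OF assms]
  have "(\<lambda>x. lmul (tens (scale c 1) 1) (G p x)) \<in> res_homs (p + q) p" for p
    unfolding res_homs_def
    by (auto simp: res_homsD[OF GD(1)] lmul_simps scalar_central)
  then show ?thesis
    using GD by (simp add: is_lift_def aug_lmul act_scalar diff_lmul)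
qed

text \<open>The source of associativity: the product is composition of chain maps followed by a
  cocycle.\<close>

lemma is_lift_comp:
  assumes G: "is_lift q g G" and H: "is_lift s h H"
  shows "is_lift (q + s) (g \<circ> H q) (\<lambda>p. G p \<circ> H (p + q))"
proof -
  note GD = is_liftD[OF G] and HD = is_liftD[OF H]
  have "G p \<circ> H (p + q) \<in> res_homs (p + (q + s)) p" for p
    using res_homs_comp[OF GD(1)[of p] HD(1)[of "p + q"]] by (simp add: add.assoc)
  moreover have "aug (G 0 (H q x)) = g (H q x)" if "x \<in> res (q + s)" for x
    using GD(2) HD(1)[of q] that by (auto simp: res_homsD)
  moreover have "diff (Suc p) (G (Suc p) (H (Suc (p + q)) x)) = G p (H (p + q) (diff (Suc (p + (q + s))) x))"
    if "x \<in> res (Suc (p + (q + s)))" for p x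
    using GD(3)[of "H (Suc (p + q)) x" p] HD(3)[of x "p + q"] HD(1)[of "Suc (p + q)"] that
    by (simp add: res_homsD(1) add.assoc)
  ultimately show ?thesis by (simp add: is_lift_def)
qed

lemma comp_lift_cocycle:
  assumes f: "f \<in> cocycles p" and G: "is_lift q g G"
  shows "f \<circ> G p \<in> cocycles (p + q)"
proof -
  note GD = is_liftD[OF G]
  have "f (G p (diff (Suc (p + q)) x)) = 0" if "x \<in> res (Suc (p + q))" for x
    using GD(3)[OF that] GD(1)[of "Suc p"] that f by (simp add: res_homsD(1) flip: GD(3))
  then show ?thesis
    using cochains_comp[OF cocycles_cochains[OF f] GD(1)[of p]] unfolding cocycles_def by simp
qed

text \<open>A chain map commutes with the differentials, so for \<open>b = k \<circ> d\<close> the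
  composite is \<open>k \<circ> G m\<close> followed by the differential.\<close>

lemma coboundary_comp_lift:
  assumes b: "b \<in> coboundaries p" and G: "is_lift q g G"
  shows "b \<circ> G p \<in> coboundaries (p + q)"
proof (cases p)
  case 0
  then have "b \<circ> G p = 0" using b by (auto simp: fun_eq_iff zero_fun_apply)
  then show ?thesis by simp
next
  case (Suc m)
  note GD = is_liftD[OF G]
  obtain k where k: "k \<in> cochains m" "b = extend0 (Suc m) (k \<circ> diff (Suc m))"
    using b unfolding Suc by (rule coboundariesE)
  have "b (G p x) = extend0 (Suc (m + q)) ((k \<circ> G m) \<circ> diff (Suc (m + q))) x" for x
    using GD(1)[of p] GD(3)[of x m] k(1) by (auto simp: k(2) extend0_def Suc res_homsD)
  then have "b \<circ> G p = extend0 (Suc (m + q)) ((k \<circ> G m) \<circ> diff (Suc (m + q)))"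
    by (simp add: fun_eq_iff)
  moreover have "k \<circ> G m \<in> cochains (m + q)"
    using k(1) GD(1) by (rule cochains_comp)
  ultimately show ?thesis by (simp add: Suc)
qed

text \<open>
  A coboundary \<open>k \<circ> d\<close> has the lift with components \<open>S \<circ> d\<close> in degree 0 and \<open>0\<close> in positive
  degrees, where \<open>S\<close> lifts \<open>k\<close> through the augmentation; any other lift differs from it by a lift of \<open>0\<close>.
\<close>

lemma comp_lift_coboundary:
  fixes f b :: "'k::field chain \<Rightarrow> 'k lam"
  assumes f: "f \<in> cocycles p" and G: "is_lift q b G" and b: "b \<in> coboundaries q"
  shows "f \<circ> G p \<in> coboundaries (p + q)"
proof (cases q)
  case 0
  then show ?thesis using comp_null_lift[OF f G] b by (simp add: zero_fun_apply)
next
  case (Suc m)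
  obtain k where k: "k \<in> cochains m" "b = extend0 (Suc m) (k \<circ> diff (Suc m))"
    using b unfolding Suc by (rule coboundariesE)
  obtain S where S: "S \<in> res_homs m 0" "\<And>x. x \<in> res m \<Longrightarrow> aug (S x) = k x"
    using lift_chain_exists[OF k(1)] by auto
  define H where "H p = (case p of 0 \<Rightarrow> extend0 q (S \<circ> diff q) | Suc _ \<Rightarrow> 0)" for p :: nat
  have S0: "S 0 = 0" using S(1) by simp
  have "H p \<in> res_homs (p + q) p" for p
    using res_homs_comp_diff[OF S(1)] by (cases p) (simp_all add: H_def Suc res_homs_closed)
  then have H: "is_lift q b H"
    unfolding is_lift_def by (auto simp: H_def extend0_def k(2) S Suc S0 diff_diff zero_fun_apply split: nat.splits)
  have "f \<circ> H p \<in> coboundaries (p + q)"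
  proof (cases p)
    case 0
    have "f (H p x) = extend0 (Suc m) ((f \<circ> S) \<circ> diff (Suc m)) x" for x
      using cochains_zero[OF cocycles_cochains[OF f]] by (simp add: H_def 0 Suc extend0_def zero_fun_apply)
    then have "f \<circ> H p = extend0 (Suc m) ((f \<circ> S) \<circ> diff (Suc m))"
      by (simp add: fun_eq_iff)
    moreover have "f \<circ> S \<in> cochains m"
      using cochains_comp[OF cocycles_cochains[OF f] S(1)[folded 0]] .
    ultimately show ?thesis by (simp add: 0 Suc)
  next
    case (Suc k)
    then have "f \<circ> H p = 0" using f by (auto simp: H_def fun_eq_iff zero_fun_apply)
    then show ?thesis by simp
  qed
  moreover have "f \<circ> (G p - H p) \<in> coboundaries (p + q)"
    by (rule comp_null_lift[OF f is_lift_minus[OF G H]]) (simp add: minus_apply zero_fun_apply)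
  moreover have "f \<circ> G p = (f \<circ> (G p - H p)) + (f \<circ> H p)"
  proof
    fix x
    have "f (G p x - H p x) = f (G p x) - f (H p x)"
    proof (cases "x \<in> res (p + q)")
      case True
      then show ?thesis
        using f is_liftD(1)[OF G, of p] is_liftD(1)[OF H, of p] by (intro cochains_minus) (auto intro: res_homsD(1))
    next
      case False
      then show ?thesis
        using f is_liftD(1)[OF G, of p] is_liftD(1)[OF H, of p] by (simp add: res_homsD(4))
    qed
    then show "(f \<circ> G p) x = ((f \<circ> (G p - H p)) + (f \<circ> H p)) x"
      by (simp add: plus_fun_apply minus_apply)
  qed
  ultimately show ?thesis by simp
qed


section \<open>The Yoneda product on cocycles\<close>

lemma hom_comp_lift_minus:
  assumes f: "f \<in> cocycles p" and G: "is_lift q g G" "is_lift q h H"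
  shows "(f \<circ> G p) - (f \<circ> H p) = f \<circ> (G p - H p)"
proof
  fix x
  have "f (G p x - H p x) = f (G p x) - f (H p x)"
  proof (cases "x \<in> res (p + q)")
    case True
    then show ?thesis
      using f res_homsD(1)[OF is_liftD(1)[OF G(1)]] res_homsD(1)[OF is_liftD(1)[OF G(2)]]
      by (intro cochains_minus[of f p]) auto
  next
    case False
    then show ?thesis
      using f is_liftD(1)[OF G(1), of p] is_liftD(1)[OF G(2), of p] by (simp add: res_homsD(4))
  qed
  then show "((f \<circ> G p) - (f \<circ> H p)) x = (f \<circ> (G p - H p)) x"
    by (simp add: minus_apply)
qed

text \<open>The difference splits as \<open>(f - f') \<circ> G p\<close> plus
  \<open>f' \<circ> (G p - G' p)\<close>; in the second term a lift of the coboundary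
  \<open>g - g'\<close> appears.\<close>

lemma comp_lift_cong:
  assumes f: "f \<in> cocycles p" "f' \<in> cocycles p" "f - f' \<in> coboundaries p"
    and G: "is_lift q g G" "is_lift q g' G'" "g - g' \<in> coboundaries q"
  shows "(f \<circ> G p) - (f' \<circ> G' p) \<in> coboundaries (p + q)"
proof -
  have "f' \<circ> (G p - G' p) \<in> coboundaries (p + q)"
    using comp_lift_coboundary[OF f(2) is_lift_minus[OF G(1,2)] G(3)] .
  moreover have "(f - f') \<circ> G p \<in> coboundaries (p + q)"
    by (rule coboundary_comp_lift[OF f(3) G(1)])
  moreover have "(f \<circ> G p) - (f' \<circ> G' p) = ((f - f') \<circ> G p) + (f' \<circ> (G p - G' p))"
    unfolding hom_comp_lift_minus[OF f(2) G(1,2), symmetric]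
    by (simp add: fun_eq_iff plus_fun_apply minus_apply)
  ultimately show ?thesis by simp
qed

lemma coho_class_iff: "h \<in> coho_class n f \<longleftrightarrow> h - f \<in> coboundaries n"
proof
  assume "h - f \<in> coboundaries n"
  then show "h \<in> coho_class n f"
    unfolding coho_class_def by (rule image_eqI[rotated]) simp
qed (auto simp: coho_class_def)

lemma coho_class_eq_iff: "coho_class n f = coho_class n g \<longleftrightarrow> f - g \<in> coboundaries n"
proof
  assume "coho_class n f = coho_class n g"
  moreover have "f \<in> coho_class n f" by (simp add: coho_class_iff)
  ultimately show "f - g \<in> coboundaries n" by (simp add: coho_class_iff)
next
  assume *: "f - g \<in> coboundaries n"
  have "h - f \<in> coboundaries n \<longleftrightarrow> h - g \<in> coboundaries n" for h
    using coboundaries_closed(2)[OF _ *, of "h - f"] coboundaries_closed(3)[OF _ *, of "h - g"] by auto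
  then show "coho_class n f = coho_class n g" by (auto simp: coho_class_iff)
qed

lemma coho_class_zero: "coho_class n 0 = coboundaries n"
  by (auto simp: coho_class_iff)

lemma coho_class_eq_coboundaries: "coho_class n f = coboundaries n \<longleftrightarrow> f \<in> coboundaries n"
  using coho_class_eq_iff[of n f 0] by (simp add: coho_class_zero)

text \<open>The given lift makes the union non-empty, and \<open>comp_lift_cong\<close> makes all
  its members cohomologous.\<close>

lemma yoneda_coho_class:
  assumes f: "f \<in> cocycles p" and g: "g \<in> cocycles q" and G: "is_lift q g G"
  shows "yoneda p q (coho_class p f) (coho_class q g) = coho_class (p + q) (f \<circ> G p)"
proof (intro equalityI subsetI)
  fix h assume "h \<in> yoneda p q (coho_class p f) (coho_class q g)"
  then obtain f' g' G' where *: "f' - f \<in> coboundaries p" "g' - g \<in> coboundaries q" "is_lift q g' G'"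
    and h: "h \<in> coho_class (p + q) (extend0 (p + q) (f' \<circ> G' p))"
    by (auto simp: yoneda_def coho_class_iff)
  have f': "f' \<in> cocycles p"
    using cocycles_closed(1)[OF f coboundaries_cocycles[OF *(1)]] by simp
  have "extend0 (p + q) (f' \<circ> G' p) = f' \<circ> G' p"
    by (rule extend0_cochain) (use comp_lift_cocycle[OF f' *(3)] in simp)
  moreover have "(f' \<circ> G' p) - (f \<circ> G p) \<in> coboundaries (p + q)"
    by (rule comp_lift_cong[OF f' f *(1) *(3) G *(2)])
  ultimately show "h \<in> coho_class (p + q) (f \<circ> G p)"
    using h coho_class_eq_iff by metis
next
  fix h assume h: "h \<in> coho_class (p + q) (f \<circ> G p)"
  have "extend0 (p + q) (f \<circ> G p) = f \<circ> G p"
    by (rule extend0_cochain) (use comp_lift_cocycle[OF f G] in simp)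
  moreover have "f \<in> coho_class p f" "g \<in> coho_class q g" by (simp_all add: coho_class_iff)
  ultimately show "h \<in> yoneda p q (coho_class p f) (coho_class q g)"
    using G h unfolding yoneda_def by (intro CollectI bexI[of _ f] bexI[of _ g] exI[of _ G]) simp_all
qed

text \<open>A product of cocycles with a chosen lift of the second factor. It is strictly additive
  in \<open>f\<close>, but additive in \<open>g\<close> only up to coboundaries, because the chosen
  lift of a sum need not be the sum of the chosen lifts.\<close>

definition lift_prod :: "nat \<Rightarrow> nat \<Rightarrow> ('k::field chain \<Rightarrow> 'k lam) \<Rightarrow> ('k chain \<Rightarrow> 'k lam) \<Rightarrow> 'k chain \<Rightarrow> 'k lam" where
  "lift_prod p q f g = f \<circ> (SOME G. is_lift q g G) p"

lemma some_lift: "g \<in> cocycles q \<Longrightarrow> is_lift q g (SOME G. is_lift q g G)"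
  using lift_exists by (rule someI_ex)

lemma lift_prod_cocycle: "f \<in> cocycles p \<Longrightarrow> g \<in> cocycles q \<Longrightarrow> lift_prod p q f g \<in> cocycles (p + q)"
  unfolding lift_prod_def by (rule comp_lift_cocycle[OF _ some_lift])

lemma lift_prod_eqI:
  assumes "f \<in> cocycles p" "g \<in> cocycles q" "is_lift q g G"
  shows "lift_prod p q f g - (f \<circ> G p) \<in> coboundaries (p + q)"
  unfolding lift_prod_def
  by (rule comp_lift_cong[OF assms(1,1) _ some_lift[OF assms(2)] assms(3)]) simp_all

lemma lift_prod_add_left: "lift_prod p q (f + f') g = lift_prod p q f g + lift_prod p q f' g"
  by (simp add: lift_prod_def fun_eq_iff plus_fun_apply)

lemma lift_prod_zero_left [simp]: "lift_prod p q 0 g = 0"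
  by (simp add: lift_prod_def fun_eq_iff zero_fun_apply)

lemma lift_prod_sum_left: "lift_prod p q (sum f A) g = (\<Sum>a\<in>A. lift_prod p q (f a) g)"
  by (simp add: lift_prod_def fun_eq_iff sum_fun_apply)

lemma lift_prod_add_right:
  assumes "f \<in> cocycles p" "g \<in> cocycles q" "g' \<in> cocycles q"
  shows "lift_prod p q f (g + g') - (lift_prod p q f g + lift_prod p q f g') \<in> coboundaries (p + q)"
proof -
  let ?L = "\<lambda>g. SOME G. is_lift q g G"
  have l: "is_lift q (g + g') (\<lambda>p. ?L g p + ?L g' p)"
    by (intro is_lift_add some_lift assms)
  have "f (?L g p x + ?L g' p x) = f (?L g p x) + f (?L g' p x)" for x
  proof (cases "x \<in> res (p + q)")
    case True
    then show ?thesis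
      using assms(1) res_homsD(1)[OF is_liftD(1)[OF some_lift[OF assms(2)]]]
        res_homsD(1)[OF is_liftD(1)[OF some_lift[OF assms(3)]]]
      by (intro cochainsD(1)[of f p]) auto
  next
    case False
    then show ?thesis
      using assms(1) res_homsD(4)[OF is_liftD(1)[OF some_lift[OF assms(2)]]]
        res_homsD(4)[OF is_liftD(1)[OF some_lift[OF assms(3)]]]
      by simp
  qed
  then have "f \<circ> (?L g p + ?L g' p) = lift_prod p q f g + lift_prod p q f g'"
    by (simp add: fun_eq_iff lift_prod_def plus_fun_apply)
  then show ?thesis
    using lift_prod_eqI[OF assms(1) cocycles_closed(1)[OF assms(2,3)] l] by simp
qed

lemma lift_prod_coboundary:
  assumes "f \<in> cocycles p" "g \<in> cocycles q" "f \<in> coboundaries p \<or> g \<in> coboundaries q"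
  shows "lift_prod p q f g \<in> coboundaries (p + q)"
  using assms(3)
proof
  assume "f \<in> coboundaries p"
  then show ?thesis
    unfolding lift_prod_def by (rule coboundary_comp_lift[OF _ some_lift[OF assms(2)]])
next
  assume "g \<in> coboundaries q"
  then show ?thesis
    unfolding lift_prod_def by (rule comp_lift_coboundary[OF assms(1) some_lift[OF assms(2)]])
qed

lemma coboundaries_trans:
  "f - g \<in> coboundaries n \<Longrightarrow> g - h \<in> coboundaries n \<Longrightarrow> f - h \<in> coboundaries n"
  using coboundaries_closed(2)[of "f - g" n "g - h"] by simp

lemma sum_coboundaries: "(\<And>a. a \<in> A \<Longrightarrow> f a \<in> coboundaries n) \<Longrightarrow> sum f A \<in> coboundaries n"
  by (induction A rule: infinite_finite_induct) simp_all

lemma sum_cocycles: "(\<And>a. a \<in> A \<Longrightarrow> f a \<in> cocycles n) \<Longrightarrow> sum f A \<in> cocycles n"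
  by (induction A rule: infinite_finite_induct) simp_all

lemma sum_coboundaries_cong:
  "(\<And>a. a \<in> A \<Longrightarrow> f a - g a \<in> coboundaries n) \<Longrightarrow> sum f A - sum g A \<in> coboundaries n"
  unfolding sum_subtractf[symmetric] by (rule sum_coboundaries)

lemma lift_prod_sum_right:
  assumes f: "f \<in> cocycles p" and g: "\<And>a. a \<in> A \<Longrightarrow> g a \<in> cocycles q"
  shows "lift_prod p q f (sum g A) - (\<Sum>a\<in>A. lift_prod p q f (g a)) \<in> coboundaries (p + q)"
  using g
proof (induction A rule: infinite_finite_induct)
  case (infinite A)
  then show ?case using lift_prod_coboundary[OF f, of 0 q] by simp
next
  case empty
  then show ?case using lift_prod_coboundary[OF f, of 0 q] by simp
next
  case (insert a A)
  have "lift_prod p q f (g a + sum g A) - (lift_prod p q f (g a) + lift_prod p q f (sum g A)) \<in> coboundaries (p + q)"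
    using insert.prems by (intro lift_prod_add_right f sum_cocycles) auto
  moreover have "lift_prod p q f (sum g A) - (\<Sum>a\<in>A. lift_prod p q f (g a)) \<in> coboundaries (p + q)"
    using insert by auto
  ultimately show ?case
    using insert.hyps
      coboundaries_trans[of _ "lift_prod p q f (g a) + lift_prod p q f (sum g A)" _
        "lift_prod p q f (g a) + (\<Sum>a\<in>A. lift_prod p q f (g a))"]
    by simp
qed

text \<open>The composite of the chosen lifts of \<open>g\<close> and \<open>h\<close> is a lift of
  their product, though perhaps not the chosen one; this accounts for the coboundary.\<close>

lemma lift_prod_assoc:
  assumes f: "f \<in> cocycles p" and g: "g \<in> cocycles q" and h: "h \<in> cocycles s"
  shows "lift_prod (p + q) s (lift_prod p q f g) h - lift_prod p (q + s) f (lift_prod q s g h)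
    \<in> coboundaries (p + q + s)"
proof -
  let ?G = "SOME G. is_lift q g G" and ?H = "SOME H. is_lift s h H"
  have "is_lift (q + s) (lift_prod q s g h) (\<lambda>p. ?G p \<circ> ?H (p + q))"
    using is_lift_comp[OF some_lift[OF g] some_lift[OF h]] by (simp add: lift_prod_def)
  from lift_prod_eqI[OF f lift_prod_cocycle[OF g h] this]
  have "lift_prod p (q + s) f (lift_prod q s g h) - lift_prod (p + q) s (lift_prod p q f g) h
      \<in> coboundaries (p + q + s)"
    by (simp add: lift_prod_def comp_assoc add.assoc)
  from coboundaries_closed(4)[OF this] show ?thesis by simp
qed

lemma lift_prod_scale_right:
  assumes f: "f \<in> cocycles p" and g: "g \<in> cocycles q"
  shows "lift_prod p q f (\<lambda>x. scale c (g x)) - (\<lambda>x. scale c (lift_prod p q f g x)) \<in> coboundaries (p + q)"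
proof -
  let ?G = "SOME G. is_lift q g G"
  have "f (lmul (tens (scale c 1) 1) (?G p x)) = scale c (f (?G p x))" for x
  proof (cases "x \<in> res (p + q)")
    case True
    then show ?thesis
      using cochainsD(2)[OF cocycles_cochains[OF f] res_homsD(1)[OF is_liftD(1)[OF some_lift[OF g]]]]
      by (simp add: act_scalar)
  next
    case False
    then show ?thesis
      using f res_homsD(4)[OF is_liftD(1)[OF some_lift[OF g]]] by (simp add: scale_zero_right)
  qed
  then have "f \<circ> (\<lambda>x. lmul (tens (scale c 1) 1) (?G p x)) = (\<lambda>x. scale c (lift_prod p q f g x))"
    by (simp add: fun_eq_iff lift_prod_def)
  then show ?thesis
    using lift_prod_eqI[OF f cocycles_closed(5)[OF g] is_lift_scale[OF some_lift[OF g], of c]] by simp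
qed

lemma aug_cocycle: "extend0 0 aug \<in> cocycles 0"
  unfolding cocycles_def cochains_def by (auto simp: extend0_def aug_add aug_lmul aug_diff)

lemma lift_prod_one_left:
  assumes "g \<in> cocycles q"
  shows "lift_prod 0 q (extend0 0 aug) g = g"
proof
  fix x
  note L = is_liftD[OF some_lift[OF assms]]
  show "lift_prod 0 q (extend0 0 aug) g x = g x"
  proof (cases "x \<in> res q")
    case True
    then show ?thesis
      using L(2) res_homsD(1)[OF L(1), of x 0] by (simp add: lift_prod_def extend0_def)
  next
    case False
    then show ?thesis
      using res_homsD(4)[OF L(1), of x 0] cochainsD(3)[OF cocycles_cochains[OF assms]]
      by (simp add: lift_prod_def extend0_def)
  qed
qed

text \<open>The identity chain map is a lift of the augmentation.\<close>

lemma lift_prod_one_right: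
  assumes "f \<in> cocycles p"
  shows "lift_prod p 0 f (extend0 0 aug) - f \<in> coboundaries p"
proof -
  have "is_lift 0 (extend0 0 aug) (\<lambda>p. extend0 p id)"
    by (auto simp: is_lift_def res_homs_def extend0_def)
  from lift_prod_eqI[OF assms aug_cocycle this]
  have "lift_prod p 0 f (extend0 0 aug) - (f \<circ> extend0 p id) \<in> coboundaries p" by simp
  moreover have "f \<circ> extend0 p id = f"
    using assms by (auto simp: fun_eq_iff extend0_def cochainsD(3)[of f p])
  ultimately show ?thesis by simp
qed

section \<open>Families of cocycles representing the elements of the direct sum\<close>

definition total_cocycles :: "(nat \<Rightarrow> 'k::field chain \<Rightarrow> 'k lam) set" where
  "total_cocycles = {F. (\<forall>n. F n \<in> cocycles n) \<and> finite {n. F n \<notin> coboundaries n}}"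

definition total_class :: "(nat \<Rightarrow> 'k::field chain \<Rightarrow> 'k lam) \<Rightarrow> nat \<Rightarrow> ('k chain \<Rightarrow> 'k lam) set" where
  "total_class F = (\<lambda>n. coho_class n (F n))"

definition total_prod :: "(nat \<Rightarrow> 'k::field chain \<Rightarrow> 'k lam) \<Rightarrow> (nat \<Rightarrow> 'k chain \<Rightarrow> 'k lam) \<Rightarrow> nat \<Rightarrow> 'k chain \<Rightarrow> 'k lam" where
  "total_prod F G n = (\<Sum>p\<le>n. lift_prod p (n - p) (F p) (G (n - p)))"

lemma total_class_eq_iff: "total_class F = total_class G \<longleftrightarrow> (\<forall>n. F n - G n \<in> coboundaries n)"
  by (simp add: total_class_def fun_eq_iff coho_class_eq_iff)

lemma total_cocyclesD: "F \<in> total_cocycles \<Longrightarrow> F n \<in> cocycles n"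
  by (simp add: total_cocycles_def)

lemma HH_carrier: "carrier HH_algebra = total_class ` (total_cocycles :: (nat \<Rightarrow> 'k::field chain \<Rightarrow> 'k lam) set)"
proof (intro equalityI subsetI)
  fix z :: "nat \<Rightarrow> ('k chain \<Rightarrow> 'k lam) set"
  assume z: "z \<in> carrier HH_algebra"
  then have "\<forall>n. \<exists>f. f \<in> cocycles n \<and> z n = coho_class n f"
    by (auto simp: HH_algebra_def HH_def)
  then obtain F where F: "\<And>n. F n \<in> cocycles n" "\<And>n. z n = coho_class n (F n)" by metis
  have "F \<in> total_cocycles"
    using z by (simp add: total_cocycles_def HH_algebra_def F coho_class_eq_coboundaries)
  moreover have "z = total_class F" by (simp add: total_class_def fun_eq_iff F)
  ultimately show "z \<in> total_class ` total_cocycles" by blast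
qed (auto simp: HH_algebra_def HH_def total_class_def total_cocycles_def coho_class_eq_coboundaries)

lemma HH_add:
  fixes F G :: "nat \<Rightarrow> 'k::field chain \<Rightarrow> 'k lam"
  shows "total_class F \<oplus>\<^bsub>HH_algebra\<^esub> total_class G = total_class (\<lambda>n. F n + G n)"
proof -
  have "{f + g | f g. f \<in> coho_class n (F n) \<and> g \<in> coho_class n (G n)} = coho_class n (F n + G n)" for n
  proof (intro equalityI subsetI)
    fix h assume "h \<in> coho_class n (F n + G n)"
    then have "h - G n \<in> coho_class n (F n)" "h = (h - G n) + G n" "G n \<in> coho_class n (G n)"
      by (simp_all add: coho_class_iff algebra_simps)
    then show "h \<in> {f + g | f g. f \<in> coho_class n (F n) \<and> g \<in> coho_class n (G n)}" by blast
  next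
    fix h assume "h \<in> {f + g | f g. f \<in> coho_class n (F n) \<and> g \<in> coho_class n (G n)}"
    then obtain f g where "h = f + g" "f - F n \<in> coboundaries n" "g - G n \<in> coboundaries n"
      by (auto simp: coho_class_iff)
    then show "h \<in> coho_class n (F n + G n)"
      using coboundaries_closed(2)[of "f - F n" n "g - G n"] by (simp add: coho_class_iff add_diff_add)
  qed
  then show ?thesis by (simp add: HH_algebra_def total_class_def fun_eq_iff)
qed

lemma scale_minus: "scale c (x - y) = scale c x - scale c y"
  by (rule lam_eqI) (simp_all add: algebra_simps)

lemma HH_smult:
  fixes F :: "nat \<Rightarrow> 'k::field chain \<Rightarrow> 'k lam"
  shows "c \<odot>\<^bsub>HH_algebra\<^esub> total_class F = total_class (\<lambda>n x. scale c (F n x))"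
proof -
  have "{(\<lambda>x. scale c (f x)) + b | f b. f \<in> coho_class n (F n) \<and> b \<in> coboundaries n}
      = coho_class n (\<lambda>x. scale c (F n x))" for n
  proof (intro equalityI subsetI)
    fix h assume "h \<in> coho_class n (\<lambda>x. scale c (F n x))"
    then have "h - (\<lambda>x. scale c (F n x)) \<in> coboundaries n" "F n \<in> coho_class n (F n)"
      by (simp_all add: coho_class_iff)
    moreover have "h = (\<lambda>x. scale c (F n x)) + (h - (\<lambda>x. scale c (F n x)))" by simp
    ultimately show "h \<in> {(\<lambda>x. scale c (f x)) + b | f b. f \<in> coho_class n (F n) \<and> b \<in> coboundaries n}"
      by blast
  next
    fix h assume "h \<in> {(\<lambda>x. scale c (f x)) + b | f b. f \<in> coho_class n (F n) \<and> b \<in> coboundaries n}"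
    then obtain f b where h: "h = (\<lambda>x. scale c (f x)) + b" "f - F n \<in> coboundaries n" "b \<in> coboundaries n"
      by (auto simp: coho_class_iff)
    have "h - (\<lambda>x. scale c (F n x)) = (\<lambda>x. scale c ((f - F n) x)) + b"
      by (simp add: h(1) fun_eq_iff plus_fun_apply minus_apply scale_minus)
    moreover have "\<dots> \<in> coboundaries n"
      using h coboundaries_closed(5)[of "f - F n" n c] by (intro coboundaries_closed(2))
    ultimately show "h \<in> coho_class n (\<lambda>x. scale c (F n x))" by (simp add: coho_class_iff)
  qed
  then show ?thesis by (simp add: HH_algebra_def total_class_def fun_eq_iff)
qed

lemma HH_zero: "\<zero>\<^bsub>HH_algebra\<^esub> = total_class (\<lambda>n. 0)"
  by (simp add: HH_algebra_def total_class_def coho_class_zero)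

lemma homog_total_class: "homog n f = total_class (\<lambda>m. if m = n then f else 0)"
  by (auto simp: homog_def total_class_def fun_eq_iff coho_class_zero)

lemma HH_one: "\<one>\<^bsub>HH_algebra\<^esub> = total_class (\<lambda>n. if n = 0 then extend0 0 aug else 0)"
  by (simp add: HH_algebra_def homog_total_class)

lemma HH_mult:
  fixes F G :: "nat \<Rightarrow> 'k::field chain \<Rightarrow> 'k lam"
  assumes F: "\<And>n. F n \<in> cocycles n" and G: "\<And>n. G n \<in> cocycles n"
  shows "total_class F \<otimes>\<^bsub>HH_algebra\<^esub> total_class G = total_class (total_prod F G)"
proof -
  have y: "yoneda p (n - p) (coho_class p (F p)) (coho_class (n - p) (G (n - p)))
      = coho_class n (lift_prod p (n - p) (F p) (G (n - p)))" if "p \<le> n" for n p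
    using yoneda_coho_class[OF F[of p] G[of "n - p"] some_lift[OF G]] that by (simp add: lift_prod_def)
  have "{\<Sum>p\<le>n. h p | h. \<forall>p\<le>n. h p \<in> yoneda p (n - p) (total_class F p) (total_class G (n - p))}
      = coho_class n (total_prod F G n)" for n
  proof (intro equalityI subsetI)
    fix k assume "k \<in> {\<Sum>p\<le>n. h p | h. \<forall>p\<le>n. h p \<in> yoneda p (n - p) (total_class F p) (total_class G (n - p))}"
    then obtain h where "k = (\<Sum>p\<le>n. h p)"
      "\<And>p. p \<le> n \<Longrightarrow> h p - lift_prod p (n - p) (F p) (G (n - p)) \<in> coboundaries n"
      by (auto simp: total_class_def y coho_class_iff)
    then show "k \<in> coho_class n (total_prod F G n)"
      by (auto simp: coho_class_iff total_prod_def intro!: sum_coboundaries_cong)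
  next
    fix k assume k: "k \<in> coho_class n (total_prod F G n)"
    let ?l = "\<lambda>p. lift_prod p (n - p) (F p) (G (n - p))"
    \<comment> \<open>The whole discrepancy is put into the summand \<open>p = 0\<close>, which
      exists for every \<open>n\<close>.\<close>
    let ?h = "\<lambda>p. ?l p + (if p = 0 then k - total_prod F G n else 0)"
    have "k = (\<Sum>p\<le>n. ?h p)"
      unfolding sum.distrib by (simp add: total_prod_def[symmetric])
    moreover have "?h p \<in> yoneda p (n - p) (total_class F p) (total_class G (n - p))" if "p \<le> n" for p
      using k that by (simp add: total_class_def y coho_class_iff)
    ultimately show "k \<in> {\<Sum>p\<le>n. h p | h. \<forall>p\<le>n. h p \<in> yoneda p (n - p) (total_class F p) (total_class G (n - p))}"
      by (intro CollectI exI[of _ ?h]) simp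
  qed
  then show ?thesis by (simp add: HH_algebra_def total_class_def[of "total_prod F G"] fun_eq_iff)
qed

lemma lift_prod_cocycle_le:
  "p \<le> n \<Longrightarrow> f \<in> cocycles p \<Longrightarrow> g \<in> cocycles (n - p) \<Longrightarrow> lift_prod p (n - p) f g \<in> cocycles n"
  using lift_prod_cocycle[of f p g "n - p"] by simp

lemma total_prod_cocycle:
  assumes "\<And>n. F n \<in> cocycles n" "\<And>n. G n \<in> cocycles n"
  shows "total_prod F G n \<in> cocycles n"
  unfolding total_prod_def by (intro sum_cocycles lift_prod_cocycle_le assms) simp

text \<open>A degree in which the product is not a coboundary is a sum of two such degrees of the
  factors, of which there are finitely many.\<close>

lemma total_prod_closed:
  assumes F: "F \<in> total_cocycles" and G: "G \<in> total_cocycles"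
  shows "total_prod F G \<in> total_cocycles"
proof -
  let ?A = "{n. F n \<notin> coboundaries n}" and ?B = "{n. G n \<notin> coboundaries n}"
  note c = total_cocyclesD[OF F] total_cocyclesD[OF G]
  have "{n. total_prod F G n \<notin> coboundaries n} \<subseteq> (\<lambda>(a, b). a + b) ` (?A \<times> ?B)"
  proof
    fix n assume n: "n \<in> {n. total_prod F G n \<notin> coboundaries n}"
    have "\<exists>p\<le>n. F p \<notin> coboundaries p \<and> G (n - p) \<notin> coboundaries (n - p)"
    proof (rule ccontr)
      assume *: "\<not> ?thesis"
      have "lift_prod p (n - p) (F p) (G (n - p)) \<in> coboundaries n" if "p \<le> n" for p
        using lift_prod_coboundary[OF c, of p "n - p"] * that by auto
      then have "total_prod F G n \<in> coboundaries n"
        unfolding total_prod_def by (intro sum_coboundaries) simp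
      then show False using n by simp
    qed
    then obtain p where "p \<le> n" "p \<in> ?A" "n - p \<in> ?B" by auto
    then show "n \<in> (\<lambda>(a, b). a + b) ` (?A \<times> ?B)"
      by (intro image_eqI[of _ _ "(p, n - p)"]) auto
  qed
  moreover have "finite ((\<lambda>(a, b). a + b) ` (?A \<times> ?B))"
    using F G by (auto simp: total_cocycles_def)
  ultimately have "finite {n. total_prod F G n \<notin> coboundaries n}" by (rule finite_subset)
  then show ?thesis using total_prod_cocycle[of F G] c by (simp add: total_cocycles_def)
qed

lemma total_cocycles_closed:
  assumes "F \<in> total_cocycles" "G \<in> total_cocycles"
  shows "(\<lambda>n. F n + G n) \<in> total_cocycles" "(\<lambda>n x. scale c (F n x)) \<in> total_cocycles"
    "(\<lambda>n. - F n) \<in> total_cocycles"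
proof -
  let ?A = "{n. F n \<notin> coboundaries n}" and ?B = "{n. G n \<notin> coboundaries n}"
  have fin: "finite (?A \<union> ?B)" "finite ?A" using assms by (auto simp: total_cocycles_def)
  have "finite {n. F n + G n \<notin> coboundaries n}"
    by (rule finite_subset[OF _ fin(1)]) auto
  then show "(\<lambda>n. F n + G n) \<in> total_cocycles" using assms by (simp add: total_cocycles_def)
  have "finite {n. (\<lambda>x. scale c (F n x)) \<notin> coboundaries n}"
    by (rule finite_subset[OF _ fin(2)]) auto
  then show "(\<lambda>n x. scale c (F n x)) \<in> total_cocycles" using assms by (simp add: total_cocycles_def)
  have "finite {n. - F n \<notin> coboundaries n}"
    by (rule finite_subset[OF _ fin(2)]) auto
  then show "(\<lambda>n. - F n) \<in> total_cocycles" using assms by (simp add: total_cocycles_def)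
qed

lemma homog_total_cocycle: "f \<in> cocycles n \<Longrightarrow> (\<lambda>m. if m = n then f else 0) \<in> total_cocycles"
proof -
  assume f: "f \<in> cocycles n"
  have "finite {m. (if m = n then f else 0) \<notin> coboundaries m}"
    by (rule finite_subset[of _ "{n}"]) auto
  then show ?thesis using f by (simp add: total_cocycles_def)
qed

text \<open>Both bracketings become sums over \<open>p + q \<le> n\<close>. The left one expands
  exactly, by strict additivity in the first factor; the right one only modulo coboundaries.\<close>

lemma total_prod_assoc:
  fixes F G H :: "nat \<Rightarrow> 'k::field chain \<Rightarrow> 'k lam"
  assumes F: "\<And>n. F n \<in> cocycles n" and G: "\<And>n. G n \<in> cocycles n" and H: "\<And>n. H n \<in> cocycles n"
  shows "total_prod (total_prod F G) H n - total_prod F (total_prod G H) n \<in> coboundaries n"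
proof -
  let ?T = "\<lambda>p q. lift_prod (p + q) (n - (p + q)) (lift_prod p q (F p) (G q)) (H (n - (p + q)))"
  let ?U = "\<lambda>p q. lift_prod p (n - p) (F p) (lift_prod q (n - p - q) (G q) (H (n - p - q)))"
  have "total_prod (total_prod F G) H n = (\<Sum>k\<le>n. \<Sum>p\<le>k. ?T p (k - p))"
    unfolding total_prod_def[of "total_prod F G"] unfolding total_prod_def[of F] lift_prod_sum_left
    by (intro sum.cong refl) simp
  also have "\<dots> = (\<Sum>(p, q) \<in> {(p, q). p + q \<le> n}. ?T p q)"
    by (rule sum.triangle_reindex_eq[symmetric])
  also have "{(p, q). p + q \<le> n} = Sigma {..n} (\<lambda>p. {..n - p})"
    by auto
  also have "(\<Sum>(p, q) \<in> Sigma {..n} (\<lambda>p. {..n - p}). ?T p q) = (\<Sum>p\<le>n. \<Sum>q\<le>n - p. ?T p q)"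
    by (rule sum.Sigma[symmetric]) simp_all
  finally have 1: "total_prod (total_prod F G) H n = (\<Sum>p\<le>n. \<Sum>q\<le>n - p. ?T p q)" .
  have "(\<Sum>p\<le>n. \<Sum>q\<le>n - p. ?T p q) - (\<Sum>p\<le>n. \<Sum>q\<le>n - p. ?U p q) \<in> coboundaries n"
  proof (intro sum_coboundaries_cong)
    fix p q assume "p \<in> {..n}" "q \<in> {..n - p}"
    then show "?T p q - ?U p q \<in> coboundaries n"
      using lift_prod_assoc[OF F[of p] G[of q] H[of "n - (p + q)"]] by simp
  qed
  moreover have "(\<Sum>p\<le>n. \<Sum>q\<le>n - p. ?U p q) - total_prod F (total_prod G H) n \<in> coboundaries n"
    unfolding total_prod_def[of F]
  proof (rule sum_coboundaries_cong)
    fix p assume p: "p \<in> {..n}"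
    have "lift_prod p (n - p) (F p) (total_prod G H (n - p)) - (\<Sum>q\<le>n - p. ?U p q) \<in> coboundaries (p + (n - p))"
      unfolding total_prod_def by (intro lift_prod_sum_right F lift_prod_cocycle_le G H) simp
    from coboundaries_closed(4)[OF this] show "(\<Sum>q\<le>n - p. ?U p q)
        - lift_prod p (n - p) (F p) (total_prod G H (n - p)) \<in> coboundaries n"
      using p by simp
  qed
  ultimately show ?thesis unfolding 1 by (rule coboundaries_trans)
qed

lemma total_prod_one:
  fixes F :: "nat \<Rightarrow> 'k::field chain \<Rightarrow> 'k lam"
  defines "E \<equiv> \<lambda>n. if n = (0::nat) then extend0 0 aug else (0 :: 'k chain \<Rightarrow> 'k lam)"
  assumes F: "\<And>n. F n \<in> cocycles n"
  shows "total_prod E F n - F n \<in> coboundaries n" "total_prod F E n - F n \<in> coboundaries n"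
proof -
  have "total_prod E F n = (\<Sum>p\<le>n. if p = 0 then F n else 0)"
    unfolding total_prod_def by (intro sum.cong refl) (auto simp: E_def lift_prod_one_left F)
  then show "total_prod E F n - F n \<in> coboundaries n" by simp
  have "total_prod F E n - (\<Sum>p\<le>n. if p = n then F n else 0) \<in> coboundaries n"
    unfolding total_prod_def
  proof (rule sum_coboundaries_cong)
    fix p assume p: "p \<in> {..n}"
    show "lift_prod p (n - p) (F p) (E (n - p)) - (if p = n then F n else 0) \<in> coboundaries n"
    proof (cases "p = n")
      case True
      then show ?thesis using lift_prod_one_right[OF F] by (simp add: E_def)
    next
      case False
      then show ?thesis
        using p lift_prod_coboundary[OF F[of p], of 0 "n - p"] by (simp add: E_def)
    qed
  qed
  then show "total_prod F E n - F n \<in> coboundaries n" by simp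
qed

lemma total_prod_add:
  fixes F G H :: "nat \<Rightarrow> 'k::field chain \<Rightarrow> 'k lam"
  assumes F: "\<And>n. F n \<in> cocycles n" and G: "\<And>n. G n \<in> cocycles n" and H: "\<And>n. H n \<in> cocycles n"
  shows "total_prod (\<lambda>n. F n + G n) H n = total_prod F H n + total_prod G H n"
    "total_prod H (\<lambda>n. F n + G n) n - (total_prod H F n + total_prod H G n) \<in> coboundaries n"
proof -
  show "total_prod (\<lambda>n. F n + G n) H n = total_prod F H n + total_prod G H n"
    by (simp add: total_prod_def lift_prod_add_left sum.distrib)
  have "lift_prod p (n - p) (H p) (F (n - p) + G (n - p))
      - (lift_prod p (n - p) (H p) (F (n - p)) + lift_prod p (n - p) (H p) (G (n - p))) \<in> coboundaries n"
    if "p \<le> n" for p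
    using lift_prod_add_right[OF H[of p] F[of "n - p"] G[of "n - p"]] that by simp
  then show "total_prod H (\<lambda>n. F n + G n) n - (total_prod H F n + total_prod H G n) \<in> coboundaries n"
    unfolding total_prod_def sum.distrib[symmetric] by (intro sum_coboundaries_cong) auto
qed

lemma scale_sum: "scale c (sum f A) = (\<Sum>a\<in>A. scale c (f a))"
  using sum_comp_morphism[of "scale c" f A] by (simp add: scale_zero_right scale_add_right comp_def)

lemma total_prod_scale:
  fixes F G :: "nat \<Rightarrow> 'k::field chain \<Rightarrow> 'k lam"
  assumes F: "\<And>n. F n \<in> cocycles n" and G: "\<And>n. G n \<in> cocycles n"
  shows "total_prod (\<lambda>n x. scale c (F n x)) G n = (\<lambda>x. scale c (total_prod F G n x))"
    "total_prod F (\<lambda>n x. scale c (G n x)) n - (\<lambda>x. scale c (total_prod F G n x)) \<in> coboundaries n"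
proof -
  show "total_prod (\<lambda>n x. scale c (F n x)) G n = (\<lambda>x. scale c (total_prod F G n x))"
    by (simp add: total_prod_def lift_prod_def fun_eq_iff sum_fun_apply scale_sum)
  have "(\<lambda>x. scale c (total_prod F G n x))
      = (\<Sum>p\<le>n. (\<lambda>x. scale c (lift_prod p (n - p) (F p) (G (n - p)) x)))"
    by (simp add: total_prod_def fun_eq_iff sum_fun_apply scale_sum)
  moreover have "lift_prod p (n - p) (F p) (\<lambda>x. scale c (G (n - p) x))
      - (\<lambda>x. scale c (lift_prod p (n - p) (F p) (G (n - p)) x)) \<in> coboundaries n" if "p \<le> n" for p
    using lift_prod_scale_right[OF F[of p] G[of "n - p"]] that by simp
  ultimately show "total_prod F (\<lambda>n x. scale c (G n x)) n - (\<lambda>x. scale c (total_prod F G n x)) \<in> coboundaries n"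
    unfolding total_prod_def[of F "\<lambda>n x. scale c (G n x)"] by (simp only:) (intro sum_coboundaries_cong, auto)
qed


section \<open>The algebra structure and products with the degree-two classes\<close>

abbreviation (input) HHA :: "('k::field, nat \<Rightarrow> ('k chain \<Rightarrow> 'k lam) set) module" where
  "HHA \<equiv> HH_algebra"

lemma HH_carrierE:
  assumes "z \<in> carrier HHA"
  obtains F where "F \<in> total_cocycles" "z = total_class F"
  using assms by (auto simp: HH_carrier)

lemma total_class_in_carrier: "F \<in> total_cocycles \<Longrightarrow> total_class F \<in> carrier HHA"
  by (auto simp: HH_carrier)

lemma HH_mult': "F \<in> total_cocycles \<Longrightarrow> G \<in> total_cocycles \<Longrightarrow>
    total_class F \<otimes>\<^bsub>HHA\<^esub> total_class G = total_class (total_prod F G)"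
  by (rule HH_mult) (simp_all add: total_cocyclesD)

lemma HH_abelian_group: "abelian_group (HHA :: ('k::field, _) module)"
proof (rule abelian_groupI)
  fix x y z :: "nat \<Rightarrow> ('k chain \<Rightarrow> 'k lam) set"
  assume x: "x \<in> carrier HHA"
  then obtain F where F: "F \<in> total_cocycles" "x = total_class F" by (rule HH_carrierE)
  show "\<zero>\<^bsub>HHA\<^esub> \<oplus>\<^bsub>HHA\<^esub> x = x"
    by (simp add: F HH_zero HH_add)
  show "\<exists>y\<in>carrier HHA. y \<oplus>\<^bsub>HHA\<^esub> x = \<zero>\<^bsub>HHA\<^esub>"
    by (rule bexI[of _ "total_class (\<lambda>n. - F n)"])
      (simp_all add: F HH_zero HH_add total_class_in_carrier total_cocycles_closed[OF F(1) F(1)])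
  assume y: "y \<in> carrier HHA"
  then obtain G where G: "G \<in> total_cocycles" "y = total_class G" by (rule HH_carrierE)
  show "x \<oplus>\<^bsub>HHA\<^esub> y \<in> carrier HHA"
    by (simp add: F G HH_add total_class_in_carrier total_cocycles_closed)
  show "x \<oplus>\<^bsub>HHA\<^esub> y = y \<oplus>\<^bsub>HHA\<^esub> x"
    by (simp add: F G HH_add add.commute)
  assume z: "z \<in> carrier HHA"
  then obtain H where H: "H \<in> total_cocycles" "z = total_class H" by (rule HH_carrierE)
  show "x \<oplus>\<^bsub>HHA\<^esub> y \<oplus>\<^bsub>HHA\<^esub> z = x \<oplus>\<^bsub>HHA\<^esub> (y \<oplus>\<^bsub>HHA\<^esub> z)"
    by (simp add: F G H HH_add add.assoc)
next
  have "(\<lambda>n. 0) \<in> (total_cocycles :: (nat \<Rightarrow> 'k chain \<Rightarrow> 'k lam) set)"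
    using homog_total_cocycle[of 0 0] by simp
  then show "\<zero>\<^bsub>HHA\<^esub> \<in> carrier (HHA :: ('k, _) module)"
    by (simp add: HH_zero total_class_in_carrier)
qed

lemma HH_monoid: "Group.monoid (HHA :: ('k::field, _) module)"
proof (rule monoidI)
  show one: "\<one>\<^bsub>HHA\<^esub> \<in> carrier (HHA :: ('k, _) module)"
    by (simp add: HH_one total_class_in_carrier homog_total_cocycle aug_cocycle)
  fix x y z :: "nat \<Rightarrow> ('k chain \<Rightarrow> 'k lam) set"
  assume x: "x \<in> carrier HHA"
  then obtain F where F: "F \<in> total_cocycles" "x = total_class F" by (rule HH_carrierE)
  note one' = homog_total_cocycle[OF aug_cocycle]
  show "\<one>\<^bsub>HHA\<^esub> \<otimes>\<^bsub>HHA\<^esub> x = x" "x \<otimes>\<^bsub>HHA\<^esub> \<one>\<^bsub>HHA\<^esub> = x"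
    by (simp_all add: F HH_one HH_mult' one' total_class_eq_iff total_prod_one total_cocyclesD)
  assume y: "y \<in> carrier HHA"
  then obtain G where G: "G \<in> total_cocycles" "y = total_class G" by (rule HH_carrierE)
  show "x \<otimes>\<^bsub>HHA\<^esub> y \<in> carrier HHA"
    by (simp add: F G HH_mult' total_class_in_carrier total_prod_closed)
  assume z: "z \<in> carrier HHA"
  then obtain H where H: "H \<in> total_cocycles" "z = total_class H" by (rule HH_carrierE)
  show "x \<otimes>\<^bsub>HHA\<^esub> y \<otimes>\<^bsub>HHA\<^esub> z = x \<otimes>\<^bsub>HHA\<^esub> (y \<otimes>\<^bsub>HHA\<^esub> z)"
    by (simp add: F G H HH_mult' total_prod_closed total_class_eq_iff total_prod_assoc total_cocyclesD)
qed

lemma HH_ring: "ring (HHA :: ('k::field, _) module)"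
proof (rule ringI[OF HH_abelian_group HH_monoid])
  fix x y z :: "nat \<Rightarrow> ('k chain \<Rightarrow> 'k lam) set"
  assume xyz: "x \<in> carrier HHA" "y \<in> carrier HHA" "z \<in> carrier HHA"
  obtain F where F: "F \<in> total_cocycles" "x = total_class F" using xyz(1) by (rule HH_carrierE)
  obtain G where G: "G \<in> total_cocycles" "y = total_class G" using xyz(2) by (rule HH_carrierE)
  obtain H where H: "H \<in> total_cocycles" "z = total_class H" using xyz(3) by (rule HH_carrierE)
  show "(x \<oplus>\<^bsub>HHA\<^esub> y) \<otimes>\<^bsub>HHA\<^esub> z = x \<otimes>\<^bsub>HHA\<^esub> z \<oplus>\<^bsub>HHA\<^esub> y \<otimes>\<^bsub>HHA\<^esub> z"
    "z \<otimes>\<^bsub>HHA\<^esub> (x \<oplus>\<^bsub>HHA\<^esub> y) = z \<otimes>\<^bsub>HHA\<^esub> x \<oplus>\<^bsub>HHA\<^esub> z \<otimes>\<^bsub>HHA\<^esub> y"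
    by (simp_all add: F G H HH_mult' HH_add total_cocycles_closed total_class_eq_iff total_prod_add total_cocyclesD)
qed

lemma HH_module: "Module.module (ring_of_type_algebra :: 'k::field ring) HHA"
proof (rule moduleI[OF cring_from_type_algebra HH_abelian_group])
  fix x y :: "nat \<Rightarrow> ('k chain \<Rightarrow> 'k lam) set" and c d :: 'k
  assume x: "x \<in> carrier HHA"
  then obtain F where F: "F \<in> total_cocycles" "x = total_class F" by (rule HH_carrierE)
  show "c \<odot>\<^bsub>HHA\<^esub> x \<in> carrier HHA"
    by (simp add: F HH_smult total_class_in_carrier total_cocycles_closed[OF F(1) F(1)])
  have s: "(\<lambda>x. scale (c + d) (f x)) = (\<lambda>x. scale c (f x)) + (\<lambda>x. scale d (f x))"
    for f :: "'k chain \<Rightarrow> 'k lam"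
    by (simp add: fun_eq_iff plus_fun_apply scale_add_left)
  show "(c \<oplus>\<^bsub>ring_of_type_algebra\<^esub> d) \<odot>\<^bsub>HHA\<^esub> x = c \<odot>\<^bsub>HHA\<^esub> x \<oplus>\<^bsub>HHA\<^esub> d \<odot>\<^bsub>HHA\<^esub> x"
    by (simp add: F HH_smult HH_add ring_of_type_algebra_def s)
  show "(c \<otimes>\<^bsub>ring_of_type_algebra\<^esub> d) \<odot>\<^bsub>HHA\<^esub> x = c \<odot>\<^bsub>HHA\<^esub> (d \<odot>\<^bsub>HHA\<^esub> x)"
    by (simp add: F HH_smult ring_of_type_algebra_def scale_scale)
  show "\<one>\<^bsub>ring_of_type_algebra\<^esub> \<odot>\<^bsub>HHA\<^esub> x = x"
    by (simp add: F HH_smult ring_of_type_algebra_def scale_one_left)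
  assume y: "y \<in> carrier HHA"
  then obtain G where G: "G \<in> total_cocycles" "y = total_class G" by (rule HH_carrierE)
  have s: "(\<lambda>x. scale c ((f + g) x)) = (\<lambda>x. scale c (f x)) + (\<lambda>x. scale c (g x))"
    for f g :: "'k chain \<Rightarrow> 'k lam"
    by (simp add: fun_eq_iff plus_fun_apply scale_add_right)
  show "c \<odot>\<^bsub>HHA\<^esub> (x \<oplus>\<^bsub>HHA\<^esub> y) = c \<odot>\<^bsub>HHA\<^esub> x \<oplus>\<^bsub>HHA\<^esub> c \<odot>\<^bsub>HHA\<^esub> y"
    by (simp add: F G HH_smult HH_add s)
qed

lemma HH_K_algebra: "K_algebra (HHA :: ('k::field, _) module)"
  unfolding K_algebra_def
proof (intro conjI allI ballI HH_ring HH_module)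
  fix x y :: "nat \<Rightarrow> ('k chain \<Rightarrow> 'k lam) set" and c :: 'k
  assume xy: "x \<in> carrier HHA" "y \<in> carrier HHA"
  obtain F where F: "F \<in> total_cocycles" "x = total_class F" using xy(1) by (rule HH_carrierE)
  obtain G where G: "G \<in> total_cocycles" "y = total_class G" using xy(2) by (rule HH_carrierE)
  show "c \<odot>\<^bsub>HHA\<^esub> x \<otimes>\<^bsub>HHA\<^esub> y = c \<odot>\<^bsub>HHA\<^esub> (x \<otimes>\<^bsub>HHA\<^esub> y)"
    "x \<otimes>\<^bsub>HHA\<^esub> (c \<odot>\<^bsub>HHA\<^esub> y) = c \<odot>\<^bsub>HHA\<^esub> (x \<otimes>\<^bsub>HHA\<^esub> y)"
    by (simp_all add: F G HH_mult' HH_smult total_cocycles_closed[OF F(1) F(1)] total_cocycles_closed[OF G(1) G(1)]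
        total_class_eq_iff total_prod_scale total_cocyclesD)
qed

section \<open>Cochains as families of values on the generators\<close>

lemma cell_lmul: "cell n i r u w = lmul (tens u w) (res_gen n i r)"
  by (simp add: res_gen_cell lmul_cell)

lemma cochain_cell: "f \<in> cochains n \<Longrightarrow> f (cell n i r u w) = u * f (res_gen n i r) * w"
  by (simp add: cell_lmul cochainsD act_tens)

lemma res_gen_out [simp]: "r < 0 \<or> int n < r \<Longrightarrow> res_gen n i r = 0"
  by (simp add: res_gen_cell)

text \<open>A generator is fixed by its own idempotents, so its value inherits them.\<close>

lemma cochain_gen_idem:
  assumes "f \<in> cochains n"
  shows "idem i * f (res_gen n i r) * idem (i + of_nat n) = f (res_gen n i r)"
  using cochain_cell[OF assms, of i r "1 * idem i" "idem (i + of_nat n) * 1"]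
  by (simp only: cell_idem if_True simp_thms) (simp add: res_gen_cell)

lemma cochain_eqI:
  assumes "f \<in> cochains n" "g \<in> cochains n"
    and "\<And>i r. r \<le> n \<Longrightarrow> f (res_gen n i (int r)) = g (res_gen n i (int r))"
  shows "f = g"
proof
  fix x
  show "f x = g x"
    using assms by (cases "x \<in> res n") (simp_all add: cochains_expand[of _ n x] cochainsD(3))
qed

text \<open>The transpose of \<open>diff_cell_Suc\<close>: the value of the coboundary on a
  generator in terms of values \<open>V\<close>, which are to be zero at indices out of
  range.\<close>

definition diff_value :: "nat \<Rightarrow> (2 \<Rightarrow> int \<Rightarrow> 'k::field lam) \<Rightarrow> 2 \<Rightarrow> int \<Rightarrow> 'k lam" where
  "diff_value n V i r = V i r * xx - sgz (int n) (V i (r - 1) * yy)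
     - sgz (int n + r) (xx * V (i + 1) r + yy * V (i + 1) (r - 1))"

lemma cochain_diff_gen:
  assumes f: "f \<in> cochains n"
  shows "f (diff (Suc n) (res_gen (Suc n) i r)) = diff_value n (\<lambda>i r. f (res_gen n i r)) i r"
proof -
  show ?thesis
    by (simp add: res_gen_cell[of "Suc n"] diff_cell_Suc diff_value_def sgz_def cochain_cell[OF f]
        cochains_uminus[OF f] cochains_minus[OF f] cochainsD(1)[OF f])
qed

lemma cocycle_iff:
  assumes f: "f \<in> cochains n"
  shows "f \<in> cocycles n \<longleftrightarrow> (\<forall>i r. diff_value n (\<lambda>i r. f (res_gen n i r)) i r = 0)"
proof
  assume "f \<in> cocycles n"
  then show "\<forall>i r. diff_value n (\<lambda>i r. f (res_gen n i r)) i r = 0"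
    using cochain_diff_gen[OF f] by (metis cocyclesD res_gen_in_res)
next
  assume *: "\<forall>i r. diff_value n (\<lambda>i r. f (res_gen n i r)) i r = 0"
  have "extend0 (Suc n) (f \<circ> diff (Suc n)) = 0"
    by (rule cochain_eqI[OF cochains_comp_diff[OF f]])
      (use * in \<open>simp_all add: extend0_def cochain_diff_gen[OF f] zero_fun_apply\<close>)
  then have "f (diff (Suc n) x) = 0" if "x \<in> res (Suc n)" for x
    using that by (metis comp_apply extend0_def zero_fun_apply)
  then show "f \<in> cocycles n"
    using f unfolding cocycles_def by blast
qed

lemma sum_cochains: "(\<And>a. a \<in> A \<Longrightarrow> f a \<in> cochains n) \<Longrightarrow> sum f A \<in> cochains n"
  by (induction A rule: infinite_finite_induct) simp_all

definition single_coch :: "nat \<Rightarrow> nat \<Rightarrow> (2 \<Rightarrow> 'k::field lam) \<Rightarrow> 'k chain \<Rightarrow> 'k lam" where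
  "single_coch n r w = coch n (\<lambda>i r'. if r' = r then w i else 0)"

lemma coch_res_gen:
  assumes "r \<le> n"
  shows "coch n v (res_gen n i (int r)) = idem i * v i r * idem (i + of_nat n)"
proof -
  have "coch n v (res_gen n i (int r)) = (\<Sum>i'\<in>UNIV. \<Sum>r'\<le>n. if r' = r then if i' = i then act (gen_idem n i) (v i r) else 0 else 0)"
    unfolding coch_def extend0_def using assms
    by (simp only: res_gen_in_res if_True) (intro sum.cong refl, auto simp: res_gen_def)
  then show ?thesis using assms by (simp add: act_tens)
qed

definition normalized :: "nat \<Rightarrow> (2 \<Rightarrow> 'k::field lam) \<Rightarrow> bool" where
  "normalized n w \<longleftrightarrow> (\<forall>i. idem i * w i * idem (i + of_nat n) = w i)"

lemma single_coch_in_cochains [simp]: "single_coch n r w \<in> cochains n"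
  by (simp add: single_coch_def)

lemma single_coch_gen:
  assumes "normalized n w" "r \<le> n"
  shows "single_coch n r w (res_gen n i r') = (if r' = int r then w i else 0)"
proof (cases "0 \<le> r' \<and> r' \<le> int n")
  case True
  then have "r' = int (nat r')" "nat r' \<le> n" by auto
  then show ?thesis
    using coch_res_gen[of "nat r'" n "\<lambda>i r'. if r' = r then w i else 0" i] assms
    by (auto simp: single_coch_def normalized_def)
next
  case False
  then show ?thesis using assms cochains_zero[OF single_coch_in_cochains] by auto
qed

lemma single_coch_decomp:
  assumes f: "f \<in> cochains n"
  shows "f = (\<Sum>r\<le>n. single_coch n r (\<lambda>i. f (res_gen n i (int r))))"
proof (rule cochain_eqI[OF f])
  have n: "normalized n (\<lambda>i. f (res_gen n i (int r)))" for r
    by (simp add: normalized_def cochain_gen_idem[OF f])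
  show "(\<Sum>r\<le>n. single_coch n r (\<lambda>i. f (res_gen n i (int r)))) \<in> cochains n"
    by (rule sum_cochains) simp
  fix i r assume r: "r \<le> n"
  have "(\<Sum>r'\<le>n. single_coch n r' (\<lambda>i. f (res_gen n i (int r')))) (res_gen n i (int r))
      = (\<Sum>r'\<le>n. if r' = r then f (res_gen n i (int r)) else 0)"
    unfolding sum_fun_apply
    by (intro sum.cong refl) (auto simp: single_coch_gen[OF n])
  then show "f (res_gen n i (int r)) = (\<Sum>r'\<le>n. single_coch n r' (\<lambda>i. f (res_gen n i (int r')))) (res_gen n i (int r))"
    using r by simp
qed

lemma single_coch_add: "single_coch n r (\<lambda>i. v i + w i) = single_coch n r v + single_coch n r w"
  by (rule cochain_eqI[of _ n]) (simp_all add: single_coch_def coch_res_gen plus_fun_apply distrib_left distrib_right)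

lemma single_coch_scale: "single_coch n r (\<lambda>i. scale c (w i)) = (\<lambda>x. scale c (single_coch n r w x))"
  by (rule cochain_eqI[of _ n])
    (simp_all add: single_coch_def coch_res_gen scale_mult_left scale_mult_right scale_zero_right)

text \<open>The coboundary of a cochain supported at \<open>r\<close> is supported at the indices
  \<open>r\<close>, where only x enters, and \<open>r + 1\<close>, where only y enters; hence two
  independent conditions.\<close>

lemma single_coch_cocycle:
  assumes w: "normalized n w" and r: "r \<le> n"
    and x: "\<And>i. w i * xx = sgz (int n + int r) (xx * w (i + 1))"
    and y: "\<And>i. w i * yy = sgz (int r) (yy * w (i + 1))"
  shows "single_coch n r w \<in> cocycles n"
  unfolding cocycle_iff[OF single_coch_in_cochains] diff_value_def single_coch_gen[OF w r]
proof (intro allI)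
  fix i r'
  consider "r' = int r" | "r' = int r + 1" | "r' \<noteq> int r" "r' - 1 \<noteq> int r" by linarith
  then show "(if r' = int r then w i else 0) * xx - sgz (int n) ((if r' - 1 = int r then w i else 0) * yy)
      - sgz (int n + r') (xx * (if r' = int r then w (i + 1) else 0)
          + yy * (if r' - 1 = int r then w (i + 1) else 0)) = 0"
    by cases (simp_all add: x y sgz_def)
qed

section \<open>The shift maps, which lift the classes of degree two\<close>

definition shift_chain :: "nat \<Rightarrow> nat \<Rightarrow> 'k::field chain \<Rightarrow> 'k chain" where
  "shift_chain s p x = (\<lambda>i r. if r \<le> p then (if s = 1 \<and> i = 1 then - x i (r + s) else x i (r + s)) else 0)"

text \<open>The factor \<open>(-1)^(r * i)\<close>, with the vertex \<open>i\<close> read as 0 or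
  1.\<close>

definition twist :: "nat \<Rightarrow> 2 \<Rightarrow> 'b::ab_group_add \<Rightarrow> 'b" where
  "twist r i z = (if odd r \<and> i = 1 then - z else z)"

lemma shift_chain_linear:
  "shift_chain s p (x + y) = shift_chain s p x + shift_chain s p y"
  "shift_chain s p (- x) = - shift_chain s p x"
  "shift_chain s p (x - y) = shift_chain s p x - shift_chain s p y"
  "shift_chain s p (lmul t x) = lmul t (shift_chain s p x)"
  "shift_chain s p 0 = 0"
  by (auto simp: shift_chain_def fun_eq_iff plus_fun_apply minus_apply uminus_apply lmul_apply zero_fun_apply)

lemma shift_chain_cell:
  assumes "s \<le> 2"
  shows "shift_chain s p (cell (Suc (Suc p)) i r u w) = twist s i (cell p i (r - int s) u w)"
proof -
  have "s = 0 \<or> s = 1 \<or> s = 2" using assms by auto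
  then show ?thesis
    by (elim disjE) (auto simp: shift_chain_def fun_eq_iff cell_def twist_def uminus_apply)
qed

lemma shift_chain_in_res: "s \<le> 2 \<Longrightarrow> x \<in> res (Suc (Suc p)) \<Longrightarrow> shift_chain s p x \<in> res p"
proof -
  assume s: "s \<le> 2" and x: "x \<in> res (Suc (Suc p))"
  have "x i (r + s) * gen_idem p i = x i (r + s)" if "r \<le> p" for i r
  proof -
    have "r + s \<le> Suc (Suc p)" using s that by simp
    then have "x i (r + s) * gen_idem (Suc (Suc p)) i = x i (r + s)"
      using x unfolding res_iff by metis
    then show ?thesis by simp
  qed
  then show ?thesis by (auto simp: res_iff shift_chain_def)
qed

lemma diff_shift_chain:
  assumes s: "s \<le> 2" and x: "x \<in> res (Suc (Suc (Suc p)))"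
  shows "diff (Suc p) (shift_chain s (Suc p) x) = shift_chain s p (diff (Suc (Suc (Suc p))) x)"
  using x
proof (induction rule: res_induct)
  case (cell i r u w)
  have "s = 0 \<or> s = 1 \<or> s = 2" using s by auto
  then show ?case
    using vertex_cases[of i]
    by (elim disjE) (simp_all add: shift_chain_cell shift_chain_linear diff_cell_Suc twist_def sgz_def diff_uminus algebra_simps)
qed (simp add: shift_chain_linear diff_add)

text \<open>The index \<open>s\<close> is 1 minus the second subscript: \<open>s = 0, 1, 2\<close>
  gives \<open>chi_2_1\<close>, \<open>chi_2_0\<close>, \<open>chi_2_m1\<close>.\<close>

definition chi_coch :: "nat \<Rightarrow> 'k::field chain \<Rightarrow> 'k lam" where
  "chi_coch s = single_coch 2 s (\<lambda>i. twist s i (idem i))"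

lemma normalized_twist: "normalized n w \<Longrightarrow> normalized n (\<lambda>i. twist r i (w i))"
  by (auto simp: normalized_def twist_def)

lemma normalized_idem: "even n \<Longrightarrow> normalized n (idem :: 2 \<Rightarrow> 'k::field lam)"
  by (auto simp: normalized_def elim!: evenE)

lemma is_lift_shift:
  assumes s: "s \<le> 2"
  shows "is_lift 2 (chi_coch s :: 'k::field chain \<Rightarrow> 'k lam) (\<lambda>p. extend0 (p + 2) (shift_chain s p))"
proof -
  have "extend0 (Suc (Suc p)) (shift_chain s p) \<in> (res_homs (Suc (Suc p)) p :: ('k chain \<Rightarrow> 'k chain) set)" for p
    by (auto simp: res_homs_def extend0_def shift_chain_linear shift_chain_in_res[OF s])
  moreover have "aug (shift_chain s 0 x) = chi_coch s x" if "x \<in> res 2" for x :: "'k chain"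
    using that
  proof (induction rule: res_induct)
    case (cell i r u w)
    have "r \<noteq> s \<Longrightarrow> cell 0 i (int r - int s) u w = 0"
      by (rule cell_out) auto
    then have "aug (shift_chain s 0 (cell 2 i (int r) u w)) = (if r = s then twist s i (u * idem i * w) else 0)"
      using s shift_chain_cell[OF s, of 0 i "int r" u w]
      by (cases "r = s") (auto simp: aug_cell twist_def aug_uminus eval_nat_numeral)
    also have "\<dots> = u * chi_coch s (res_gen 2 i (int r)) * w"
      unfolding chi_coch_def single_coch_gen[OF normalized_twist[OF normalized_idem] s, OF even_numeral]
      by (simp add: twist_def)
    finally show ?case
      by (simp add: chi_coch_def cochain_cell[OF single_coch_in_cochains])
  next
    case (add x y)
    then show ?case
      by (simp add: shift_chain_linear aug_add chi_coch_def cochainsD(1)[OF single_coch_in_cochains])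
  qed
  moreover have "diff (Suc p) (shift_chain s (Suc p) x) = shift_chain s p (diff (Suc (Suc (Suc p))) x)"
    if "x \<in> res (Suc (Suc (Suc p)))" for p and x :: "'k chain"
    using s that by (rule diff_shift_chain)
  ultimately show ?thesis
    by (simp add: is_lift_def extend0_def eval_nat_numeral)
qed

lemma single_coch_shift:
  fixes w :: "2 \<Rightarrow> 'k::field lam"
  assumes w: "normalized p w" and r: "r \<le> p" and s: "s \<le> 2"
  shows "single_coch p r w \<circ> extend0 (p + 2) (shift_chain s p)
    = single_coch (p + 2) (r + s) (\<lambda>i. twist s i (w i))"
proof (rule cochain_eqI[of _ "p + 2"])
  show "single_coch p r w \<circ> extend0 (p + 2) (shift_chain s p) \<in> cochains (p + 2)"
    using is_liftD(1)[OF is_lift_shift[OF s]] by (rule cochains_comp[OF single_coch_in_cochains])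
  have w': "normalized (p + 2) (\<lambda>i. twist s i (w i))"
    using normalized_twist[OF w] by (simp add: normalized_def)
  fix i r'
  have tw: "single_coch p r w (twist s i x) = twist s i (single_coch p r w x)" if "x \<in> res p" for x
    using that by (simp add: twist_def cochains_uminus[OF single_coch_in_cochains])
  have "shift_chain s p (res_gen (p + 2) i (int r') :: 'k chain) = twist s i (res_gen p i (int r' - int s))"
    using shift_chain_cell[OF s, of p i "int r'" 1 1] by (simp add: res_gen_cell)
  then have "(single_coch p r w \<circ> extend0 (p + 2) (shift_chain s p)) (res_gen (p + 2) i (int r'))
      = twist s i (if int r' - int s = int r then w i else 0)"
    by (simp only: comp_apply extend0_def res_gen_in_res if_True tw single_coch_gen[OF w r])
  also have "\<dots> = single_coch (p + 2) (r + s) (\<lambda>i. twist s i (w i)) (res_gen (p + 2) i (int r'))"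
    using r s by (subst single_coch_gen[OF w']) (auto simp: twist_def)
  finally show "(single_coch p r w \<circ> extend0 (p + 2) (shift_chain s p)) (res_gen (p + 2) i (int r'))
    = single_coch (p + 2) (r + s) (\<lambda>i. twist s i (w i)) (res_gen (p + 2) i (int r'))" .
qed simp

section \<open>Arithmetic with homogeneous elements\<close>

lemma homog_add: "homog n f \<oplus>\<^bsub>HHA\<^esub> homog n g = homog n (f + g)"
  unfolding homog_total_class HH_add by (rule arg_cong[of _ _ total_class]) auto

lemma homog_scale: "c \<odot>\<^bsub>HHA\<^esub> homog n f = homog n (\<lambda>x. scale c (f x))"
  unfolding homog_total_class HH_smult
  by (rule arg_cong[of _ _ total_class]) (auto simp: fun_eq_iff zero_fun_apply scale_zero_right)

lemma homog_eqI: "f - g \<in> coboundaries n \<Longrightarrow> homog n f = homog n g"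
  by (simp add: homog_total_class total_class_eq_iff)

lemma homog_zero: "homog n 0 = \<zero>\<^bsub>HHA\<^esub>"
  unfolding homog_total_class HH_zero by (rule arg_cong[of _ _ total_class]) auto

lemma homog_mult:
  assumes f: "f \<in> cocycles p" and g: "g \<in> cocycles q" and G: "is_lift q g G"
  shows "homog p f \<otimes>\<^bsub>HHA\<^esub> homog q g = homog (p + q) (f \<circ> G p)"
proof -
  let ?F = "\<lambda>n. if n = p then f else 0" and ?G = "\<lambda>n. if n = q then g else 0"
  have c: "?F n \<in> cocycles n" "?G n \<in> cocycles n" for n using f g by auto
  have "total_prod ?F ?G n - (if n = p + q then f \<circ> G p else 0) \<in> coboundaries n" for n
  proof -
    have "total_prod ?F ?G n - (\<Sum>a\<le>n. if a = p then (if n = p + q then f \<circ> G p else 0) else 0) \<in> coboundaries n"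
      unfolding total_prod_def
    proof (rule sum_coboundaries_cong)
      fix a assume a: "a \<in> {..n}"
      show "lift_prod a (n - a) (?F a) (?G (n - a)) - (if a = p then (if n = p + q then f \<circ> G p else 0) else 0)
        \<in> coboundaries n"
      proof (cases "a = p \<and> n = p + q")
        case True
        then show ?thesis using lift_prod_eqI[OF f g G] by simp
      next
        case False
        \<comment> \<open>A product with 0 as second factor is only known to be a coboundary,
          because the lift of 0 is an arbitrary choice.\<close>
        then have "?F a \<in> coboundaries a \<or> ?G (n - a) \<in> coboundaries (n - a)"
          using a by auto
        from lift_prod_coboundary[OF c this] show ?thesis
          using False a by auto
      qed
    qed
    also have "(\<Sum>a\<le>n. if a = p then (if n = p + q then f \<circ> G p else 0) else 0)
        = (if n = p + q then f \<circ> G p else 0)"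
      by auto
    finally show ?thesis .
  qed
  then show ?thesis
    unfolding homog_total_class HH_mult[OF c] total_class_eq_iff by blast
qed

text \<open>Up to coboundaries a family may be cut down to the finitely many degrees where it is not
  a coboundary, hence to a finite sum of homogeneous elements.\<close>

lemma total_class_in_subalgebra:
  fixes S :: "(nat \<Rightarrow> ('k::field chain \<Rightarrow> 'k lam) set) set"
  assumes S: "K_subalgebra S HHA"
    and h: "\<And>n f. f \<in> cocycles n \<Longrightarrow> homog n f \<in> S"
    and F: "F \<in> total_cocycles"
  shows "total_class F \<in> S"
proof -
  have sub: "subring S HHA" using S by (simp add: K_subalgebra_def)
  have *: "total_class (\<lambda>n. if n \<in> A then F n else 0) \<in> S" if "finite A" for A
    using that
  proof (induction rule: finite_induct)
    case empty
    then show ?case using subringE(2)[OF sub] by (simp add: HH_zero)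
  next
    case (insert a A)
    have "total_class (\<lambda>n. if n \<in> A then F n else 0) \<oplus>\<^bsub>HHA\<^esub> homog a (F a) \<in> S"
      by (intro subringE(7)[OF sub] insert.IH h total_cocyclesD[OF F])
    also have "total_class (\<lambda>n. if n \<in> A then F n else 0) \<oplus>\<^bsub>HHA\<^esub> homog a (F a)
        = total_class (\<lambda>n. if n \<in> insert a A then F n else 0)"
      unfolding homog_total_class HH_add by (rule arg_cong[of _ _ total_class]) (use insert.hyps in auto)
    finally show ?case .
  qed
  have "total_class F = total_class (\<lambda>n. if n \<in> {n. F n \<notin> coboundaries n} then F n else 0)"
    by (simp add: total_class_eq_iff)
  also have "\<dots> \<in> S"
    by (rule *) (use F in \<open>simp add: total_cocycles_def\<close>)
  finally show ?thesis .
qed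

text \<open>The cocycle property is included because products of homogeneous elements can be
  evaluated only for cocycles.\<close>

definition represents :: "(nat \<Rightarrow> ('k::field chain \<Rightarrow> 'k lam) set) set \<Rightarrow> nat \<Rightarrow> ('k chain \<Rightarrow> 'k lam) \<Rightarrow> bool" where
  "represents S n f \<longleftrightarrow> f \<in> cocycles n \<and> homog n f \<in> S"

text \<open>
  Up to coboundaries, the values of a cocycle on the generators with index \<open>r\<close> are combinations of the twists
  by \<open>r\<close> of \<open>idem\<close> and \<open>soc_at\<close> in even degrees, and of \<open>arr\<close> and \<open>odd_bar\<close> in odd degrees.
\<close>

definition odd_bar :: "2 \<Rightarrow> 'k::field lam" where
  "odd_bar i = twist 1 i (bar (i + 1))"

definition soc_at :: "2 \<Rightarrow> 2 \<Rightarrow> 'k::field lam" where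
  "soc_at j i = (if i = j then soc i else 0)"

lemma normalized_basic:
  "odd n \<Longrightarrow> normalized n (arr :: 2 \<Rightarrow> 'k::field lam)"
  "odd n \<Longrightarrow> normalized n (odd_bar :: 2 \<Rightarrow> 'k lam)"
  "even n \<Longrightarrow> normalized n (soc_at j :: 2 \<Rightarrow> 'k lam)"
  by (auto simp: normalized_def odd_bar_def soc_at_def twist_def elim!: evenE oddE intro!: lam_eqI)

lemma twist_twist: "twist r i (twist s i z) = twist (r + s) i z"
  by (simp add: twist_def)

lemma twist_zero [simp]: "twist 0 i z = z"
  by (simp add: twist_def)

lemma chi_coch_cocycle: "s \<le> 2 \<Longrightarrow> chi_coch s \<in> cocycles 2"
  unfolding chi_coch_def
proof (rule single_coch_cocycle)
  fix i :: 2
  show "twist s i (idem i) * xx = sgz (int 2 + int s) (xx * twist s (i + 1) (idem (i + 1)))"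
    "twist s i (idem i) * yy = sgz (int s) (yy * twist s (i + 1) (idem (i + 1)))"
    using vertex_cases[of i] by (auto simp: twist_def sgz_def idem_xx_comm)
qed (simp_all add: normalized_twist normalized_idem)

text \<open>Idempotents commute with x and y up to the exchange of vertices, and the twist supplies
  \<open>(-1)^r\<close>. Socle elements are annihilated. In odd degree \<open>arr\<close> meets only
  the condition for y, with sign \<open>(-1)^r\<close>, and bar arrows meet only the one for x, with
  sign \<open>(-1)^(n + r)\<close>; this explains the additional twist in
  \<open>odd_bar\<close>.\<close>

lemma twist_gen_cocycles:
  assumes "r \<le> n"
  shows "even n \<Longrightarrow> single_coch n r (\<lambda>i. twist r i (idem i :: 'k::field lam)) \<in> cocycles n"
    "even n \<Longrightarrow> single_coch n r (\<lambda>i. twist r i (soc_at j i :: 'k lam)) \<in> cocycles n"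
    "odd n \<Longrightarrow> single_coch n r (\<lambda>i. twist r i (arr i :: 'k lam)) \<in> cocycles n"
    "odd n \<Longrightarrow> single_coch n r (\<lambda>i. twist r i (odd_bar i :: 'k lam)) \<in> cocycles n"
proof -
  have s: "soc_at j i * xx = 0" "soc_at j i * yy = 0" "xx * soc_at j i = 0" "yy * soc_at j i = 0"
    "arr i * xx = 0" "xx * arr i = 0" "bar i * yy = 0" "yy * bar i = 0"
    "arr i * yy = soc i" "yy * arr i = soc (i + 1)" "bar i * xx = soc (i + 1)" "xx * bar i = soc i" for i
    by (auto intro!: lam_eqI simp: soc_at_def split: if_splits)
  note nt = normalized_twist normalized_idem normalized_basic
  show "single_coch n r (\<lambda>i. twist r i (idem i :: 'k lam)) \<in> cocycles n" if "even n"
  proof (rule single_coch_cocycle[OF _ assms])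
    fix i :: 2
    show "twist r i (idem i) * xx = sgz (int n + int r) (xx * twist r (i + 1) (idem (i + 1) :: 'k lam))"
      "twist r i (idem i) * yy = sgz (int r) (yy * twist r (i + 1) (idem (i + 1) :: 'k lam))"
      using vertex_cases[of i] that by (auto simp: twist_def sgz_def idem_xx_comm)
  qed (simp add: nt that)
  show "single_coch n r (\<lambda>i. twist r i (soc_at j i :: 'k lam)) \<in> cocycles n" if "even n"
    by (rule single_coch_cocycle[OF _ assms]) (simp_all add: nt that, auto simp: twist_def sgz_def s)
  show "single_coch n r (\<lambda>i. twist r i (arr i :: 'k lam)) \<in> cocycles n" if "odd n"
  proof (rule single_coch_cocycle[OF _ assms])
    fix i :: 2
    show "twist r i (arr i) * xx = sgz (int n + int r) (xx * twist r (i + 1) (arr (i + 1) :: 'k lam))"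
      "twist r i (arr i) * yy = sgz (int r) (yy * twist r (i + 1) (arr (i + 1) :: 'k lam))"
      using vertex_cases[of i] that by (auto simp: twist_def sgz_def s)
  qed (simp add: nt that)
  show "single_coch n r (\<lambda>i. twist r i (odd_bar i :: 'k lam)) \<in> cocycles n" if "odd n"
  proof (rule single_coch_cocycle[OF _ assms])
    fix i :: 2
    show "twist r i (odd_bar i) * xx = sgz (int n + int r) (xx * twist r (i + 1) (odd_bar (i + 1) :: 'k lam))"
      "twist r i (odd_bar i) * yy = sgz (int r) (yy * twist r (i + 1) (odd_bar (i + 1) :: 'k lam))"
      using vertex_cases[of i] that by (auto simp: twist_def sgz_def odd_bar_def s)
  qed (simp add: nt that)
qed

lemma gen_class_single:
  "2 * int r = int n - k \<Longrightarrow> gen_class n k (w :: 2 \<Rightarrow> 'k::field lam) = homog n (single_coch n r w)"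
  unfolding gen_class_def single_coch_def
  by (rule arg_cong[of _ _ "\<lambda>v. homog n (coch n v)"]) (auto simp: fun_eq_iff)

text \<open>In degrees 0 and 1 the exponent of the twist is made equal to the index
  \<open>r\<close>, a form that multiplication by the degree-two classes preserves.\<close>

lemma generators_eq:
  "centre_class (1 :: 'k::field lam) = homog 0 (single_coch 0 0 (\<lambda>i. twist 0 i (idem i)))"
  "centre_class (arr j * bar j :: 'k lam) = homog 0 (single_coch 0 0 (\<lambda>i. twist 0 i (soc_at j i)))"
  "phi_1_0 = homog 1 (single_coch 1 0 (\<lambda>i. twist 0 i (arr i :: 'k lam)))"
  "phi_1_m1 = homog 1 (single_coch 1 1 (\<lambda>i. twist 1 i (arr i :: 'k lam)))"
  "psi_1_0 = homog 1 (single_coch 1 0 (\<lambda>i. twist 0 i (odd_bar i :: 'k lam)))"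
  "psi_1_m1 = homog 1 (single_coch 1 1 (\<lambda>i. twist 1 i (odd_bar i :: 'k lam)))"
  "chi_2_1 = homog 2 (chi_coch 0 :: 'k chain \<Rightarrow> 'k lam)"
  "chi_2_0 = homog 2 (chi_coch 1 :: 'k chain \<Rightarrow> 'k lam)"
  "chi_2_m1 = homog 2 (chi_coch 2 :: 'k chain \<Rightarrow> 'k lam)"
proof -
  have v: "scale (vsign i) z = twist 1 i z" for i and z :: "'k lam"
    using vertex_cases[of i] scale_add_left[of 1 "- 1" z]
    by (auto simp: vsign_def twist_def scale_one_left scale_zero_left eq_neg_iff_add_eq_0 add.commute)
  have s: "idem i * soc j = (soc_at j i :: 'k lam)" for i j :: 2
    by (auto intro!: lam_eqI simp: soc_at_def split: if_splits)
  show "centre_class (1 :: 'k lam) = homog 0 (single_coch 0 0 (\<lambda>i. twist 0 i (idem i)))"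
    "centre_class (arr j * bar j :: 'k lam) = homog 0 (single_coch 0 0 (\<lambda>i. twist 0 i (soc_at j i)))"
    using gen_class_single[of 0 0 0, where 'k = 'k] by (simp_all add: centre_class_def soc_def[symmetric] s)
  show "phi_1_0 = homog 1 (single_coch 1 0 (\<lambda>i. twist 0 i (arr i :: 'k lam)))"
    "phi_1_m1 = homog 1 (single_coch 1 1 (\<lambda>i. twist 1 i (arr i :: 'k lam)))"
    "psi_1_0 = homog 1 (single_coch 1 0 (\<lambda>i. twist 0 i (odd_bar i :: 'k lam)))"
    "psi_1_m1 = homog 1 (single_coch 1 1 (\<lambda>i. twist 1 i (odd_bar i :: 'k lam)))"
    by (simp_all add: phi_1_0_def phi_1_m1_def psi_1_0_def psi_1_m1_def v odd_bar_def twist_twist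
        gen_class_single[of 0] gen_class_single[of 1]) (simp add: twist_def)
  show "chi_2_1 = homog 2 (chi_coch 0 :: 'k chain \<Rightarrow> 'k lam)"
    "chi_2_0 = homog 2 (chi_coch 1 :: 'k chain \<Rightarrow> 'k lam)"
    "chi_2_m1 = homog 2 (chi_coch 2 :: 'k chain \<Rightarrow> 'k lam)"
    by (simp_all add: chi_2_1_def chi_2_0_def chi_2_m1_def v chi_coch_def
        gen_class_single[of 0] gen_class_single[of 1] gen_class_single[of 2]) (simp add: twist_def)
qed

context
  fixes S :: "(nat \<Rightarrow> ('k::field chain \<Rightarrow> 'k lam) set) set"
  assumes S: "K_subalgebra S HHA"
begin

lemma represents_add: "represents S n f \<Longrightarrow> represents S n g \<Longrightarrow> represents S n (f + g)"
  using S subringE(7)[of S HHA] unfolding represents_def K_subalgebra_def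
  by (auto simp: homog_add[symmetric])

lemma represents_scale: "represents S n f \<Longrightarrow> represents S n (\<lambda>x. scale c (f x))"
  using S unfolding represents_def K_subalgebra_def by (auto simp: homog_scale[symmetric])

lemma represents_coboundary: "b \<in> coboundaries n \<Longrightarrow> represents S n b"
  using S subringE(2)[of S HHA] homog_eqI[of b 0 n] unfolding represents_def K_subalgebra_def
  by (auto simp: homog_zero)

lemma represents_sum: "(\<And>a. a \<in> A \<Longrightarrow> represents S n (f a)) \<Longrightarrow> represents S n (sum f A)"
  by (induction A rule: infinite_finite_induct)
    (simp_all add: represents_add represents_coboundary)

lemma represents_shift:
  assumes f: "represents S n (single_coch n r w)" and w: "normalized n w" and r: "r \<le> n" and s: "s \<le> 2"
    and chi: "homog 2 (chi_coch s) \<in> S"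
  shows "represents S (n + 2) (single_coch (n + 2) (r + s) (\<lambda>i. twist s i (w i)))"
proof -
  note L = is_lift_shift[OF s]
  have fc: "single_coch n r w \<in> cocycles n" using f by (simp add: represents_def)
  have "homog n (single_coch n r w) \<otimes>\<^bsub>HHA\<^esub> homog 2 (chi_coch s) \<in> S"
    using S f chi subringE(6)[of S HHA] by (auto simp: represents_def K_subalgebra_def)
  then show ?thesis
    using homog_mult[OF fc chi_coch_cocycle[OF s] L] comp_lift_cocycle[OF fc L]
    by (simp add: represents_def single_coch_shift[OF w r s, simplified])
qed

text \<open>Each step raises the degree by 2 and the index by \<open>s\<close>; exponents of twists
  add, so the twist remains equal to the index.\<close>

lemma represents_family:
  assumes base: "\<And>r. r \<le> b \<Longrightarrow> represents S b (single_coch b r (\<lambda>i. twist r i (w i)))"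
    and w: "normalized b w" and chi: "\<And>s. s \<le> 2 \<Longrightarrow> homog 2 (chi_coch s) \<in> S"
    and r: "r \<le> b + 2 * k"
  shows "represents S (b + 2 * k) (single_coch (b + 2 * k) r (\<lambda>i. twist r i (w i)))"
  using r
proof (induction k arbitrary: r)
  case 0
  then show ?case using base by simp
next
  case (Suc k)
  let ?n = "b + 2 * k"
  have n: "(of_nat ?n :: 2) = of_nat b" by simp
  have wn: "normalized ?n w" using w unfolding normalized_def n .
  \<comment> \<open>The shift is chosen so that \<open>r - s\<close> is an index of the lower
    degree: 0 when possible, otherwise the excess of \<open>r\<close>.\<close>
  obtain s where s: "s \<le> 2" "s \<le> r" "r - s \<le> ?n"
  proof -
    consider "r \<le> ?n" | "r = ?n + 1" | "r = ?n + 2" using Suc.prems by fastforce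
    then show thesis by cases (auto intro: that[of 0] that[of 1] that[of 2])
  qed
  have "represents S (?n + 2) (single_coch (?n + 2) (r - s + s) (\<lambda>i. twist s i (twist (r - s) i (w i))))"
    by (intro represents_shift Suc.IH normalized_twist wn s chi)
  then show ?case using s by (simp add: twist_twist)
qed

end


section \<open>Decomposition of cocycles\<close>

text \<open>In even degree a value lies in the span of an idempotent and a socle element at one
  vertex. The socle coefficients at the two vertices are independent, and the cocycle condition ties
  the two idempotent coefficients, so no coboundary has to be subtracted.\<close>

lemma even_normal_form:
  fixes f :: "'k::field chain \<Rightarrow> 'k lam"
  assumes n: "even n" and f: "f \<in> cocycles n"
  defines "V \<equiv> \<lambda>i r. f (res_gen n i r)"
  shows "V i (int r) = scale (coord_e 0 (V 0 (int r))) (twist r i (idem i))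
    + (scale (twist r 0 (coord_s 0 (V 0 (int r)))) (twist r i (soc_at 0 i))
     + scale (twist r 1 (coord_s 1 (V 1 (int r)))) (twist r i (soc_at 1 i)))"
proof -
  have fc: "f \<in> cochains n" using f by simp
  have [simp]: "(of_nat n :: 2) = 0" using n by (auto elim!: evenE)
  have I: "V j q = idem j * V j q * idem j" for j q
    using cochain_gen_idem[OF fc, of j q] by (simp add: V_def)
  have c: "coord_a j (V k q) = 0" "coord_b j (V k q) = 0" "j \<noteq> k \<Longrightarrow> coord_e j (V k q) = 0"
    "j \<noteq> k \<Longrightarrow> coord_s j (V k q) = 0" for j k q
    by (subst I, simp)+
  \<comment> \<open>In this coordinate only the two products with x contribute, one from each
    vertex.\<close>
  have "coord_a 0 (diff_value n V 0 (int r)) = 0"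
    using f cocycle_iff[OF fc] by (simp add: V_def)
  then have e: "coord_e 1 (V 1 (int r)) = twist r 1 (coord_e 0 (V 0 (int r)))"
    using n by (auto simp: diff_value_def sgz_def twist_def c split: if_splits)
  show ?thesis
    using vertex_cases[of i]
    by (elim disjE) (auto intro!: lam_eqI simp: twist_def soc_at_def c e)
qed

lemma vertex_neq: "j \<noteq> 1 \<longleftrightarrow> j = (0::2)" "j \<noteq> 0 \<longleftrightarrow> j = (1::2)"
  using vertex_cases[of j] by auto

text \<open>The symmetry assumed for the coefficients of \<open>arr\<close> passes to those of
  \<open>bar\<close> through the socle coordinate of the cocycle condition. It is assumed for
  \<open>r < n\<close> only, the range in which a coboundary can alter these coefficients.\<close>

lemma odd_normal_form:
  fixes f :: "'k::field chain \<Rightarrow> 'k lam"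
  assumes n: "odd n" and f: "f \<in> cocycles n" and r: "r \<le> n"
  defines "V \<equiv> \<lambda>i r. f (res_gen n i r)"
  assumes A: "\<And>r. r < n \<Longrightarrow> coord_a 1 (V 1 (int r)) = twist r 1 (coord_a 0 (V 0 (int r)))"
  shows "V i (int r) = scale (coord_a 0 (V 0 (int r))) (twist r i (arr i))
     + scale (coord_b 1 (V 0 (int r))) (twist r i (odd_bar i))"
proof -
  have fc: "f \<in> cochains n" using f by simp
  have [simp]: "(of_nat n :: 2) = 1" using n by (auto elim!: oddE)
  have I: "V j q = idem j * V j q * idem (j + 1)" for j q
    using cochain_gen_idem[OF fc, of j q] by (simp add: V_def)
  have c: "coord_e j (V k q) = 0" "coord_s j (V k q) = 0" "j \<noteq> k \<Longrightarrow> coord_a j (V k q) = 0"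
    "j = k \<Longrightarrow> coord_b j (V k q) = 0" for j k q
    by (subst I, simp)+
  have V: "V j q = 0" if "q < 0 \<or> q > int n" for j q
    using that cochains_zero[OF fc] by (simp add: V_def)
  have e: "x + y = - z - w \<Longrightarrow> x + z + (y + w) = 0" "x + y = z + w \<Longrightarrow> x - z + (y - w) = 0" for x y z w :: 'k
    by (drule arg_cong[of _ _ "\<lambda>t. t + (z + w)"], simp add: algebra_simps) (simp add: algebra_simps)
  \<comment> \<open>The socle coordinate links bar arrows at index \<open>q\<close> with arrows
    \<open>arr\<close> at index \<open>q - 1\<close>; the cases \<open>q = 0\<close> and
    \<open>q = n + 1\<close> each lose one of the two kinds.\<close>
  have D: "coord_b 1 (V 0 q) + sgz q (coord_b 0 (V 1 q)) + (coord_a 0 (V 0 (q - 1)) + sgz q (coord_a 1 (V 1 (q - 1)))) = 0" for q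
  proof -
    have "coord_s 0 (diff_value n V 0 q) = 0"
      using f cocycle_iff[OF fc] by (simp add: V_def)
    then show ?thesis
      using n e by (cases "even q") (simp_all add: diff_value_def sgz_def c)
  qed
  have b: "coord_b 0 (V 1 (int r)) = - twist r 1 (coord_b 1 (V 0 (int r)))"
  proof (cases r)
    case 0
    then show ?thesis using D[of 0] by (simp add: V sgz_def twist_def eq_neg_iff_add_eq_0 add.commute)
  next
    case (Suc m)
    have "coord_a 0 (V 0 (int m)) + sgz (int r) (coord_a 1 (V 1 (int m))) = 0"
      using A[of m] r Suc by (auto simp: twist_def sgz_def)
    then show ?thesis
      using D[of "int r"] by (auto simp: Suc sgz_def twist_def eq_neg_iff_add_eq_0 add.commute split: if_splits)
  qed
  have a: "coord_a 1 (V 1 (int r)) = twist r 1 (coord_a 0 (V 0 (int r)))"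
  proof (cases "r < n")
    case False
    then have "r = n" using r by simp
    \<comment> \<open>At \<open>q = n + 1\<close> the bar arrows are out of range, which leaves the
      missing symmetry at index \<open>n\<close>.\<close>
    then show ?thesis using D[of "int n + 1"] n by (auto simp: V sgz_def twist_def eq_neg_iff_add_eq_0 add.commute)
  qed (rule A)
  show ?thesis
    using vertex_cases[of i]
    by (elim disjE) (auto intro!: lam_eqI simp: twist_def odd_bar_def c a b vertex_neq)
qed

text \<open>
  The part of the coefficients of \<open>a\<^sub>0\<close> and \<open>a\<^sub>1\<close> with the wrong symmetry can be removed because the
  coboundary of the cochain with value \<open>d e\<^sub>0\<close> changes it by \<open>2 d\<close>.
\<close>

lemma odd_adjust:
  fixes f :: "'k::field chain \<Rightarrow> 'k lam"
  assumes n: "odd n" and f: "f \<in> cocycles n" and two: "(2 :: 'k) \<noteq> 0"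
  obtains b where "b \<in> coboundaries n"
    "\<And>r. r < n \<Longrightarrow> coord_a 1 ((f - b) (res_gen n 1 (int r))) = twist r 1 (coord_a 0 ((f - b) (res_gen n 0 (int r))))"
proof -
  obtain m where m: "n = Suc m" "even m" using n by (cases n) auto
  let ?V = "\<lambda>i r. f (res_gen n i (int r))"
  \<comment> \<open>Half of the defect of symmetry: the coboundary has the coefficients
    \<open>d\<close> of \<open>a_0\<close> and \<open>-(-1)^r d\<close> of \<open>a_1\<close>, hence
    defect \<open>2 d\<close>.\<close>
  let ?d = "\<lambda>r. (coord_a 0 (?V 0 r) - twist r 1 (coord_a 1 (?V 1 r))) / 2"
  define u where "u = coch m (\<lambda>i r. if i = 0 then scale (?d r) (idem 0) else 0)"
  have uc: "u \<in> cochains m" by (simp add: u_def)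
  define b where "b = extend0 (Suc m) (u \<circ> diff (Suc m))"
  have U: "u (res_gen m i (int r)) = (if i = 0 then scale (?d r) (idem 0) else 0)" if "r \<le> m" for i r
    using m by (auto simp: u_def coch_res_gen[OF that] scale_mult_left scale_mult_right elim!: evenE)
  have bV: "b (res_gen n i (int r)) = diff_value m (\<lambda>i r. u (res_gen m i r)) i (int r)" for i r
    by (simp add: b_def extend0_def m(1) cochain_diff_gen[OF uc])
  have I: "idem i * u (res_gen m i q) * idem i = u (res_gen m i q)" for i q
    using cochain_gen_idem[OF uc, of i q] m by (auto elim!: evenE)
  have Ua: "coord_a j (u (res_gen m i q)) = 0" for i j q
    by (subst I[symmetric]) simp
  have d: "coord_a 0 (b (res_gen n 0 (int r))) = ?d r" "coord_a 1 (b (res_gen n 1 (int r))) = - twist r 1 (?d r)"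
    if "r < n" for r
  proof -
    have "r \<le> m" using that m by simp
    then show "coord_a 0 (b (res_gen n 0 (int r))) = ?d r" "coord_a 1 (b (res_gen n 1 (int r))) = - twist r 1 (?d r)"
      unfolding bV diff_value_def using m(2)
      by (simp_all add: U sgz_def twist_def Ua)
  qed
  have "coord_a 1 ((f - b) (res_gen n 1 (int r))) = twist r 1 (coord_a 0 ((f - b) (res_gen n 0 (int r))))"
    if "r < n" for r
  proof -
    let ?b = "coord_a 0 (b (res_gen n 0 (int r)))"
    have "2 * ?b = coord_a 0 (?V 0 r) - twist r 1 (coord_a 1 (?V 1 r))"
      unfolding d(1)[OF that] using two by simp
    then have 1: "coord_a 0 (?V 0 r) = 2 * ?b + twist r 1 (coord_a 1 (?V 1 r))"
      by (simp add: algebra_simps)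
    have 2: "coord_a 1 (b (res_gen n 1 (int r))) = - twist r 1 ?b"
      by (simp only: d[OF that])
    show ?thesis
      unfolding minus_apply coord_diff 1 2 by (simp add: twist_def)
  qed
  moreover have "b \<in> coboundaries n"
    using uc by (simp add: b_def m(1))
  ultimately show thesis by (rule that[rotated])
qed

lemma normalized_basic_0_1:
  "normalized 0 idem" "normalized 0 (soc_at j)" "normalized 1 arr" "normalized 1 odd_bar"
  by (simp_all add: normalized_idem normalized_basic)

text \<open>Stated for an arbitrary subalgebra containing the generators, since
  \<open>K_generated\<close> is the intersection of all of these.\<close>

lemma all_cocycles_represented:
  fixes S :: "(nat \<Rightarrow> ('k::field chain \<Rightarrow> 'k lam) set) set"
  assumes S: "K_subalgebra S HHA" and two: "(2 :: 'k) \<noteq> 0"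
    and gens: "{centre_class 1, centre_class (arr 0 * bar 0), centre_class (arr 1 * bar 1),
       phi_1_0, phi_1_m1, psi_1_0, psi_1_m1, chi_2_0, chi_2_1, chi_2_m1} \<subseteq> S"
    and f: "f \<in> cocycles n"
  shows "represents S n f"
proof -
  have chi: "homog 2 (chi_coch s) \<in> S" if "s \<le> 2" for s
  proof -
    have "s = 0 \<or> s = 1 \<or> s = 2" using that by auto
    then show ?thesis using gens by (auto simp: generators_eq)
  qed
  note g = gens[unfolded generators_eq insert_subset]
  have base_e: "represents S 0 (single_coch 0 0 (\<lambda>i. twist 0 i (idem i)))"
    using g twist_gen_cocycles(1)[of 0 0] unfolding represents_def by blast
  have base_s: "represents S 0 (single_coch 0 0 (\<lambda>i. twist 0 i (soc_at j i)))" for j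
    using g twist_gen_cocycles(2)[of 0 0] vertex_cases[of j] unfolding represents_def by blast
  have base_a: "represents S 1 (single_coch 1 r (\<lambda>i. twist r i (arr i)))"
    and base_b: "represents S 1 (single_coch 1 r (\<lambda>i. twist r i (odd_bar i)))" if "r \<le> 1" for r
  proof -
    have "r = 0 \<or> r = 1" using that by auto
    then have "homog 1 (single_coch 1 r (\<lambda>i. twist r i (arr i))) \<in> S"
      "homog 1 (single_coch 1 r (\<lambda>i. twist r i (odd_bar i))) \<in> S"
      using g by blast+
    then show "represents S 1 (single_coch 1 r (\<lambda>i. twist r i (arr i)))"
      "represents S 1 (single_coch 1 r (\<lambda>i. twist r i (odd_bar i)))"
      using twist_gen_cocycles(3,4)[OF that odd_one] by (simp_all add: represents_def)
  qed
  have fc: "f \<in> cochains n" using f by simp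
  show ?thesis
  proof (cases "even n")
    case True
    then obtain k where n: "n = 0 + 2 * k" by (auto elim!: evenE)
    have E: "represents S n (single_coch n r (\<lambda>i. twist r i (idem i)))"
      "represents S n (single_coch n r (\<lambda>i. twist r i (soc_at j i)))" if "r \<le> n" for r j
      unfolding n using that[unfolded n]
      by (intro represents_family[OF S _ _ chi] normalized_basic_0_1; simp add: base_e base_s del: twist_zero)+
    have "represents S n (single_coch n r (\<lambda>i. f (res_gen n i (int r))))" if "r \<le> n" for r
      \<comment> \<open>The values at index \<open>r\<close> are replaced by their normal form, a
        linear combination of families already represented.\<close>
      by (subst arg_cong[of _ _ "single_coch n r", OF ext, OF even_normal_form[OF True f]],
          unfold single_coch_add single_coch_scale)
        (intro represents_add[OF S] represents_scale[OF S] E that)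
    then show ?thesis
      by (subst single_coch_decomp[OF fc]) (auto intro!: represents_sum[OF S])
  next
    case False
    then obtain k where n: "n = 1 + 2 * k" by (auto elim!: oddE)
    have E: "represents S n (single_coch n r (\<lambda>i. twist r i (arr i)))"
      "represents S n (single_coch n r (\<lambda>i. twist r i (odd_bar i)))" if "r \<le> n" for r
      unfolding n using that[unfolded n]
      by (intro represents_family[OF S _ _ chi] normalized_basic_0_1 base_a base_b; simp)+
    obtain b where b: "b \<in> coboundaries n" and A: "\<And>r. r < n \<Longrightarrow> coord_a 1 ((f - b) (res_gen n 1 (int r)))
        = twist r 1 (coord_a 0 ((f - b) (res_gen n 0 (int r))))"
      using odd_adjust[OF False f two] by blast
    have g: "f - b \<in> cocycles n" using f b by simp
    have "represents S n (single_coch n r (\<lambda>i. (f - b) (res_gen n i (int r))))" if r: "r \<le> n" for r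
      by (subst arg_cong[of _ _ "single_coch n r", OF ext, OF odd_normal_form[OF False g r A]],
          assumption, unfold single_coch_add single_coch_scale)
        (intro represents_add[OF S] represents_scale[OF S] E that)
    then have "represents S n (f - b)"
      by (subst single_coch_decomp[OF cocycles_cochains[OF g]]) (auto intro!: represents_sum[OF S])
    then have "represents S n (f - b + b)"
      by (rule represents_add[OF S _ represents_coboundary[OF S b]])
    then show ?thesis by simp
  qed
qed

theorem theorem6p3:
  assumes "(2 :: 'k::field) \<noteq> 0"
  shows "K_algebra (HH_algebra :: ('k, nat \<Rightarrow> ('k chain \<Rightarrow> 'k lam) set) module) \<and>
    finitely_generated_by (HH_algebra :: ('k, nat \<Rightarrow> ('k chain \<Rightarrow> 'k lam) set) module)
      {centre_class 1, centre_class (arr 0 * bar 0), centre_class (arr 1 * bar 1),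
       phi_1_0, phi_1_m1, psi_1_0, psi_1_m1,
       chi_2_0, chi_2_1, chi_2_m1}" (is "_ \<and> finitely_generated_by _ ?G")
proof (intro conjI HH_K_algebra)
  interpret ring "HHA :: ('k, _) module" by (rule HH_ring)
  have h: "homog n f \<in> carrier HHA" if "f \<in> cocycles n" for n and f :: "'k chain \<Rightarrow> 'k lam"
    using that by (simp add: homog_total_class total_class_in_carrier homog_total_cocycle)
  have G: "?G \<subseteq> carrier HHA"
    unfolding generators_eq insert_subset
    by (intro conjI h twist_gen_cocycles chi_coch_cocycle empty_subsetI) simp_all
  have car: "K_subalgebra (carrier HHA) (HHA :: ('k, _) module)"
    unfolding K_subalgebra_def
    using carrier_is_subring HH_module[where 'k = 'k] Module.module.smult_closed[of "ring_of_type_algebra :: 'k ring" HHA]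
    by (auto simp: ring_of_type_algebra_def)
  have "carrier HHA \<subseteq> S" if S: "K_subalgebra S (HHA :: ('k, _) module)" "?G \<subseteq> S" for S
  proof
    fix z assume "z \<in> carrier (HHA :: ('k, _) module)"
    then obtain F where F: "F \<in> total_cocycles" "z = total_class F" by (rule HH_carrierE)
    show "z \<in> S"
      unfolding F(2)
      by (rule total_class_in_subalgebra[OF S(1) _ F(1)])
        (use all_cocycles_represented[OF S(1) assms S(2)] in \<open>simp add: represents_def\<close>)
  qed
  then have "K_generated HHA ?G = carrier HHA"
    unfolding K_generated_def using car G by blast
  then show "finitely_generated_by HHA ?G"
    using G by (simp add: finitely_generated_by_def)
qed

end
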